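(* Let $X'\subset\mathbb P(1,1,2,3,4,4,5,7)$, with weighted coordinates $x_0,x_1,y,w,u_0,u_1,z,t$, be defined by the $14$ relations $R_1,\dots,R_{14}$ given in the context, depending on parameters $\theta,\tau\in\mathbb C$ and a homogeneous form $P=P_{10}$ of degree $10$. These $14$ relations fit into a Pfaffian presentation \[\operatorname{Pf}_4 M=MV=0,\] where $M$ is the $6\times 6$ skew-symmetric matrix with entries above the diagonal \[ M=\begin{pmatrix} 0&0&x_0 & x_1^2 & u_0 \\ &0&x_1 & y & u_1 \\ &&u_0 & x_1u_1 & t\\ &&&t&-(\tau w^3+\theta u_1z)\\ &&&&P \end{pmatrix},\qquad V=\begin{pmatrix} 0 \\ -u_1^2 \\ 0 \\ w \\ -y \\ 0 \end{pmatrix}. \] For general choices of $P_{10}$ and $\tau$ the singular locus of $X'$ is one point of type $\frac1{25}(1,14)$.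
   Context: We work over $\mathbb C$. The weights of $x_0,x_1,y,w,u_0,u_1,z,t$ are $1,1,2,3,4,4,5,7$. $\operatorname{Pf}_4M$ denotes the collection of $4\times4$ sub-Pfaffians of $M$; diagonal zeros are omitted in the display, so the first displayed row lists the entries $(1,2),\dots,(1,6)$, the second $(2,3),\dots,(2,6)$, etc. The relations are: \begin{align*} R_1&\colon x_0y-x_1^3=0 & R_2&\colon x_0w-x_1^2y=0 \\ R_3&\colon x_1w-y^2=0 & R_4&\colon x_0u_1-x_1u_0=0\\ R_5&\colon x_1^2u_1-yu_0=0 & R_6&\colon x_1yu_1-wu_0=0 \\ R_7&\colon x_0t-u_0^2 =0 & R_8&\colon x_1t-u_0u_1=0\\ R_9&\colon x_1u_1^2-yt=0 & R_{10}&\colon yu_1^2-wt=0 \end{align*} \begin{align*} R_{11}&\colon x_0P+x_1^2(\theta u_1z+\tau w^3)+u_0t =0\\ R_{12}&\colon x_1P+y(\theta u_1z+\tau w^3)+u_1t=0\\ R_{13}&\colon yP+w(\theta u_1z+\tau w^3)+u_1^3=0\\ R_{14}&\colon u_0P+x_1u_1(\theta u_1z+\tau w^3)+t^2=0 \end{align*} where $P=z^2+\dots$ is a general homogeneous form of degree $10$. *)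

theory Defs
  imports
    Complex_Main
    "HOL-Library.Poly_Mapping"
    "HOL-Library.Extended_Nat"
    "HOL-Computational_Algebra.Fraction_Field"
    "HOL-Computational_Algebra.Formal_Power_Series"
    "HOL-Algebra.QuotRing"
    "HOL-Algebra.Ideal_Product"
    "Jordan_Normal_Form.Matrix"
begin

section \<open>Multivariate polynomials over the complex numbers\<close>

type_synonym 'v mpol = "('v \<Rightarrow>\<^sub>0 nat) \<Rightarrow>\<^sub>0 complex"

definition Var :: "'v \<Rightarrow> 'v mpol" where
  "Var v = Poly_Mapping.single (Poly_Mapping.single v 1) 1"

definition Const :: "complex \<Rightarrow> 'v mpol" where
  "Const c = Poly_Mapping.single 0 c"

definition eval_pol :: "'v mpol \<Rightarrow> ('v \<Rightarrow> complex) \<Rightarrow> complex" where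
  "eval_pol f a = (\<Sum>m\<in>Poly_Mapping.keys f. Poly_Mapping.lookup f m *
     (\<Prod>v\<in>Poly_Mapping.keys m. a v ^ Poly_Mapping.lookup m v))"

section \<open>Rings and local rings\<close>

text \<open>A subset of a commutative ring type, with the operations of that type.\<close>

definition ring_on :: "'a::comm_ring_1 set \<Rightarrow> 'a ring" where
  "ring_on A = \<lparr>carrier = A, mult = (*), one = 1, zero = 0, add = (+)\<rparr>"

definition krull_dim :: "('a, 'b) ring_scheme \<Rightarrow> enat" where
  "krull_dim R = Sup {enat n | n. \<exists>\<pp>. (\<forall>i\<le>n. primeideal (\<pp> i) R) \<and> (\<forall>i<n. \<pp> i \<subset> \<pp> (Suc i))}"

text \<open>The maximal ideal of a local ring.\<close>

definition nonunits :: "('a, 'b) ring_scheme \<Rightarrow> 'a set" where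
  "nonunits R = carrier R - Units R"

text \<open>
  Only meant for a Noetherian local ring \<open>R\<close>; the local rings below are localizations
  of finitely generated algebras over the complex numbers, hence Noetherian.
\<close>

definition regular_local_ring :: "('a, 'b) ring_scheme \<Rightarrow> bool" where
  "regular_local_ring R \<longleftrightarrow>
     (\<exists>F. finite F \<and> F \<subseteq> carrier R \<and> Idl\<^bsub>R\<^esub> F = nonunits R \<and> enat (card F) = krull_dim R)"

text \<open>
  The \<open>I\<close>-adic completion, as the inverse limit of the rings \<open>R / I^n\<close>. A residue class
  modulo \<open>I^n\<close> is a coset of \<open>I^n\<close>, so \<open>x (Suc n)\<close> maps to \<open>x n\<close> iff it is a subset of it.
\<close>

abbreviation ideal_pow :: "('a, 'b) ring_scheme \<Rightarrow> 'a set \<Rightarrow> nat \<Rightarrow> 'a set" where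
  "ideal_pow R I n \<equiv> I [^]\<^bsub>ideals_set R\<^esub> n"

definition completion :: "('a, 'b) ring_scheme \<Rightarrow> 'a set \<Rightarrow> (nat \<Rightarrow> 'a set) ring" where
  "completion R I =
     \<lparr>carrier = {x. \<forall>n. x n \<in> carrier (R Quot ideal_pow R I n) \<and> x (Suc n) \<subseteq> x n},
      mult = (\<lambda>x y n. x n \<otimes>\<^bsub>R Quot ideal_pow R I n\<^esub> y n),
      one = (\<lambda>n. \<one>\<^bsub>R Quot ideal_pow R I n\<^esub>),
      zero = (\<lambda>n. \<zero>\<^bsub>R Quot ideal_pow R I n\<^esub>),
      add = (\<lambda>x y n. x n \<oplus>\<^bsub>R Quot ideal_pow R I n\<^esub> y n)\<rparr>"

definition to_completion :: "('a, 'b) ring_scheme \<Rightarrow> 'a set \<Rightarrow> 'a \<Rightarrow> nat \<Rightarrow> 'a set" where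
  "to_completion R I a = (\<lambda>n. ideal_pow R I n +>\<^bsub>R\<^esub> a)"

section \<open>The weighted projective space and its subschemes\<close>

datatype coord = cx0 | cx1 | cy | cw | cu0 | cu1 | cz | ct

fun wt :: "coord \<Rightarrow> nat" where
  "wt cx0 = 1" | "wt cx1 = 1" | "wt cy = 2" | "wt cw = 3"
| "wt cu0 = 4" | "wt cu1 = 4" | "wt cz = 5" | "wt ct = 7"

text \<open>
  An arbitrary linear order on the coordinates: the library proves that polynomials form an
  integral domain (so that their fraction field exists) for linearly ordered variables only.
\<close>

fun coord_index :: "coord \<Rightarrow> nat" where
  "coord_index cx0 = 0" | "coord_index cx1 = 1" | "coord_index cy = 2" | "coord_index cw = 3"
| "coord_index cu0 = 4" | "coord_index cu1 = 5" | "coord_index cz = 6" | "coord_index ct = 7"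

lemma coord_index_inject: "coord_index a = coord_index b \<Longrightarrow> a = b"
  by (cases a; cases b) auto

instantiation coord :: linorder
begin

definition less_eq_coord :: "coord \<Rightarrow> coord \<Rightarrow> bool" where
  "less_eq_coord a b \<longleftrightarrow> coord_index a \<le> coord_index b"

definition less_coord :: "coord \<Rightarrow> coord \<Rightarrow> bool" where
  "less_coord a b \<longleftrightarrow> coord_index a < coord_index b"

instance
  by standard (auto simp: less_eq_coord_def less_coord_def coord_index_inject)

end

type_synonym pol = "coord mpol"

definition monomial_weight :: "(coord \<Rightarrow>\<^sub>0 nat) \<Rightarrow> nat" where
  "monomial_weight m = (\<Sum>v\<in>Poly_Mapping.keys m. Poly_Mapping.lookup m v * wt v)"

definition homogeneous :: "nat \<Rightarrow> pol \<Rightarrow> bool" where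
  "homogeneous d f \<longleftrightarrow> (\<forall>m\<in>Poly_Mapping.keys f. monomial_weight m = d)"

text \<open>Points of the weighted projective space are orbits of nonzero vectors under \<open>scale\<close>.\<close>

type_synonym point = "(coord \<Rightarrow> complex) set"

definition scale :: "complex \<Rightarrow> (coord \<Rightarrow> complex) \<Rightarrow> coord \<Rightarrow> complex" where
  "scale l a = (\<lambda>v. l ^ wt v * a v)"

definition wproj :: "point set" where
  "wproj = {{scale l a | l. l \<noteq> 0} | a. a \<noteq> (\<lambda>_. 0)}"

definition zero_locus :: "pol set \<Rightarrow> point set" where
  "zero_locus E = {p \<in> wproj. \<forall>a\<in>p. \<forall>f\<in>E. eval_pol f a = 0}"

definition pol_ideal :: "pol set \<Rightarrow> pol set" where
  "pol_ideal E = Idl\<^bsub>ring_on UNIV\<^esub> E"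

text \<open>
  The local ring at \<open>p\<close> of the weighted projective space is the degree \<open>0\<close> part of the
  homogeneous localization of the polynomial ring at the ideal of \<open>p\<close>, realized inside the
  field of fractions. For a set \<open>E\<close> of homogeneous polynomials, the closed subscheme defined
  by \<open>E\<close> (the \<open>Proj\<close> of the polynomial ring modulo the ideal of \<open>E\<close>) has as its local ring
  the quotient by the degree \<open>0\<close> part of the localized ideal.
\<close>

definition ambient_local_ring :: "point \<Rightarrow> pol fract ring" where
  "ambient_local_ring p = ring_on {Fract f g | f g d.
     homogeneous d f \<and> homogeneous d g \<and> (\<forall>a\<in>p. eval_pol g a \<noteq> 0)}"

definition local_ideal :: "pol set \<Rightarrow> point \<Rightarrow> pol fract set" where
  "local_ideal E p = {Fract f g | f g d. f \<in> pol_ideal E \<and>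
     homogeneous d f \<and> homogeneous d g \<and> (\<forall>a\<in>p. eval_pol g a \<noteq> 0)}"

definition local_ring :: "pol set \<Rightarrow> point \<Rightarrow> pol fract set ring" where
  "local_ring E p = ambient_local_ring p Quot local_ideal E p"

definition local_const :: "pol set \<Rightarrow> point \<Rightarrow> complex \<Rightarrow> pol fract set" where
  "local_const E p c = local_ideal E p +>\<^bsub>ambient_local_ring p\<^esub> Fract (Const c) 1"

definition singular_locus :: "pol set \<Rightarrow> point set" where
  "singular_locus E = {p \<in> zero_locus E. \<not> regular_local_ring (local_ring E p)}"

section \<open>Cyclic quotient singularities of surfaces\<close>

text \<open>
  Power series in two variables \<open>s\<close>, \<open>t\<close> are of type \<^typ>\<open>complex fps fps\<close>; the coefficient
  of \<open>s^i t^j\<close> in \<open>F\<close> is \<open>fps_nth (fps_nth F j) i\<close>. The diagonal substitution maps \<open>F(s, t)\<close>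
  to \<open>F(e^a s, e^b t)\<close>, and the completed local ring at the origin of the quotient of the
  plane by the \<open>r\<close>-th roots of unity acting with weights \<open>a\<close>, \<open>b\<close> is the ring of invariants.
\<close>

definition diag_subst :: "nat \<Rightarrow> nat \<Rightarrow> complex \<Rightarrow> complex fps fps \<Rightarrow> complex fps fps" where
  "diag_subst a b e F = Abs_fps (\<lambda>j. Abs_fps (\<lambda>i. (e ^ a) ^ i * (e ^ b) ^ j * fps_nth (fps_nth F j) i))"

definition quotient_plane_ring :: "nat \<Rightarrow> nat \<Rightarrow> nat \<Rightarrow> complex fps fps ring" where
  "quotient_plane_ring r a b = ring_on {F. \<forall>e. e ^ r = 1 \<longrightarrow> diag_subst a b e F = F}"

text \<open>
  The point \<open>p\<close> is of type \<open>1/r(a,b)\<close> if it is analytically isomorphic to the origin of that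
  quotient, i.e. the completed local rings are isomorphic as algebras over the complex numbers.
\<close>

definition of_type :: "pol set \<Rightarrow> point \<Rightarrow> nat \<Rightarrow> nat \<Rightarrow> nat \<Rightarrow> bool" where
  "of_type E p r a b \<longleftrightarrow> p \<in> zero_locus E \<and>
     (let R = local_ring E p; \<mm> = nonunits R in
      \<exists>h \<in> ring_iso (completion R \<mm>) (quotient_plane_ring r a b).
        \<forall>c. h (to_completion R \<mm> (local_const E p c)) = fps_const (fps_const c))"

section \<open>The family of surfaces\<close>

definition relations :: "complex \<Rightarrow> complex \<Rightarrow> pol \<Rightarrow> pol set" where
  "relations \<theta> \<tau> P =
    (let x0 = Var cx0; x1 = Var cx1; y = Var cy; w = Var cw;
         u0 = Var cu0; u1 = Var cu1; z = Var cz; t = Var ct;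
         Q = Const \<theta> * u1 * z + Const \<tau> * w ^ 3
     in
      {x0 * y - x1 ^ 3,
       x0 * w - x1 ^ 2 * y,
       x1 * w - y ^ 2,
       x0 * u1 - x1 * u0,
       x1 ^ 2 * u1 - y * u0,
       x1 * y * u1 - w * u0,
       x0 * t - u0 ^ 2,
       x1 * t - u0 * u1,
       x1 * u1 ^ 2 - y * t,
       y * u1 ^ 2 - w * t,
       x0 * P + x1 ^ 2 * Q + u0 * t,
       x1 * P + y * Q + u1 * t,
       y * P + w * Q + u1 ^ 3,
       u0 * P + x1 * u1 * Q + t ^ 2})"

text \<open>
  The skew-symmetric matrix with strictly upper triangular entries listed row by row:
  the entry \<open>(i, j)\<close>, \<open>i < j\<close>, is element number \<open>j - i - 1\<close> of row \<open>i\<close>, counting from \<open>0\<close>.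
\<close>

definition skew_mat :: "nat \<Rightarrow> 'a::comm_ring_1 list list \<Rightarrow> 'a mat" where
  "skew_mat n es = mat n n (\<lambda>(i, j).
     if i < j then es ! i ! (j - i - 1) else if j < i then - (es ! j ! (i - j - 1)) else 0)"

definition M_mat :: "complex \<Rightarrow> complex \<Rightarrow> pol \<Rightarrow> pol mat" where
  "M_mat \<theta> \<tau> P =
    (let x0 = Var cx0; x1 = Var cx1; y = Var cy; w = Var cw;
         u0 = Var cu0; u1 = Var cu1; z = Var cz; t = Var ct
     in skew_mat 6
      [[0, 0, x0, x1 ^ 2, u0],
          [0, x1, y, u1],
             [u0, x1 * u1, t],
                 [t, - (Const \<tau> * w ^ 3 + Const \<theta> * u1 * z)],
                    [P]])"

definition V_vec :: "pol vec" where
  "V_vec = vec_of_list [0, - (Var cu1 ^ 2), 0, Var cw, - Var cy, 0]"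

definition Pf4 :: "'a::comm_ring_1 mat \<Rightarrow> 'a set" where
  "Pf4 A = {A $$ (i, j) * A $$ (k, l) - A $$ (i, k) * A $$ (j, l) + A $$ (i, l) * A $$ (j, k)
            | i j k l. i < j \<and> j < k \<and> k < l \<and> l < dim_row A}"

section \<open>General choices of the parameters\<close>

text \<open>The forms \<open>P = z^2 + ...\<close> of degree \<open>10\<close>.\<close>

definition P10_forms :: "pol set" where
  "P10_forms = {P. homogeneous 10 P \<and>
     Poly_Mapping.lookup P (Poly_Mapping.single cz 2) = 1}"

text \<open>
  The pairs \<open>(\<tau>, P)\<close> form an affine space whose coordinates are \<open>\<tau>\<close> (index \<open>None\<close>) and the
  coefficients of \<open>P\<close> (index \<open>Some m\<close> for a monomial \<open>m\<close>). A property holds for general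
  \<open>(\<tau>, P)\<close> if it holds off the zeros of some polynomial that is not identically zero on it,
  i.e. on a nonempty Zariski open set.
\<close>

definition for_general :: "(complex \<Rightarrow> pol \<Rightarrow> bool) \<Rightarrow> bool" where
  "for_general Q \<longleftrightarrow> (\<exists>D :: (coord \<Rightarrow>\<^sub>0 nat) option mpol.
     let nonzero = (\<lambda>\<tau> P. eval_pol D (case_option \<tau> (Poly_Mapping.lookup P)) \<noteq> 0) in
     (\<exists>\<tau>. \<exists>P\<in>P10_forms. nonzero \<tau> P) \<and> (\<forall>\<tau>. \<forall>P\<in>P10_forms. nonzero \<tau> P \<longrightarrow> Q \<tau> P))"

end

theory Submission
  imports Defs "HOL-Computational_Algebra.Polynomial"
begin

text \<open>
  Write \<open>Q = \<theta> u\<^sub>1 z + \<tau> w\<^sup>3\<close>. The substitution (\<open>toric\<close>)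

  \<open>x\<^sub>0 = l\<^sup>5, x\<^sub>1 = a l\<^sup>2, y = a\<^sup>3 l, w = a\<^sup>5, u\<^sub>0 = b l\<^sup>3, u\<^sub>1 = a b, t = b\<^sup>2 l\<close>

  turns the ten binomial relations into identities, and each of the other four into a monomial times
  the single equation \<open>l P + a\<^sup>2 Q + b\<^sup>3 = 0\<close>. Up to a factor \<open>5\<close> the weights of \<open>l, a, b, z\<close> are
  \<open>1, 3, 17, 25\<close>, so the surface is, locally and up to cyclic groups, a hypersurface of degree \<open>51\<close> in
  the weighted projective space with these weights. The Pfaffian presentation is an expansion of
  fifteen Pfaffians and one matrix product. The points of the surface are of three kinds.

  If \<open>x\<^sub>0 \<noteq> 0\<close>, put \<open>l = 1\<close>: the surface becomes the hypersurface \<open>affine_eq\<close> in affine space with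
  coordinates \<open>x\<^sub>1, u\<^sub>0, z\<close>, and a nonzero partial derivative leaves two of the coordinates as
  generators of the maximal ideal (\<open>regular_affine_chart\<close>). For general \<open>(\<tau>, P)\<close> this hypersurface is
  smooth (\<open>general_smooth\<close>): the monomials \<open>x\<^sub>0\<^sup>1\<^sup>0, x\<^sub>0\<^sup>9 x\<^sub>1, x\<^sub>0\<^sup>6 u\<^sub>0, x\<^sub>0\<^sup>5 z\<close> of \<open>P\<close> restrict to
  \<open>1, x\<^sub>1, u\<^sub>0, z\<close>, so a singular point determines their four coefficients in terms of its three
  coordinates and the other coefficients. The singular members thus lie in the polynomial image of a
  space of one dimension less, and counting monomials shows that such an image satisfies a polynomial
  equation (\<open>polynomial_relation\<close>).

  If \<open>x\<^sub>0 = 0\<close>, then \<open>x\<^sub>1 = y = u\<^sub>0 = t = 0\<close> and \<open>w Q + u\<^sub>1\<^sup>3 = 0\<close>. For \<open>\<tau> \<noteq> 0\<close> either \<open>w\<close> and \<open>u\<^sub>1\<close> are both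
  nonzero, and the point is regular (\<open>regular_on_curve\<close>), or only \<open>z\<close> is nonzero.

  At that last point \<open>P = z\<^sup>2 + ...\<close> is a unit, so Hensel's lemma solves the equation for \<open>l\<close> as a power
  series in \<open>a\<close> and \<open>b\<close>, and the local ring maps to the power series ring. Inverting \<open>P\<close>, the relations
  express every coordinate as a polynomial in \<open>w = a\<^sup>5\<close>, \<open>u\<^sub>1 = a b\<close>, \<open>z\<close> and a form \<open>T\<close> that maps to
  \<open>b\<^sup>5\<close>. In degree \<open>0\<close> these give exactly the monomials \<open>a\<^sup>p b\<^sup>q\<close> with \<open>25 dvd p + 14 q\<close>, so the completed
  local ring is the ring of invariants of the \<open>25\<close>-th roots of unity (\<open>completed_local_ring\<close>). The point is
  singular, since \<open>a\<^sup>2\<^sup>5, a\<^sup>1\<^sup>1 b, b\<^sup>2\<^sup>5\<close> are linearly independent modulo the square of the maximal ideal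
  while the dimension is at most two (\<open>not_regular\<close>).

  Dimensions enter only through two inequalities. The graded pieces of the coordinate ring grow
  quadratically, so any three elements of a local ring are algebraically dependent, which excludes
  chains of four primes (\<open>krull_dim_R\<close>). Conversely, a homomorphism to power series in two variables
  produces a chain of three primes (\<open>krull_dim_ge_2\<close>).
\<close>

section \<open>Evaluation of polynomials\<close>

abbreviation (input) "lookup \<equiv> Poly_Mapping.lookup"
abbreviation (input) "keys \<equiv> Poly_Mapping.keys"
abbreviation (input) "single \<equiv> Poly_Mapping.single"

lemma single_in_sum:
  fixes f :: "'a \<Rightarrow>\<^sub>0 'b::comm_monoid_add"
  shows "f = (\<Sum>m\<in>keys f. single m (lookup f m))"
proof (rule poly_mapping_eqI)
  fix k
  have "(\<Sum>m\<in>keys f. lookup (single m (lookup f m)) k) = lookup f k"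
  proof (cases "k \<in> keys f")
    case True
    then have "(\<Sum>m\<in>keys f. lookup (single m (lookup f m)) k)
       = (\<Sum>m\<in>keys f. if m = k then lookup f k else 0)"
      by (intro sum.cong) (auto simp: lookup_single)
    with True show ?thesis by simp
  next
    case False
    then have "(\<Sum>m\<in>keys f. lookup (single m (lookup f m)) k) = 0"
      by (intro sum.neutral) (auto simp: lookup_single when_def)
    with False show ?thesis by (simp add: in_keys_iff)
  qed
  then show "lookup f k = lookup (\<Sum>m\<in>keys f. single m (lookup f m)) k"
    by (simp add: lookup_sum)
qed

definition monom_eval :: "('v \<Rightarrow> 'r::comm_ring_1) \<Rightarrow> ('v \<Rightarrow>\<^sub>0 nat) \<Rightarrow> 'r" where
  "monom_eval X m = (\<Prod>v\<in>keys m. X v ^ lookup m v)"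

lemma monom_eval_superset:
  assumes "finite V" "keys m \<subseteq> V"
  shows "monom_eval X m = (\<Prod>v\<in>V. X v ^ lookup m v)"
  unfolding monom_eval_def
  by (rule prod.mono_neutral_left) (use assms in \<open>auto simp: in_keys_iff\<close>)

lemma monom_eval_0 [simp]: "monom_eval X 0 = 1"
  by (simp add: monom_eval_def)

lemma monom_eval_add: "monom_eval X (m + n) = monom_eval X m * monom_eval X n"
proof -
  have k: "keys (m + n) \<subseteq> keys m \<union> keys n" by (rule keys_add)
  show ?thesis
    by (subst (1 2 3) monom_eval_superset[where V = "keys m \<union> keys n"])
      (use k in \<open>auto simp: lookup_add power_add prod.distrib\<close>)
qed

lemma monom_eval_single: "monom_eval X (single v k) = X v ^ k"
  by (cases "k = 0") (simp_all add: monom_eval_def)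

lemma monom_eval_scale:
  "monom_eval (\<lambda>v. l ^ wt v * X v) m = l ^ monomial_weight m * monom_eval X m"
  by (simp add: monom_eval_def monomial_weight_def power_mult_distrib prod.distrib
      power_sum mult.commute flip: power_mult)

text \<open>
  Coefficients are mapped by \<open>h\<close>, so that the same polynomial can be evaluated at complex numbers, at
  polynomials, at power series and at elements of a local ring.
\<close>

definition eval_hom :: "(complex \<Rightarrow> 'r::comm_ring_1) \<Rightarrow> ('v \<Rightarrow> 'r) \<Rightarrow> 'v mpol \<Rightarrow> 'r" where
  "eval_hom h X f = (\<Sum>m\<in>keys f. h (lookup f m) * monom_eval X m)"

locale coeff_hom =
  fixes h :: "complex \<Rightarrow> 'r::comm_ring_1"
  assumes h_add: "h (c + d) = h c + h d"
    and h_mult: "h (c * d) = h c * h d"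
    and h_one: "h 1 = 1"
begin

lemma h_zero: "h 0 = 0"
  using h_add[of 0 0] by simp

lemma h_uminus: "h (- c) = - h c"
  using h_add[of c "- c"] by (simp add: eq_neg_iff_add_eq_0 add.commute h_zero)

lemma h_sum: "h (sum c A) = (\<Sum>x\<in>A. h (c x))"
  by (induction A rule: infinite_finite_induct) (auto simp: h_add h_zero)

lemma h_power: "h (c ^ n) = h c ^ n"
  by (induction n) (auto simp: h_mult h_one)

lemma h_of_nat: "h (of_nat n) = of_nat n"
  by (induction n) (auto simp: h_add h_one h_zero)

lemma h_unit: "c \<noteq> 0 \<Longrightarrow> h c * h (inverse c) = 1"
  by (simp add: h_one flip: h_mult)

lemma eval_hom_superset:
  assumes "finite K" "keys f \<subseteq> K"
  shows "eval_hom h X f = (\<Sum>m\<in>K. h (lookup f m) * monom_eval X m)"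
  unfolding eval_hom_def
  by (rule sum.mono_neutral_left) (use assms in \<open>auto simp: in_keys_iff h_zero\<close>)

lemma eval_hom_zero [simp]: "eval_hom h X 0 = 0"
  by (simp add: eval_hom_def)

lemma eval_hom_add: "eval_hom h X (f + g) = eval_hom h X f + eval_hom h X g"
proof -
  have k: "keys (f + g) \<subseteq> keys f \<union> keys g" by (rule keys_add)
  show ?thesis
    by (subst (1 2 3) eval_hom_superset[where K = "keys f \<union> keys g"])
      (use k in \<open>auto simp: lookup_add h_add ring_distribs sum.distrib\<close>)
qed

lemma eval_hom_sum: "eval_hom h X (sum f A) = (\<Sum>x\<in>A. eval_hom h X (f x))"
  by (induction A rule: infinite_finite_induct) (auto simp: eval_hom_add)

lemma eval_hom_single: "eval_hom h X (single m c) = h c * monom_eval X m"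
  by (cases "c = 0") (simp_all add: eval_hom_def h_zero)

lemma eval_hom_mult: "eval_hom h X (f * g) = eval_hom h X f * eval_hom h X g"
proof -
  have "f * g = (\<Sum>m\<in>keys f. \<Sum>n\<in>keys g. single (m + n) (lookup f m * lookup g n))"
    by (subst (1) single_in_sum[of f], subst (1) single_in_sum[of g])
      (simp add: sum_product mult_single)
  then have "eval_hom h X (f * g) =
     (\<Sum>m\<in>keys f. \<Sum>n\<in>keys g. h (lookup f m * lookup g n) * monom_eval X (m + n))"
    by (simp add: eval_hom_sum eval_hom_single)
  also have "\<dots> = eval_hom h X f * eval_hom h X g"
    by (simp add: eval_hom_def sum_product h_mult monom_eval_add mult_ac)
  finally show ?thesis .
qed

lemma eval_hom_Const [simp]: "eval_hom h X (Const c) = h c"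
  by (simp add: Const_def eval_hom_single)

lemma eval_hom_Var [simp]: "eval_hom h X (Var v) = X v"
  by (simp add: Var_def eval_hom_single monom_eval_single h_one)

lemma eval_hom_one [simp]: "eval_hom h X 1 = 1"
  using eval_hom_Const[of X 1] by (simp add: Const_def h_one del: eval_hom_Const)

lemma eval_hom_uminus: "eval_hom h X (- f) = - eval_hom h X f"
  using eval_hom_add[of X f "- f"] by (simp add: eq_neg_iff_add_eq_0 add.commute)

lemma eval_hom_diff: "eval_hom h X (f - g) = eval_hom h X f - eval_hom h X g"
  using eval_hom_add[of X f "- g"] by (simp add: eval_hom_uminus)

lemma eval_hom_power: "eval_hom h X (f ^ n) = eval_hom h X f ^ n"
  by (induction n) (auto simp: eval_hom_mult)

lemma eval_hom_prod: "eval_hom h X (prod f A) = (\<Prod>x\<in>A. eval_hom h X (f x))"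
  by (induction A rule: infinite_finite_induct) (auto simp: eval_hom_mult)

lemmas eval_hom_simps = eval_hom_add eval_hom_mult eval_hom_uminus eval_hom_diff eval_hom_power

lemma eval_hom_scale:
  assumes "homogeneous d f"
  shows "eval_hom h (\<lambda>v. l ^ wt v * X v) f = l ^ d * eval_hom h X f"
  using assms unfolding eval_hom_def sum_distrib_left monom_eval_scale homogeneous_def
  by (intro sum.cong) (auto simp: mult_ac)

end

lemma Const_add: "Const (c + d) = Const c + Const d"
  and Const_mult: "Const (c * d) = Const c * Const d"
  and Const_one: "Const 1 = 1"
  and Const_zero: "Const 0 = 0"
  by (simp_all add: Const_def single_add mult_single)

interpretation id_hom: coeff_hom "\<lambda>c::complex. c"
  by standard auto

interpretation Const_hom: coeff_hom "Const :: complex \<Rightarrow> 'v mpol"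
  by standard (simp_all add: Const_add Const_mult Const_one)

lemma eval_pol_eq: "eval_pol f a = eval_hom (\<lambda>c. c) a f"
  by (simp add: eval_pol_def eval_hom_def monom_eval_def)

lemma single_eq_Const_monom:
  "single m c = Const c * monom_eval Var m"
proof -
  have 1: "single (single v k) 1 = Var v ^ k" for v :: 'v and k
  proof (induction k)
    case (Suc k)
    have "single (single v (Suc k)) (1::complex) =
        single (single v 1) 1 * single (single v k) 1"
      by (simp add: mult_single flip: single_add)
    with Suc show ?case by (simp add: Var_def)
  qed auto
  have 2: "single (\<Sum>v\<in>V. single v (k v)) (1::complex) = (\<Prod>v\<in>V. Var v ^ k v)"
    if "finite V" for V :: "'v set" and k
    using that
  proof (induction V)
    case (insert v V)
    have "single (\<Sum>v\<in>insert v V. single v (k v)) (1::complex) =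
      single (single v (k v)) 1 *
        single (\<Sum>v\<in>V. single v (k v)) 1"
      using insert.hyps by (simp add: mult_single)
    with insert show ?case by (simp add: 1)
  qed simp
  have "single m (1::complex) = monom_eval Var m"
    by (subst single_in_sum[of m], subst 2) (simp_all add: monom_eval_def)
  then show ?thesis
    by (metis Const_def add_0 mult.right_neutral mult_single)
qed

lemma mpol_induct [case_names Const Var add mult]:
  assumes "\<And>c. Q (Const c)" "\<And>v. Q (Var v)" "\<And>f g. Q f \<Longrightarrow> Q g \<Longrightarrow> Q (f + g)"
    "\<And>f g. Q f \<Longrightarrow> Q g \<Longrightarrow> Q (f * g)"
  shows "Q f"
proof -
  have pw: "Q (Var v ^ k)" for v k
    by (induction k) (use assms Const_one in \<open>metis power_0 power_Suc\<close>)+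
  have pr: "Q (\<Prod>v\<in>V. Var v ^ k v)" if "finite V" for V and k :: "'a \<Rightarrow> nat"
    using that by (induction V) (use assms(1)[of 1] assms(4) pw in \<open>auto simp: Const_one\<close>)
  have "Q (\<Sum>m\<in>K. single m (c m))" if "finite K" for K c
    using that
    by (induction K) (use assms(1)[of 0] pr assms(1,3,4) in
      \<open>auto simp: Const_zero single_eq_Const_monom monom_eval_def\<close>)
  then show ?thesis by (subst single_in_sum) simp
qed

text \<open>
  All the compatibilities between the different evaluations of a polynomial are instances of this lemma.
\<close>

lemma eval_hom_compose:
  assumes h: "coeff_hom h" and k: "coeff_hom k"
    and add: "\<And>x y. g (x + y) = g x + g y" and mult: "\<And>x y. g (x * y) = g x * g y"
    and hk: "\<And>c. g (h c) = k c"
  shows "g (eval_hom h X f) = eval_hom k (\<lambda>v. g (X v)) f"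
  by (induction f rule: mpol_induct)
    (simp_all add: coeff_hom.eval_hom_simps[OF h] coeff_hom.eval_hom_simps[OF k]
      coeff_hom.eval_hom_Const[OF h] coeff_hom.eval_hom_Const[OF k]
      coeff_hom.eval_hom_Var[OF h] coeff_hom.eval_hom_Var[OF k] add mult hk)

lemma eval_hom_Const_Var [simp]: "eval_hom Const Var f = f"
  by (induction f rule: mpol_induct) (simp_all add: Const_hom.eval_hom_simps)

section \<open>Homogeneous polynomials\<close>

lemma monomial_weight_superset:
  assumes "finite V" "keys m \<subseteq> V"
  shows "monomial_weight m = (\<Sum>v\<in>V. lookup m v * wt v)"
  unfolding monomial_weight_def
  by (rule sum.mono_neutral_left) (use assms in \<open>auto simp: in_keys_iff\<close>)

lemma monomial_weight_add: "monomial_weight (m + n) = monomial_weight m + monomial_weight n"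
proof -
  have k: "keys (m + n) \<subseteq> keys m \<union> keys n" by (rule keys_add)
  show ?thesis
    by (subst (1 2 3) monomial_weight_superset[where V = "keys m \<union> keys n"])
      (use k in \<open>auto simp: lookup_add sum.distrib ring_distribs\<close>)
qed

lemma monomial_weight_single: "monomial_weight (single v k) = k * wt v"
  by (simp add: monomial_weight_def)

lemma homogeneous_zero [simp]: "homogeneous d 0"
  by (simp add: homogeneous_def)

lemma homogeneous_single: "monomial_weight m = d \<Longrightarrow> homogeneous d (single m c)"
  by (auto simp: homogeneous_def)

lemma homogeneous_Const [simp]: "homogeneous 0 (Const c)"
  by (simp add: Const_def homogeneous_single monomial_weight_def)

lemma homogeneous_one [simp]: "homogeneous 0 1"
  by (metis Const_one homogeneous_Const)

lemma homogeneous_Var: "homogeneous (wt v) (Var v)"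
  by (simp add: Var_def homogeneous_single monomial_weight_single)

lemma homogeneous_add: "homogeneous d f \<Longrightarrow> homogeneous d g \<Longrightarrow> homogeneous d (f + g)"
  using keys_add[of f g] by (auto simp: homogeneous_def)

lemma homogeneous_uminus: "homogeneous d f \<Longrightarrow> homogeneous d (- f)"
  by (simp add: homogeneous_def in_keys_iff)

lemma homogeneous_diff: "homogeneous d f \<Longrightarrow> homogeneous d g \<Longrightarrow> homogeneous d (f - g)"
  using homogeneous_add[of d f "- g"] by (simp add: homogeneous_uminus)

lemma homogeneous_mult: "homogeneous d f \<Longrightarrow> homogeneous e g \<Longrightarrow> homogeneous (d + e) (f * g)"
  using keys_mult[of f g] by (fastforce simp: homogeneous_def monomial_weight_add)

lemma homogeneous_power: "homogeneous d f \<Longrightarrow> homogeneous (n * d) (f ^ n)"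
  by (induction n) (auto simp: homogeneous_mult)

lemma homogeneous_sum: "(\<And>x. x \<in> A \<Longrightarrow> homogeneous d (f x)) \<Longrightarrow> homogeneous d (sum f A)"
  by (induction A rule: infinite_finite_induct) (auto simp: homogeneous_add)

section \<open>Quotients of rings that live inside a type\<close>

lemma ring_on_simps [simp]:
  "carrier (ring_on A) = A" "mult (ring_on A) = (*)" "one (ring_on A) = 1"
  "zero (ring_on A) = 0" "add (ring_on A) = (+)"
  by (simp_all add: ring_on_def)

lemma cring_ring_on:
  fixes A :: "'a::comm_ring_1 set"
  assumes "0 \<in> A" "1 \<in> A" "\<And>x y. x \<in> A \<Longrightarrow> y \<in> A \<Longrightarrow> x + y \<in> A"
    "\<And>x y. x \<in> A \<Longrightarrow> y \<in> A \<Longrightarrow> x * y \<in> A" "\<And>x. x \<in> A \<Longrightarrow> - x \<in> A"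
  shows "cring (ring_on A)"
proof (rule cringI)
  show "abelian_group (ring_on A)"
  proof (rule abelian_groupI)
    fix x assume "x \<in> carrier (ring_on A)"
    then show "\<exists>y\<in>carrier (ring_on A). y \<oplus>\<^bsub>ring_on A\<^esub> x = \<zero>\<^bsub>ring_on A\<^esub>"
      using assms(5)[of x] by (intro bexI[of _ "- x"]) auto
  qed (use assms in \<open>auto simp: algebra_simps\<close>)
  show "Group.comm_monoid (ring_on A)"
    by (rule comm_monoidI) (use assms in \<open>auto simp: algebra_simps\<close>)
qed (auto simp: algebra_simps)

lemma cring_ring_on_UNIV: "cring (ring_on (UNIV :: 'a::comm_ring_1 set))"
  by (rule cring_ring_on) auto

text \<open>
  The local rings are quotients \<open>A / I\<close> of subrings of a field. Stating membership in \<open>A\<close> and \<open>I\<close> with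
  the operations of the field avoids computing with cosets.
\<close>

locale subring_quot =
  fixes A I :: "'a::comm_ring_1 set"
  assumes A_0: "0 \<in> A" and A_1: "1 \<in> A"
    and A_add: "x \<in> A \<Longrightarrow> y \<in> A \<Longrightarrow> x + y \<in> A"
    and A_mult: "x \<in> A \<Longrightarrow> y \<in> A \<Longrightarrow> x * y \<in> A"
    and A_uminus: "x \<in> A \<Longrightarrow> - x \<in> A"
    and I_sub: "I \<subseteq> A"
    and I_0: "0 \<in> I"
    and I_add: "x \<in> I \<Longrightarrow> y \<in> I \<Longrightarrow> x + y \<in> I"
    and I_mult: "x \<in> A \<Longrightarrow> y \<in> I \<Longrightarrow> x * y \<in> I"
begin

lemma A_diff: "x \<in> A \<Longrightarrow> y \<in> A \<Longrightarrow> x - y \<in> A"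
  using A_add[of x "- y"] A_uminus[of y] by simp

lemma A_power: "x \<in> A \<Longrightarrow> x ^ n \<in> A"
  by (induction n) (auto simp: A_1 A_mult)

lemma A_sum: "(\<And>x. x \<in> S \<Longrightarrow> f x \<in> A) \<Longrightarrow> sum f S \<in> A"
  by (induction S rule: infinite_finite_induct) (auto simp: A_0 A_add)

lemma I_uminus: "x \<in> I \<Longrightarrow> - x \<in> I"
  using I_mult[of "- 1" x] A_uminus[OF A_1] by simp

lemma I_diff: "x \<in> I \<Longrightarrow> y \<in> I \<Longrightarrow> x - y \<in> I"
  using I_add[of x "- y"] I_uminus[of y] by simp

lemma I_mult_r: "x \<in> I \<Longrightarrow> y \<in> A \<Longrightarrow> x * y \<in> I"
  using I_mult[of y x] by (simp add: mult.commute)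

lemma cring_A: "cring (ring_on A)"
  by (rule cring_ring_on) (auto intro: A_0 A_1 A_add A_mult A_uminus)

lemma ideal_I: "ideal I (ring_on A)"
proof (rule idealI)
  interpret cring "ring_on A" by (rule cring_A)
  show "ring (ring_on A)" by (rule ring_axioms)
  show "subgroup I (add_monoid (ring_on A))"
  proof (rule group.subgroupI)
    show "Group.group (add_monoid (ring_on A))" by (rule add.is_group)
    fix x assume x: "x \<in> I"
    then have "\<ominus>\<^bsub>ring_on A\<^esub> x = - x"
      using I_sub A_uminus by (intro minus_equality) auto
    with x show "inv\<^bsub>add_monoid (ring_on A)\<^esub> x \<in> I"
      by (simp add: a_inv_def I_uminus)
  qed (use I_sub I_0 I_add in auto)
qed (auto intro: I_mult I_mult_r)

abbreviation "R \<equiv> ring_on A Quot I"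

definition proj :: "'a \<Rightarrow> 'a set" where "proj x = I +>\<^bsub>ring_on A\<^esub> x"

lemma proj_eq: "proj x = (\<lambda>i. i + x) ` I"
  by (auto simp: proj_def a_r_coset_def' )

lemma proj_self: "x \<in> proj x"
  unfolding proj_eq using I_0 by (intro image_eqI[of _ _ 0]) auto

lemma mem_proj: "y \<in> proj x \<longleftrightarrow> y - x \<in> I"
  unfolding proj_eq by (auto intro!: image_eqI[of _ _ "y - x"])

lemma proj_eq_iff: "proj x = proj y \<longleftrightarrow> x - y \<in> I"
proof
  assume "proj x = proj y" then show "x - y \<in> I" using proj_self[of x] by (simp add: mem_proj)
next
  assume xy: "x - y \<in> I"
  show "proj x = proj y"
  proof (rule Set.set_eqI)
    fix z
    have "z - x \<in> I \<Longrightarrow> z - y \<in> I" using I_add[OF _ xy, of "z - x"] by simp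
    moreover have "z - y \<in> I \<Longrightarrow> z - x \<in> I" using I_diff[OF _ xy, of "z - y"] by simp
    ultimately show "z \<in> proj x \<longleftrightarrow> z \<in> proj y" by (auto simp: mem_proj)
  qed
qed

lemma carrier_R: "carrier R = proj ` A"
  by (auto simp: FactRing_def A_RCOSETS_def' proj_def)

lemma cring_R: "cring R"
  by (rule ideal.quotient_is_cring[OF ideal_I cring_A])

lemma proj_in: "x \<in> A \<Longrightarrow> proj x \<in> carrier R"
  by (simp add: carrier_R)

lemma R_mult: "x \<in> A \<Longrightarrow> y \<in> A \<Longrightarrow> proj x \<otimes>\<^bsub>R\<^esub> proj y = proj (x * y)"
  using ideal.rcoset_mult_add[OF ideal_I, of x y] by (simp add: FactRing_def proj_def)

lemma R_add: "x \<in> A \<Longrightarrow> y \<in> A \<Longrightarrow> proj x \<oplus>\<^bsub>R\<^esub> proj y = proj (x + y)"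
  using ideal.a_rcos_sum[OF ideal_I, of x y] by (simp add: FactRing_def proj_def)

lemma R_one: "\<one>\<^bsub>R\<^esub> = proj 1"
  by (simp add: FactRing_def proj_def)

lemma R_zero: "\<zero>\<^bsub>R\<^esub> = proj 0"
  by (simp add: FactRing_def proj_eq)

lemma R_zero_iff: "proj x = \<zero>\<^bsub>R\<^esub> \<longleftrightarrow> x \<in> I"
  by (simp add: R_zero proj_eq_iff)

lemma R_uminus: "x \<in> A \<Longrightarrow> \<ominus>\<^bsub>R\<^esub> proj x = proj (- x)"
proof -
  interpret cring R by (rule cring_R)
  assume "x \<in> A"
  then show ?thesis
    by (intro minus_equality) (auto simp: R_add A_uminus R_zero proj_in simp del: FactRing_def)
qed

text \<open>
  A map that is additive on \<open>A\<close> and kills \<open>I\<close> is constant on cosets, so any choice of a representative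
  gives the induced map on the quotient.
\<close>

definition lift :: "('a \<Rightarrow> 'b) \<Rightarrow> 'a set \<Rightarrow> 'b" where "lift \<psi> C = \<psi> (SOME x. x \<in> C)"

lemma lift_proj:
  assumes "\<And>x y. x \<in> A \<Longrightarrow> y \<in> A \<Longrightarrow> \<psi> (x + y) = \<psi> x + (\<psi> y :: 'b::comm_ring_1)"
    "\<And>x. x \<in> I \<Longrightarrow> \<psi> x = 0" "x \<in> A"
  shows "lift \<psi> (proj x) = \<psi> x"
proof -
  have "(SOME z. z \<in> proj x) \<in> proj x" using proj_self by (rule someI)
  then obtain i where i: "i \<in> I" "(SOME z. z \<in> proj x) = i + x" by (auto simp: proj_eq)
  then show ?thesis using assms I_sub by (auto simp: lift_def)
qed

lemma lift_hom:
  assumes "\<And>x y. x \<in> A \<Longrightarrow> y \<in> A \<Longrightarrow> \<psi> (x + y) = \<psi> x + (\<psi> y :: 'b::comm_ring_1)"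
    "\<And>x y. x \<in> A \<Longrightarrow> y \<in> A \<Longrightarrow> \<psi> (x * y) = \<psi> x * \<psi> y" "\<psi> 1 = 1"
    "\<And>x. x \<in> I \<Longrightarrow> \<psi> x = 0"
  shows "lift \<psi> \<in> Ring.ring_hom R (ring_on UNIV)"
  by (rule ring_hom_memI)
    (auto simp: carrier_R R_mult R_add R_one lift_proj[OF assms(1,4)] assms A_mult A_add A_1
      simp del: FactRing_def)

text \<open>
  Primes of the quotient are used through their preimages \<open>Q'\<close>, where elements can be multiplied
  without choosing representatives.
\<close>

lemma prime_contraction:
  assumes "primeideal Q R"
  defines "Q' \<equiv> {x \<in> A. proj x \<in> Q}"
  shows "I \<subseteq> Q'" "x \<in> Q' \<Longrightarrow> y \<in> Q' \<Longrightarrow> x + y \<in> Q'" "x \<in> A \<Longrightarrow> y \<in> Q' \<Longrightarrow> x * y \<in> Q'" "1 \<notin> Q'"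
    "x \<in> A \<Longrightarrow> y \<in> A \<Longrightarrow> x * y \<in> Q' \<Longrightarrow> x \<in> Q' \<or> y \<in> Q'"
proof -
  interpret primeideal Q R by fact
  show "I \<subseteq> Q'"
  proof
    fix x assume "x \<in> I"
    then have "proj x = \<zero>\<^bsub>R\<^esub>" "x \<in> A" using I_sub by (auto simp: R_zero_iff)
    then show "x \<in> Q'" using additive_subgroup.zero_closed[OF is_additive_subgroup] by (simp add: Q'_def)
  qed
  show "x \<in> Q' \<Longrightarrow> y \<in> Q' \<Longrightarrow> x + y \<in> Q'"
    using additive_subgroup.a_closed[OF is_additive_subgroup, of "proj x" "proj y"]
    by (auto simp: Q'_def A_add R_add)
  show "x \<in> A \<Longrightarrow> y \<in> Q' \<Longrightarrow> x * y \<in> Q'"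
    using I_l_closed[of "proj y" "proj x"] by (auto simp: Q'_def A_mult R_mult proj_in)
  show "1 \<notin> Q'"
    using one_imp_carrier I_notcarr by (auto simp: Q'_def R_one)
  show "x \<in> A \<Longrightarrow> y \<in> A \<Longrightarrow> x * y \<in> Q' \<Longrightarrow> x \<in> Q' \<or> y \<in> Q'"
    using I_prime[of "proj x" "proj y"] by (auto simp: Q'_def R_mult proj_in)
qed

text \<open>
  The hypothesis on \<open>N\<close> says that every ideal of \<open>A\<close> that contains \<open>F\<close> and \<open>I\<close> contains \<open>N\<close>, and the
  preimage of the ideal generated by \<open>F\<close> in the quotient is such an ideal.
\<close>

lemma generated_by_proj:
  assumes F: "F \<subseteq> A" and NA: "N \<subseteq> A"
    and N: "\<And>J. F \<subseteq> J \<Longrightarrow> I \<subseteq> J \<Longrightarrow> (\<And>x y. x \<in> J \<Longrightarrow> y \<in> J \<Longrightarrow> x + y \<in> J) \<Longrightarrow>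
        (\<And>x y. x \<in> A \<Longrightarrow> y \<in> J \<Longrightarrow> x * y \<in> J) \<Longrightarrow> N \<subseteq> J"
    and ideal: "ideal (proj ` N) R" and FN: "F \<subseteq> N"
  shows "Idl\<^bsub>R\<^esub> (proj ` F) = proj ` N"
proof -
  interpret cring R by (rule cring_R)
  have FR: "proj ` F \<subseteq> carrier R" using F by (auto simp: proj_in)
  show ?thesis
  proof (rule antisym)
    show "Idl\<^bsub>R\<^esub> (proj ` F) \<subseteq> proj ` N"
      using ideal FN by (intro genideal_minimal) auto
    interpret J: ideal "Idl\<^bsub>R\<^esub> (proj ` F)" R using FR by (rule genideal_ideal)
    have "N \<subseteq> {x \<in> A. proj x \<in> Idl\<^bsub>R\<^esub> (proj ` F)}"
    proof (rule N)
      show "F \<subseteq> {x \<in> A. proj x \<in> Idl\<^bsub>R\<^esub> (proj ` F)}" using F genideal_self[OF FR] by auto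
      show "I \<subseteq> {x \<in> A. proj x \<in> Idl\<^bsub>R\<^esub> (proj ` F)}"
      proof
        fix x assume "x \<in> I"
        then have "proj x = \<zero>\<^bsub>R\<^esub>" "x \<in> A" using I_sub by (auto simp: R_zero_iff)
        then show "x \<in> {x \<in> A. proj x \<in> Idl\<^bsub>R\<^esub> (proj ` F)}"
          using additive_subgroup.zero_closed[OF J.is_additive_subgroup] by simp
      qed
    next
      fix x y assume "x \<in> {x \<in> A. proj x \<in> Idl\<^bsub>R\<^esub> (proj ` F)}" "y \<in> {x \<in> A. proj x \<in> Idl\<^bsub>R\<^esub> (proj ` F)}"
      then show "x + y \<in> {x \<in> A. proj x \<in> Idl\<^bsub>R\<^esub> (proj ` F)}"
        using additive_subgroup.a_closed[OF J.is_additive_subgroup, of "proj x" "proj y"]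
        by (auto simp: A_add R_add)
    next
      fix x y assume "x \<in> A" "y \<in> {x \<in> A. proj x \<in> Idl\<^bsub>R\<^esub> (proj ` F)}"
      then show "x * y \<in> {x \<in> A. proj x \<in> Idl\<^bsub>R\<^esub> (proj ` F)}"
        using J.I_l_closed[of "proj y" "proj x"] by (auto simp: A_mult R_mult proj_in)
    qed
    then show "proj ` N \<subseteq> Idl\<^bsub>R\<^esub> (proj ` F)" by auto
  qed
qed

end

lemma kernel_prime:
  fixes \<psi> :: "'a \<Rightarrow> 'b::idom"
  assumes R: "cring R" and hom: "\<psi> \<in> Ring.ring_hom R (ring_on UNIV)"
  shows "primeideal {x \<in> carrier R. \<psi> x = 0} R"
proof -
  have ker: "{x \<in> carrier R. \<psi> x = 0} = a_kernel R (ring_on UNIV) \<psi>" by (simp add: a_kernel_def')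
  interpret cring R by (rule R)
  interpret S: cring "ring_on (UNIV :: 'b set)" by (rule cring_ring_on_UNIV)
  interpret H: ring_hom_ring R "ring_on UNIV" \<psi>
    by (rule ring_hom_ringI2) (use hom in \<open>auto simp: ring_axioms S.ring_axioms\<close>)
  have mult: "\<psi> (x \<otimes>\<^bsub>R\<^esub> y) = \<psi> x * \<psi> y" if "x \<in> carrier R" "y \<in> carrier R" for x y
    using ring_hom_mult[OF hom that] unfolding ring_on_simps .
  have one: "\<psi> \<one>\<^bsub>R\<^esub> = 1" using ring_hom_one[OF hom] unfolding ring_on_simps .
  show ?thesis
  proof (rule primeidealI)
    show "ideal {x \<in> carrier R. \<psi> x = 0} R" unfolding ker by (rule H.kernel_is_ideal)
    show "carrier R \<noteq> {x \<in> carrier R. \<psi> x = 0}"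
    proof
      assume "carrier R = {x \<in> carrier R. \<psi> x = 0}"
      then have "\<psi> \<one>\<^bsub>R\<^esub> = 0" using one_closed by blast
      then show False by (simp only: one one_neq_zero)
    qed
    fix x y assume "x \<in> carrier R" "y \<in> carrier R" "x \<otimes>\<^bsub>R\<^esub> y \<in> {x \<in> carrier R. \<psi> x = 0}"
    then have xy: "x \<in> carrier R" "y \<in> carrier R" and "\<psi> (x \<otimes>\<^bsub>R\<^esub> y) = 0" by blast+
    then have "\<psi> x * \<psi> y = 0" by (simp only: mult)
    then have "\<psi> x = 0 \<or> \<psi> y = 0" by (rule mult_eq_0_iff[THEN iffD1])
    with xy show "x \<in> {x \<in> carrier R. \<psi> x = 0} \<or> y \<in> {x \<in> carrier R. \<psi> x = 0}" by blast
  qed (rule R)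
qed

text \<open>
  Elements of \<open>A\<close> outside \<open>M\<close> are units, so \<open>M\<close> is the preimage of the unique maximal ideal of \<open>A / I\<close>.
\<close>

locale local_quot = subring_quot +
  fixes M :: "'a::comm_ring_1 set"
  assumes M_sub: "M \<subseteq> A" and I_M: "I \<subseteq> M"
    and M_add: "x \<in> M \<Longrightarrow> y \<in> M \<Longrightarrow> x + y \<in> M"
    and M_mult: "x \<in> A \<Longrightarrow> y \<in> M \<Longrightarrow> x * y \<in> M"
    and M_1: "1 \<notin> M"
    and A_unit: "x \<in> A \<Longrightarrow> x \<notin> M \<Longrightarrow> \<exists>y\<in>A. x * y = 1"
begin

lemma M_0: "0 \<in> M" using I_0 I_M by blast

lemma M_uminus: "x \<in> M \<Longrightarrow> - x \<in> M"
  using M_mult[of "- 1" x] A_uminus[OF A_1] by simp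

lemma M_diff: "x \<in> M \<Longrightarrow> y \<in> M \<Longrightarrow> x - y \<in> M"
  using M_add[of x "- y"] M_uminus[of y] by simp

lemma nonunits_R: "nonunits R = proj ` M"
proof -
  interpret cring R by (rule cring_R)
  have "proj x \<in> Units R \<longleftrightarrow> x \<notin> M" if x: "x \<in> A" for x
  proof
    assume "proj x \<in> Units R"
    then obtain C where "C \<in> carrier R" "proj x \<otimes>\<^bsub>R\<^esub> C = \<one>\<^bsub>R\<^esub>" by (auto simp: Units_def)
    then obtain y where y: "y \<in> A" "proj (x * y) = proj 1"
      using x by (auto simp: carrier_R R_mult R_one)
    then have m: "x * y - 1 \<in> M" using I_M by (auto simp: proj_eq_iff)
    show "x \<notin> M"
    proof
      assume "x \<in> M"
      then have "y * x \<in> M" using M_mult y by blast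
      with m have "y * x - (x * y - 1) \<in> M" by (rule M_diff[rotated])
      then show False using M_1 by (simp add: mult.commute)
    qed
  next
    assume "x \<notin> M"
    then obtain y where "y \<in> A" "x * y = 1" using A_unit x by blast
    then show "proj x \<in> Units R"
      unfolding Units_def using x
      by (auto simp: R_mult R_one mult.commute intro!: proj_in bexI[of _ "proj y"])
  qed
  then show ?thesis using M_sub by (auto simp: nonunits_def carrier_R)
qed

lemma ideal_M: "ideal (proj ` M) R"
proof (rule idealI)
  interpret cring R by (rule cring_R)
  show "ring R" by (rule ring_axioms)
  show "subgroup (proj ` M) (add_monoid R)"
  proof (rule group.subgroupI)
    show "Group.group (add_monoid R)" by (rule add.is_group)
    show "proj ` M \<noteq> {}" using M_0 by blast
    fix C assume "C \<in> proj ` M"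
    then obtain x where x: "x \<in> M" "C = proj x" by auto
    then have "\<ominus>\<^bsub>R\<^esub> C = proj (- x)" using M_sub R_uminus[of x] by auto
    with x show "inv\<^bsub>add_monoid R\<^esub> C \<in> proj ` M"
      by (simp add: a_inv_def M_uminus)
  qed (use M_sub in \<open>auto simp: proj_in R_add M_add simp del: FactRing_def\<close>,
       metis M_add M_sub R_add imageI subsetD)
next
  fix C D assume "C \<in> proj ` M" "D \<in> carrier R"
  then obtain x y where "x \<in> M" "y \<in> A" "C = proj x" "D = proj y" by (auto simp: carrier_R)
  then show "D \<otimes>\<^bsub>R\<^esub> C \<in> proj ` M" "C \<otimes>\<^bsub>R\<^esub> D \<in> proj ` M"
    using M_sub M_mult[of y x] by (auto simp: R_mult subset_iff mult.commute)
qed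

text \<open>
  The preimages of the powers of the maximal ideal. Congruences modulo these powers become statements
  about elements of \<open>A\<close>.
\<close>

definition MP :: "nat \<Rightarrow> 'a set" where "MP n = {x \<in> A. proj x \<in> ideal_pow R (proj ` M) n}"

lemma ideal_pow_0: "ideal_pow R J 0 = carrier R"
  by (simp add: ideals_set_def)

lemma ideal_pow_Suc: "ideal_pow R J (Suc n) = ideal_prod R (ideal_pow R J n) J"
  by (simp add: ideals_set_def nat_pow_def)

lemma ideal_ideal_pow: "ideal (ideal_pow R (proj ` M) n) R"
proof -
  interpret cring R by (rule cring_R)
  show ?thesis
  proof (induction n)
    case 0 show ?case unfolding ideal_pow_0 by (rule oneideal)
  next
    case (Suc n) show ?case unfolding ideal_pow_Suc by (rule ideal_prod_is_ideal[OF Suc ideal_M])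
  qed
qed

lemma MP_0: "MP 0 = A"
  unfolding MP_def ideal_pow_0 by (auto simp: proj_in)

lemma I_MP: "I \<subseteq> MP n"
proof -
  interpret J: ideal "ideal_pow R (proj ` M) n" R by (rule ideal_ideal_pow)
  show ?thesis
  proof
    fix x assume "x \<in> I"
    then have "proj x = \<zero>\<^bsub>R\<^esub>" "x \<in> A" using I_sub by (auto simp: R_zero_iff)
    then show "x \<in> MP n"
      using additive_subgroup.zero_closed[OF J.is_additive_subgroup] by (simp add: MP_def)
  qed
qed

lemma MP_add: "x \<in> MP n \<Longrightarrow> y \<in> MP n \<Longrightarrow> x + y \<in> MP n"
proof -
  interpret J: ideal "ideal_pow R (proj ` M) n" R by (rule ideal_ideal_pow)
  show "x \<in> MP n \<Longrightarrow> y \<in> MP n \<Longrightarrow> x + y \<in> MP n"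
    using additive_subgroup.a_closed[OF J.is_additive_subgroup, of "proj x" "proj y"]
    by (auto simp: MP_def R_add A_add)
qed

lemma MP_mult: "x \<in> A \<Longrightarrow> y \<in> MP n \<Longrightarrow> x * y \<in> MP n"
proof -
  interpret J: ideal "ideal_pow R (proj ` M) n" R by (rule ideal_ideal_pow)
  show "x \<in> A \<Longrightarrow> y \<in> MP n \<Longrightarrow> x * y \<in> MP n"
    using J.I_l_closed[of "proj y" "proj x"] by (auto simp: MP_def R_mult A_mult proj_in)
qed

lemma MP_Suc: "x \<in> MP n \<Longrightarrow> y \<in> M \<Longrightarrow> x * y \<in> MP (Suc n)"
  unfolding MP_def ideal_pow_Suc using M_sub
  by (auto simp: A_mult subset_iff simp flip: R_mult intro: ideal_prod.prod)

lemma MP_sum: "(\<And>x. x \<in> S \<Longrightarrow> f x \<in> MP n) \<Longrightarrow> sum f S \<in> MP n"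
  using I_MP I_0 by (induction S rule: infinite_finite_induct) (auto simp: MP_add)

lemma MP_power: "x \<in> M \<Longrightarrow> x ^ n \<in> MP n"
  by (induction n) (auto simp: MP_0 A_1 MP_Suc power_Suc2 simp del: power_Suc)

lemma MP_mono: "m \<le> n \<Longrightarrow> MP n \<subseteq> MP m"
proof (induction rule: dec_induct)
  case (step n)
  have "MP (Suc n) \<subseteq> MP n"
  proof
    fix x assume x: "x \<in> MP (Suc n)"
    interpret cring R by (rule cring_R)
    from x have "proj x \<in> ideal_prod R (ideal_pow R (proj ` M) n) (proj ` M)" "x \<in> A"
      unfolding MP_def ideal_pow_Suc by auto
    then show "x \<in> MP n"
      using ideal_prod_inter[OF ideal_ideal_pow ideal_M] by (auto simp: MP_def)
  qed
  with step show ?case by blast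
qed simp

end

section \<open>Ideals of polynomials and the local rings of a weighted projective scheme\<close>

lemma pol_ideal_ideal: "ideal (pol_ideal E) (ring_on UNIV)"
  unfolding pol_ideal_def
  by (rule ring.genideal_ideal) (use cring_ring_on_UNIV cring_def in auto)

lemma pol_ideal_base: "f \<in> E \<Longrightarrow> f \<in> pol_ideal E"
  unfolding pol_ideal_def
  using ring.genideal_self[of "ring_on UNIV" E] cring_ring_on_UNIV[where 'a = pol]
  by (auto simp: cring_def)

lemma pol_ideal_0: "0 \<in> pol_ideal E"
  using additive_subgroup.zero_closed[OF ideal.axioms(1)[OF pol_ideal_ideal]] by simp

lemma pol_ideal_add: "f \<in> pol_ideal E \<Longrightarrow> g \<in> pol_ideal E \<Longrightarrow> f + g \<in> pol_ideal E"
  using additive_subgroup.a_closed[OF ideal.axioms(1)[OF pol_ideal_ideal]] by simp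

lemma pol_ideal_mult: "g \<in> pol_ideal E \<Longrightarrow> f * g \<in> pol_ideal E"
  using ideal.I_l_closed[OF pol_ideal_ideal, of g E f] by simp

lemma pol_ideal_mult_r: "g \<in> pol_ideal E \<Longrightarrow> g * f \<in> pol_ideal E"
  using pol_ideal_mult[of g E f] by (simp add: mult.commute)

lemma pol_ideal_uminus: "f \<in> pol_ideal E \<Longrightarrow> - f \<in> pol_ideal E"
  using pol_ideal_mult[of f E "- 1"] by simp

lemma pol_ideal_diff: "f \<in> pol_ideal E \<Longrightarrow> g \<in> pol_ideal E \<Longrightarrow> f - g \<in> pol_ideal E"
  using pol_ideal_add[of f E "- g"] by (simp add: pol_ideal_uminus)

lemma pol_ideal_sum: "(\<And>x. x \<in> S \<Longrightarrow> f x \<in> pol_ideal E) \<Longrightarrow> sum f S \<in> pol_ideal E"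
  by (induction S rule: infinite_finite_induct) (auto simp: pol_ideal_0 pol_ideal_add)

lemma pol_ideal_minimal:
  assumes "E \<subseteq> J" "0 \<in> J" "\<And>f g. f \<in> J \<Longrightarrow> g \<in> J \<Longrightarrow> f + g \<in> J" "\<And>f g. g \<in> J \<Longrightarrow> f * g \<in> J"
  shows "pol_ideal E \<subseteq> J"
proof -
  interpret J: subring_quot UNIV J by standard (use assms in auto)
  show ?thesis unfolding pol_ideal_def
    using J.ideal_I assms(1) ring.genideal_minimal cring_ring_on_UNIV cring_def by blast
qed

lemma pol_ideal_mono: "E \<subseteq> pol_ideal F \<Longrightarrow> pol_ideal E \<subseteq> pol_ideal F"
  by (rule pol_ideal_minimal) (auto simp: pol_ideal_0 pol_ideal_add pol_ideal_mult)

lemma (in coeff_hom) eval_hom_pol_ideal: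
  assumes "\<And>f. f \<in> E \<Longrightarrow> eval_hom h X f = 0" "f \<in> pol_ideal E"
  shows "eval_hom h X f = 0"
proof -
  have "pol_ideal E \<subseteq> {f. eval_hom h X f = 0}"
    by (rule pol_ideal_minimal) (auto simp: assms eval_hom_simps)
  with assms show ?thesis by auto
qed

text \<open>
  A homogeneous polynomial vanishes on a whole orbit or nowhere on it, so everything can be expressed
  with one representative \<open>a\<close> of the point.
\<close>

definition orbit :: "(coord \<Rightarrow> complex) \<Rightarrow> point" where "orbit a = {scale l a | l. l \<noteq> 0}"

lemma eval_pol_scale: "homogeneous d f \<Longrightarrow> eval_pol f (scale l a) = l ^ d * eval_pol f a"
  by (simp add: eval_pol_eq scale_def id_hom.eval_hom_scale)

lemma orbit_nonvanishing: "homogeneous d g \<Longrightarrow> (\<forall>b\<in>orbit a. eval_pol g b \<noteq> 0) \<longleftrightarrow> eval_pol g a \<noteq> 0"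
proof -
  assume g: "homogeneous d g"
  have "a \<in> orbit a" unfolding orbit_def by (auto simp: scale_def intro!: exI[of _ 1])
  then show ?thesis by (auto simp: orbit_def eval_pol_scale[OF g])
qed

definition locA :: "(coord \<Rightarrow> complex) \<Rightarrow> pol fract set" where
  "locA a = {Fract f g | f g d. homogeneous d f \<and> homogeneous d g \<and> eval_pol g a \<noteq> 0}"

definition locI :: "pol set \<Rightarrow> (coord \<Rightarrow> complex) \<Rightarrow> pol fract set" where
  "locI E a = {Fract f g | f g d. f \<in> pol_ideal E \<and>
     homogeneous d f \<and> homogeneous d g \<and> eval_pol g a \<noteq> 0}"

lemma ambient_local_ring_orbit: "ambient_local_ring (orbit a) = ring_on (locA a)"
  unfolding ambient_local_ring_def locA_def
  by (rule arg_cong[of _ _ ring_on]) (use orbit_nonvanishing in blast)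

lemma local_ideal_orbit: "local_ideal E (orbit a) = locI E a"
  unfolding local_ideal_def locI_def using orbit_nonvanishing by blast

lemma local_ring_orbit: "local_ring E (orbit a) = ring_on (locA a) Quot locI E a"
  by (simp add: local_ring_def ambient_local_ring_orbit local_ideal_orbit)

lemma eval_pol_nz: "eval_pol g a \<noteq> 0 \<Longrightarrow> g \<noteq> 0"
  by (auto simp: eval_pol_eq)

lemma locA_I: "homogeneous d f \<Longrightarrow> homogeneous d g \<Longrightarrow> eval_pol g a \<noteq> 0 \<Longrightarrow> Fract f g \<in> locA a"
  by (auto simp: locA_def)

lemma locI_I: "f \<in> pol_ideal E \<Longrightarrow> homogeneous d f \<Longrightarrow> homogeneous d g \<Longrightarrow> eval_pol g a \<noteq> 0
   \<Longrightarrow> Fract f g \<in> locI E a"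
  by (auto simp: locI_def)

lemma locA_E:
  assumes "x \<in> locA a"
  obtains f g d where "x = Fract f g" "homogeneous d f" "homogeneous d g" "eval_pol g a \<noteq> 0" "g \<noteq> 0"
  using assms eval_pol_nz unfolding locA_def by blast

lemma locI_E:
  assumes "x \<in> locI E a"
  obtains f g d where "x = Fract f g" "f \<in> pol_ideal E" "homogeneous d f" "homogeneous d g"
     "eval_pol g a \<noteq> 0" "g \<noteq> 0"
  using assms eval_pol_nz unfolding locI_def by blast

lemmas eval_pol_simps = id_hom.eval_hom_simps[folded eval_pol_eq]

lemma eval_pol_Const [simp]: "eval_pol (Const c) a = c"
  and eval_pol_Var [simp]: "eval_pol (Var v) a = a v"
  and eval_pol_one [simp]: "eval_pol 1 a = 1"
  and eval_pol_zero [simp]: "eval_pol 0 a = 0"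
  by (simp_all add: eval_pol_eq)

lemma locA_add_mult:
  assumes "x \<in> locA a" "y \<in> locA a"
  shows "x + y \<in> locA a" "x * y \<in> locA a"
proof -
  obtain f g d f' g' e where 1: "x = Fract f g" "homogeneous d f" "homogeneous d g" "eval_pol g a \<noteq> 0" "g \<noteq> 0"
      and 2: "y = Fract f' g'" "homogeneous e f'" "homogeneous e g'" "eval_pol g' a \<noteq> 0" "g' \<noteq> 0"
    using assms by (meson locA_E)
  have "homogeneous (d + e) (f * g' + f' * g)"
      using 1 2 homogeneous_mult[of d f e g'] homogeneous_mult[of e f' d g]
      by (auto simp: add.commute intro!: homogeneous_add)
  moreover have "homogeneous (d + e) (g * g')" "homogeneous (d + e) (f * f')"
    using 1 2 by (auto intro: homogeneous_mult)
  moreover have "eval_pol (g * g') a \<noteq> 0" using 1 2 by (simp add: eval_pol_simps)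
  ultimately show "x + y \<in> locA a" "x * y \<in> locA a"
    using 1 2 by (auto intro: locA_I)
qed

lemmas locA_add = locA_add_mult(1)
lemmas locA_mult = locA_add_mult(2)

text \<open>
  A point with coordinates in an \<open>h\<close>-algebra \<open>'r\<close>, specializing to the complex point \<open>a\<close>: the assumption
  makes the denominators of the local ring at \<open>a\<close> invertible at \<open>X\<close>, so that evaluation extends to the
  local ring.
\<close>

locale formal_point = coeff_hom h for h :: "complex \<Rightarrow> 'r::idom" +
  fixes X :: "coord \<Rightarrow> 'r" and a :: "coord \<Rightarrow> complex"
  assumes unit: "homogeneous d g \<Longrightarrow> eval_pol g a \<noteq> 0 \<Longrightarrow> eval_hom h X g dvd 1"
begin

abbreviation "ev \<equiv> eval_hom h X"

text \<open>
  An element of the local ring has many representations as a fraction; the value is characterized by the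
  property that all of them share.
\<close>

definition Phi :: "pol fract \<Rightarrow> 'r" where
  "Phi x = (THE r. \<exists>f g d. x = Fract f g \<and> homogeneous d f \<and> homogeneous d g \<and> eval_pol g a \<noteq> 0 \<and>
     r * ev g = ev f)"

lemma ev_nz: "homogeneous d g \<Longrightarrow> eval_pol g a \<noteq> 0 \<Longrightarrow> ev g \<noteq> 0"
  using unit[of d g] by auto

lemma Phi_Fract:
  assumes "homogeneous d f" "homogeneous d g" "eval_pol g a \<noteq> 0"
  shows "Phi (Fract f g) * ev g = ev f"
proof -
  obtain u where u: "1 = ev g * u" using unit[OF assms(2,3)] by (auto simp: dvd_def)
  let ?S = "\<lambda>r. \<exists>f' g' d. Fract f g = Fract f' g' \<and> homogeneous d f' \<and> homogeneous d g' \<and>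
      eval_pol g' a \<noteq> 0 \<and> r * ev g' = ev f'"
  have "Phi (Fract f g) = ev f * u"
    unfolding Phi_def
  proof (rule the_equality)
    show "?S (ev f * u)"
      using assms u by (intro exI[of _ f] exI[of _ g] exI[of _ d]) (auto simp: algebra_simps)
  next
    fix r assume "?S r"
    then obtain f' g' e where *: "Fract f g = Fract f' g'" "homogeneous e g'" "eval_pol g' a \<noteq> 0"
      "r * ev g' = ev f'" by blast
    then have "f * g' = f' * g"
      using eq_fract(1)[OF eval_pol_nz[OF assms(3)] eval_pol_nz[OF *(3)], of f f'] by simp
    then have "ev f * ev g' = ev f' * ev g" by (metis eval_hom_mult)
    then have "ev f * ev g' = r * ev g * ev g'" by (simp flip: *(4) add: mult_ac)
    then have "ev f = r * ev g" using ev_nz[OF *(2,3)] by simp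
    then show "r = ev f * u" using u by (simp add: mult.assoc)
  qed
  then show ?thesis using u by (simp add: mult_ac)
qed

lemma Phi_unique:
  assumes "homogeneous d f" "homogeneous d g" "eval_pol g a \<noteq> 0" "r * ev g = ev f"
  shows "Phi (Fract f g) = r"
  using Phi_Fract[OF assms(1-3)] assms(4) ev_nz[OF assms(2,3)] by (metis mult_cancel_right)

lemma Phi_add:
  assumes "x \<in> locA a" "y \<in> locA a"
  shows "Phi (x + y) = Phi x + Phi y"
proof -
  obtain f g d where 1: "x = Fract f g" "homogeneous d f" "homogeneous d g" "eval_pol g a \<noteq> 0" "g \<noteq> 0"
    using assms(1) by (rule locA_E)
  obtain f' g' e where 2: "y = Fract f' g'" "homogeneous e f'" "homogeneous e g'" "eval_pol g' a \<noteq> 0" "g' \<noteq> 0"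
    using assms(2) by (rule locA_E)
  show ?thesis
    unfolding 1(1) 2(1) add_fract[OF 1(5) 2(5)]
  proof (rule Phi_unique[where d = "d + e"])
    show "homogeneous (d + e) (f * g' + f' * g)"
      using 1 2 homogeneous_mult[of d f e g'] homogeneous_mult[of e f' d g]
      by (auto simp: add.commute intro!: homogeneous_add)
    show "homogeneous (d + e) (g * g')" using 1 2 by (auto intro: homogeneous_mult)
    show "eval_pol (g * g') a \<noteq> 0" using 1 2 by (simp add: eval_pol_simps)
    show "(Phi (Fract f g) + Phi (Fract f' g')) * ev (g * g') = ev (f * g' + f' * g)"
      by (simp add: eval_hom_simps Phi_Fract[OF 1(2-4), symmetric] Phi_Fract[OF 2(2-4), symmetric]
          algebra_simps)
  qed
qed

lemma Phi_mult:
  assumes "x \<in> locA a" "y \<in> locA a"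
  shows "Phi (x * y) = Phi x * Phi y"
proof -
  obtain f g d where 1: "x = Fract f g" "homogeneous d f" "homogeneous d g" "eval_pol g a \<noteq> 0" "g \<noteq> 0"
    using assms(1) by (rule locA_E)
  obtain f' g' e where 2: "y = Fract f' g'" "homogeneous e f'" "homogeneous e g'" "eval_pol g' a \<noteq> 0" "g' \<noteq> 0"
    using assms(2) by (rule locA_E)
  show ?thesis
    unfolding 1(1) 2(1) mult_fract
  proof (rule Phi_unique[where d = "d + e"])
    show "homogeneous (d + e) (f * f')" "homogeneous (d + e) (g * g')"
      using 1 2 by (auto intro: homogeneous_mult)
    show "eval_pol (g * g') a \<noteq> 0" using 1 2 by (simp add: eval_pol_simps)
    show "(Phi (Fract f g) * Phi (Fract f' g')) * ev (g * g') = ev (f * f')"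
      by (simp add: eval_hom_simps Phi_Fract[OF 1(2-4), symmetric] Phi_Fract[OF 2(2-4), symmetric]
          algebra_simps)
  qed
qed

lemma Phi_const: "Phi (Fract (Const c) 1) = h c"
  by (rule Phi_unique[where d = 0]) simp_all

lemma Phi_one: "Phi 1 = 1"
  using Phi_const[of 1] by (simp add: Const_one h_one One_fract_def)

lemma Phi_ideal:
  assumes "\<And>f. f \<in> E \<Longrightarrow> ev f = 0" "x \<in> locI E a"
  shows "Phi x = 0"
  using assms(2)
proof (rule locI_E)
  fix f g d assume *: "x = Fract f g" "f \<in> pol_ideal E" "homogeneous d f" "homogeneous d g" "eval_pol g a \<noteq> 0"
  have "ev f = 0" using eval_hom_pol_ideal[OF assms(1) *(2)] .
  then show ?thesis unfolding *(1) by (intro Phi_unique[OF *(3-5)]) simp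
qed

end

interpretation val: formal_point "\<lambda>c. c" a a for a
  by standard (auto simp: eval_pol_eq dvd_field_iff)

abbreviation value_at :: "(coord \<Rightarrow> complex) \<Rightarrow> pol fract \<Rightarrow> complex" where
  "value_at a \<equiv> val.Phi a"

lemma value_at_Fract:
  assumes "homogeneous d f" "homogeneous d g" "eval_pol g a \<noteq> 0"
  shows "value_at a (Fract f g) = eval_pol f a / eval_pol g a"
  using val.Phi_Fract[OF assms] assms(3) by (simp add: eval_pol_eq field_simps)

definition locM :: "(coord \<Rightarrow> complex) \<Rightarrow> pol fract set" where
  "locM a = {x \<in> locA a. value_at a x = 0}"

locale scheme_point =
  fixes E :: "pol set" and a :: "coord \<Rightarrow> complex"
  assumes vanish: "f \<in> E \<Longrightarrow> eval_pol f a = 0"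

sublocale scheme_point \<subseteq> local_quot "locA a" "locI E a" "locM a"
proof
  show "0 \<in> locA a" "1 \<in> locA a"
    unfolding Zero_fract_def One_fract_def by (rule locA_I[of 0]; simp)+
  show "x + y \<in> locA a" "x * y \<in> locA a" if "x \<in> locA a" "y \<in> locA a" for x y
    using that by (rule locA_add locA_mult)+
next
  fix x assume "x \<in> locA a"
  then show "- x \<in> locA a" by (rule locA_E) (auto intro: locA_I homogeneous_uminus)
next
  show "locI E a \<subseteq> locA a" by (auto simp: locA_def locI_def)
  show "0 \<in> locI E a"
    unfolding Zero_fract_def by (rule locI_I[of _ _ 0]) (auto simp: pol_ideal_0)
next
  fix x y assume "x \<in> locI E a" "y \<in> locI E a"
  then obtain f g d f' g' e where 1: "x = Fract f g" "f \<in> pol_ideal E" "homogeneous d f" "homogeneous d g" "eval_pol g a \<noteq> 0" "g \<noteq> 0"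
      and 2: "y = Fract f' g'" "f' \<in> pol_ideal E" "homogeneous e f'" "homogeneous e g'" "eval_pol g' a \<noteq> 0" "g' \<noteq> 0"
    by (meson locI_E)
  have "homogeneous (d + e) (f * g' + f' * g)"
      using 1 2 homogeneous_mult[of d f e g'] homogeneous_mult[of e f' d g]
      by (auto simp: add.commute intro!: homogeneous_add)
  moreover have "homogeneous (d + e) (g * g')"
    using 1 2 by (auto intro: homogeneous_mult)
  moreover have "eval_pol (g * g') a \<noteq> 0" using 1 2 by (simp add: eval_pol_simps)
  moreover have "f * g' + f' * g \<in> pol_ideal E"
    using 1 2 by (auto intro: pol_ideal_add pol_ideal_mult_r)
  ultimately show "x + y \<in> locI E a"
    using 1 2 by (auto intro: locI_I)
next
  fix x y assume "x \<in> locA a" "y \<in> locI E a"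
  then obtain f g d f' g' e where 1: "x = Fract f g" "homogeneous d f" "homogeneous d g" "eval_pol g a \<noteq> 0" "g \<noteq> 0"
      and 2: "y = Fract f' g'" "f' \<in> pol_ideal E" "homogeneous e f'" "homogeneous e g'" "eval_pol g' a \<noteq> 0" "g' \<noteq> 0"
    by (meson locA_E locI_E)
  have "homogeneous (d + e) (g * g')" "homogeneous (d + e) (f * f')"
    using 1 2 by (auto intro: homogeneous_mult)
  moreover have "eval_pol (g * g') a \<noteq> 0" using 1 2 by (simp add: eval_pol_simps)
  moreover have "f * f' \<in> pol_ideal E"
    using 1 2 by (auto intro: pol_ideal_mult)
  ultimately show "x * y \<in> locI E a"
    using 1 2 by (auto intro: locI_I)
next
  show "locM a \<subseteq> locA a" by (auto simp: locM_def)
  show "locI E a \<subseteq> locM a"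
    using val.Phi_ideal[of E a] vanish by (auto simp: locM_def eval_pol_eq locA_def locI_def)
  show "1 \<notin> locM a" by (simp add: locM_def val.Phi_one)
next
  fix x assume "x \<in> locA a" "x \<notin> locM a"
  from this(1) obtain f g d where 1: "x = Fract f g" "homogeneous d f" "homogeneous d g" "eval_pol g a \<noteq> 0" "g \<noteq> 0"
    by (rule locA_E)
  have f: "eval_pol f a \<noteq> 0"
    using \<open>x \<notin> locM a\<close> \<open>x \<in> locA a\<close> 1 by (auto simp: locM_def value_at_Fract)
  then have "f \<noteq> 0" by (rule eval_pol_nz)
  with 1 have "x * Fract g f = 1" by (simp add: One_fract_def eq_fract)
  moreover have "Fract g f \<in> locA a" using 1 f by (auto intro: locA_I)
  ultimately show "\<exists>y\<in>locA a. x * y = 1" by blast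
qed (auto simp: locM_def val.Phi_add val.Phi_mult locA_add locA_mult)

section \<open>Power series in two variables\<close>

text \<open>
  The first index belongs to the inner variable \<open>s\<close>, the second one to the outer variable \<open>t\<close>.
\<close>

definition cf :: "nat \<Rightarrow> nat \<Rightarrow> complex fps fps \<Rightarrow> complex" where
  "cf i j F = fps_nth (fps_nth F j) i"

definition fc :: "complex \<Rightarrow> complex fps fps" where "fc c = fps_const (fps_const c)"

definition ord_ge :: "nat \<Rightarrow> complex fps fps \<Rightarrow> bool" where
  "ord_ge n F \<longleftrightarrow> (\<forall>i j. i + j < n \<longrightarrow> cf i j F = 0)"

lemma cf_eqI: "(\<And>i j. cf i j F = cf i j G) \<Longrightarrow> F = G"
  by (auto simp: cf_def fps_eq_iff)

lemma cf_add [simp]: "cf i j (F + G) = cf i j F + cf i j G"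
  and cf_diff [simp]: "cf i j (F - G) = cf i j F - cf i j G"
  and cf_uminus [simp]: "cf i j (- F) = - cf i j F"
  and cf_zero [simp]: "cf i j 0 = 0"
  by (simp_all add: cf_def)

lemma cf_sum: "cf i j (sum f S) = (\<Sum>x\<in>S. cf i j (f x))"
  by (induction S rule: infinite_finite_induct) auto

lemma cf_mult: "cf i j (F * G) = (\<Sum>q\<le>j. \<Sum>p\<le>i. cf p q F * cf (i - p) (j - q) G)"
  by (simp add: cf_def fps_mult_nth fps_sum_nth atLeast0AtMost)

lemma cf_0_0_mult [simp]: "cf 0 0 (F * G) = cf 0 0 F * cf 0 0 G"
  by (simp add: cf_mult)

lemma cf_fc: "cf i j (fc c) = (if i = 0 \<and> j = 0 then c else 0)"
  by (simp add: cf_def fc_def)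

lemma cf_one: "cf i j 1 = (if i = 0 \<and> j = 0 then 1 else 0)"
  by (simp add: cf_def)

lemma cf_fc_mult [simp]: "cf i j (fc c * F) = c * cf i j F"
  by (simp add: cf_def fc_def)

interpretation fc_hom: coeff_hom fc
  by standard (simp_all add: fc_def)

lemma ord_ge_0 [simp]: "ord_ge 0 F" by (simp add: ord_ge_def)

lemma ord_ge_zero [simp]: "ord_ge n 0" by (simp add: ord_ge_def)

lemma ord_ge_mono: "ord_ge n F \<Longrightarrow> m \<le> n \<Longrightarrow> ord_ge m F"
  by (auto simp: ord_ge_def)

lemma ord_ge_add: "ord_ge n F \<Longrightarrow> ord_ge n G \<Longrightarrow> ord_ge n (F + G)"
  by (simp add: ord_ge_def)

lemma ord_ge_diff: "ord_ge n F \<Longrightarrow> ord_ge n G \<Longrightarrow> ord_ge n (F - G)"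
  by (simp add: ord_ge_def)

lemma ord_ge_mult:
  assumes "ord_ge m F" "ord_ge n G"
  shows "ord_ge (m + n) (F * G)"
  unfolding ord_ge_def cf_mult
proof (intro allI impI sum.neutral ballI)
  fix i j p q assume *: "i + j < m + n" "q \<in> {..j}" "p \<in> {..i}"
  then have "p + q < m \<or> (i - p) + (j - q) < n" by auto
  then show "cf p q F * cf (i - p) (j - q) G = 0" using assms by (auto simp: ord_ge_def)
qed

lemma ord_ge_mult_left: "ord_ge n G \<Longrightarrow> ord_ge n (F * G)"
  using ord_ge_mult[of 0 F n G] by simp

lemma ord_ge_eqI: "(\<And>n. ord_ge n (F - G)) \<Longrightarrow> F = G"
proof (rule cf_eqI)
  fix i j assume "\<And>n. ord_ge n (F - G)"
  then have "ord_ge (Suc (i + j)) (F - G)" .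
  then show "cf i j F = cf i j G" by (simp add: ord_ge_def)
qed

lemma fps2_unit:
  assumes "cf 0 0 F \<noteq> 0" shows "F dvd 1"
proof -
  have "fps_nth F 0 * inverse (fps_nth F 0) = 1"
    using assms by (intro inverse_mult_eq_1') (simp add: cf_def)
  then have "F * fps_right_inverse F (inverse (fps_nth F 0)) = 1"
    by (rule fps_right_inverse)
  then show ?thesis by (metis dvdI)
qed

section \<open>Hensel's lemma for power series\<close>

lemma poly_taylor1:
  fixes p :: "'a::idom poly"
  shows "\<exists>e. poly p (x + d) = poly p x + poly (pderiv p) x * d + e * d ^ 2"
proof (induction p)
  case 0 then show ?case by (auto intro: exI[of _ 0])
next
  case (pCons c p)
  then obtain e where e: "poly p (x + d) = poly p x + poly (pderiv p) x * d + e * d ^ 2" by blast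
  have "poly (pCons c p) (x + d) = c + (x + d) * (poly p x + poly (pderiv p) x * d + e * d ^ 2)"
    by (simp only: poly_pCons e)
  then show ?case
    by (intro exI[of _ "e * (x + d) + poly (pderiv p) x"])
      (simp add: pderiv_pCons algebra_simps power2_eq_square)
qed

lemma poly_taylor0:
  fixes p :: "'a::idom poly"
  shows "\<exists>e. poly p (x + d) = poly p x + e * d"
  using poly_taylor1[of p x d]
  by (metis (no_types, lifting) add.assoc distrib_right mult.assoc power2_eq_square)

lemma map_poly_hom:
  fixes g :: "'a::idom \<Rightarrow> 'b::idom"
  assumes [simp]: "g 0 = 0" "g 1 = 1" and add: "\<And>x y. g (x + y) = g x + g y"
    and mult: "\<And>x y. g (x * y) = g x * g y"
  shows "poly (map_poly g p) (g x) = g (poly p x)"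
    and "pderiv (map_poly g p) = map_poly g (pderiv p)"
proof -
  show "poly (map_poly g p) (g x) = g (poly p x)"
    by (induction p) (simp_all add: map_poly_pCons add mult)
  have m: "map_poly g (p + q) = map_poly g p + map_poly g q" for p q
    by (rule poly_eqI) (simp add: coeff_map_poly add)
  show "pderiv (map_poly g p) = map_poly g (pderiv p)"
    by (induction p) (simp_all add: map_poly_pCons pderiv_pCons m)
qed

text \<open>
  Newton iteration, one coefficient at a time. Adding \<open>c X^(n+1)\<close> to an approximate root changes
  coefficient number \<open>n + 1\<close> of the value by \<open>c\<close> times the derivative at \<open>r0\<close>, whose inverse is \<open>u\<close>, and changes
  no earlier coefficient; the quadratic term of the Taylor expansion only starts at \<open>2 (n + 1)\<close>.
\<close>

lemma fps_hensel:
  fixes p :: "'a::idom fps poly" and r0 :: 'a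
  defines "p0 \<equiv> map_poly (\<lambda>c. fps_nth c 0) p"
  assumes root: "poly p0 r0 = 0" and unit: "poly (pderiv p0) r0 * u = 1"
  shows "\<exists>r. fps_nth r 0 = r0 \<and> poly p r = 0"
proof -
  have h1: "fps_nth (poly p x) 0 = poly p0 (fps_nth x 0)" for x
    unfolding p0_def using map_poly_hom(1)[of "\<lambda>c::'a fps. fps_nth c 0" p x] by simp
  have h2: "fps_nth (poly (pderiv p) x) 0 = poly (pderiv p0) (fps_nth x 0)" for x
    unfolding p0_def using map_poly_hom(1)[of "\<lambda>c::'a fps. fps_nth c 0" "pderiv p" x]
      map_poly_hom(2)[of "\<lambda>c::'a fps. fps_nth c 0" p] by simp
  define S where "S = rec_nat (fps_const r0)
      (\<lambda>n s. s + fps_const (- u * fps_nth (poly p s) (Suc n)) * fps_X ^ Suc n)"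
  have S0: "S 0 = fps_const r0" by (simp add: S_def)
  have SS: "S (Suc n) = S n + fps_const (- u * fps_nth (poly p (S n)) (Suc n)) * fps_X ^ Suc n" for n
    by (simp add: S_def)
  have nth0: "fps_nth (S n) 0 = r0" for n
    by (induction n) (simp_all add: S0 SS)
  have key: "\<forall>k\<le>n. fps_nth (poly p (S n)) k = 0" for n
  proof (induction n)
    case 0 then show ?case by (simp add: h1 nth0 root)
  next
    case (Suc n)
    let ?c = "- u * fps_nth (poly p (S n)) (Suc n)"
    obtain e where e: "poly p (S (Suc n)) = poly p (S n) + poly (pderiv p) (S n) * (fps_const ?c * fps_X ^ Suc n)
        + e * (fps_const ?c * fps_X ^ Suc n) ^ 2"
      using poly_taylor1[of p "S n"] unfolding SS by blast
    have sq: "(fps_const ?c * fps_X ^ Suc n) ^ 2 = fps_const ?c ^ 2 * fps_X ^ (2 * Suc n)"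
      by (simp only: power_mult_distrib power_mult[symmetric] mult.commute[of 2])
    have e': "poly p (S (Suc n)) = poly p (S n) + (poly (pderiv p) (S n) * fps_const ?c) * fps_X ^ Suc n
        + (e * fps_const ?c ^ 2) * fps_X ^ (2 * Suc n)"
      unfolding e sq by (simp only: mult.assoc)
    show ?case
    proof (intro allI impI)
      fix k assume "k \<le> Suc n"
      then consider "k \<le> n" | "k = Suc n" by linarith
      then show "fps_nth (poly p (S (Suc n))) k = 0"
      proof cases
        case 1 with Suc show ?thesis
          unfolding e' by (simp add: fps_X_power_mult_right_nth del: power_Suc)
      next
        case 2
        have "poly (pderiv p0) r0 * (- u * fps_nth (poly p (S n)) (Suc n)) =
            - (poly (pderiv p0) r0 * u) * fps_nth (poly p (S n)) (Suc n)" by (simp add: algebra_simps)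
        with 2 show ?thesis
          unfolding e' by (simp add: fps_X_power_mult_right_nth h2 nth0 unit del: power_Suc)
      qed
    qed
  qed
  have stable: "fps_nth (S (n + m)) n = fps_nth (S n) n" for n m
    by (induction m) (simp_all add: SS fps_X_power_mult_right_nth del: power_Suc)
  define r where "r = Abs_fps (\<lambda>n. fps_nth (S n) n)"
  have "fps_nth (poly p r) n = 0" for n
  proof -
    have z: "fps_nth (r - S n) k = 0" if "k \<le> n" for k
      using stable[of k "n - k"] that by (simp add: r_def)
    obtain e where "poly p (S n + (r - S n)) = poly p (S n) + e * (r - S n)"
      using poly_taylor0 by blast
    then have "fps_nth (poly p r) n = fps_nth (poly p (S n)) n + fps_nth (e * (r - S n)) n"
      by (metis add.commute diff_add_cancel fps_add_nth)
    also have "fps_nth (e * (r - S n)) n = 0"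
      unfolding fps_mult_nth by (intro sum.neutral) (auto simp: z simp del: fps_sub_nth)
    finally show ?thesis using key by simp
  qed
  then have "poly p r = 0" by (simp add: fps_eq_iff)
  moreover have "fps_nth r 0 = r0" by (simp add: r_def nth0)
  ultimately show ?thesis by blast
qed

text \<open>
  The root is lifted twice, through the inner and then through the outer power series ring. The
  derivative stays a unit because its constant term is nonzero.
\<close>

lemma fps2_hensel:
  fixes p :: "complex fps fps poly"
  assumes "poly (map_poly (cf 0 0) p) r0 = 0" "poly (pderiv (map_poly (cf 0 0) p)) r0 \<noteq> 0"
  shows "\<exists>r. cf 0 0 r = r0 \<and> poly p r = 0"
proof -
  let ?c = "\<lambda>c::complex fps. fps_nth c 0" and ?d = "\<lambda>c::complex fps fps. fps_nth c 0"
  define q where "q = map_poly ?d p"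
  have q: "map_poly ?c q = map_poly (cf 0 0) p"
    unfolding q_def by (subst map_poly_map_poly) (simp_all add: o_def cf_def[abs_def])
  have "\<exists>r. fps_nth r 0 = r0 \<and> poly q r = 0"
  proof (rule fps_hensel)
    show "poly (map_poly ?c q) r0 = 0" using assms q by simp
    show "poly (pderiv (map_poly ?c q)) r0 * inverse (poly (pderiv (map_poly ?c q)) r0) = 1"
      using assms q by simp
  qed
  then obtain r where r: "fps_nth r 0 = r0" "poly q r = 0" by blast
  have "fps_nth (poly (pderiv q) r) 0 = poly (pderiv (map_poly ?c q)) r0"
    using map_poly_hom(1)[of ?c "pderiv q" r] map_poly_hom(2)[of ?c q] r by simp
  then have "fps_nth (poly (pderiv q) r) 0 \<noteq> 0" using assms q by simp
  then have "poly (pderiv q) r * inverse (poly (pderiv q) r) = 1" by (rule inverse_mult_eq_1')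
  then have "\<exists>s. fps_nth s 0 = r \<and> poly p s = 0"
    using fps_hensel[of p r] r unfolding q_def by blast
  then show ?thesis using r by (auto simp: cf_def)
qed

section \<open>Identifying a completion with a ring of power series\<close>

text \<open>
  An element of the completion is a decreasing sequence of cosets. By \<open>ord\<close> the images of representatives
  form a Cauchy sequence of power series, and the isomorphism takes its limit. It is injective since by
  \<open>pow\<close> an element whose image has high order lies in a high power of the ideal, and by \<open>dense\<close> every
  series in \<open>B\<close> is a limit of images.
\<close>

lemma completion_iso:
  fixes R :: "('a, 'b) ring_scheme" (structure) and \<phi> :: "'a \<Rightarrow> complex fps fps"
  assumes R: "cring R" and m: "ideal m R" and hom: "\<phi> \<in> Ring.ring_hom R (ring_on UNIV)"
    and ord: "\<And>n x. x \<in> ideal_pow R m n \<Longrightarrow> ord_ge n (\<phi> x)"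
    and pow: "\<And>n. \<exists>k. \<forall>x\<in>carrier R. ord_ge k (\<phi> x) \<longrightarrow> x \<in> ideal_pow R m n"
    and dense: "\<And>F k. F \<in> B \<Longrightarrow> \<exists>x\<in>carrier R. ord_ge k (F - \<phi> x)"
    and B: "B = {F. \<forall>i j. \<not> W i j \<longrightarrow> cf i j F = 0}"
    and img: "\<And>x. x \<in> carrier R \<Longrightarrow> \<phi> x \<in> B"
  shows "\<exists>h\<in>ring_iso (completion R m) (ring_on B). \<forall>a\<in>carrier R. h (to_completion R m a) = \<phi> a"
proof -
  interpret cring R by (rule R)
  define J where "J n = ideal_pow R m n" for n
  have J0: "J 0 = carrier R" by (simp add: J_def ideals_set_def)
  have JS: "J (Suc n) = ideal_prod R (J n) m" for n by (simp add: J_def ideals_set_def nat_pow_def)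
  have JI: "ideal (J n) R" for n
    by (induction n) (simp_all add: J0 JS oneideal ideal_prod_is_ideal m)
  have JSub: "J (Suc n) \<subseteq> J n" for n
    unfolding JS using ideal_prod_inter[OF JI m] by blast
  have ph_add: "\<phi> (x \<oplus> y) = \<phi> x + \<phi> y" and ph_mult: "\<phi> (x \<otimes> y) = \<phi> x * \<phi> y"
    if "x \<in> carrier R" "y \<in> carrier R" for x y
    using ring_hom_add[OF hom that] ring_hom_mult[OF hom that] unfolding ring_on_simps .
  have ph_one: "\<phi> \<one> = 1" using ring_hom_one[OF hom] unfolding ring_on_simps .
  have ph_minus: "\<phi> (x \<ominus> y) = \<phi> x - \<phi> y" if "x \<in> carrier R" "y \<in> carrier R" for x y
  proof -
    have "(x \<ominus> y) \<oplus> y = x" using that by algebra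
    then have "\<phi> (x \<ominus> y) + \<phi> y = \<phi> x" using ph_add[of "x \<ominus> y" y] that by simp
    then show ?thesis by (simp add: eq_diff_eq)
  qed
  have coset_mem: "r \<in> J n +> s \<longleftrightarrow> r \<in> carrier R \<and> r \<ominus> s \<in> J n" if "s \<in> carrier R" for r s n
  proof -
    interpret j: ideal "J n" R by (rule JI)
    show ?thesis using that j.a_rcos_module_minus[OF ring_axioms, of s r] j.a_elemrcos_carrier[of s r] by blast
  qed
  have coset_self: "r \<in> J n +> r" if "r \<in> carrier R" for r n
  proof -
    interpret j: ideal "J n" R by (rule JI)
    show ?thesis using j.a_rcos_self[OF that] .
  qed
  have coset_eq: "J n +> r = J n +> s" if "r \<in> carrier R" "s \<in> carrier R" "r \<ominus> s \<in> J n" for r s n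
  proof -
    interpret j: ideal "J n" R by (rule JI)
    have "r \<in> J n +> s" using that coset_mem by blast
    then show ?thesis using j.a_repr_independence'[of r s] that by simp
  qed
  define C where "C = carrier (completion R m)"
  have C_iff: "x \<in> C \<longleftrightarrow> (\<forall>n. (\<exists>r\<in>carrier R. x n = J n +> r) \<and> x (Suc n) \<subseteq> x n)" for x
    unfolding C_def completion_def by (auto simp: FactRing_def A_RCOSETS_def' J_def)
  have C1: "\<exists>r\<in>carrier R. x n = J n +> r" if "x \<in> C" for x n
    using C_iff[THEN iffD1, OF that, rule_format, of n] by (rule conjunct1)
  have C_sub: "x k \<subseteq> x n" if "x \<in> C" "n \<le> k" for x n k
    using that(2) by (induction rule: dec_induct) (use that(1) C_iff in blast)+
  have C_carr: "r \<in> carrier R" if "x \<in> C" "r \<in> x n" for x n r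
    using that coset_mem unfolding C_iff by metis
  have C_coset: "x n = J n +> r" if "x \<in> C" "r \<in> x n" for x n r
  proof -
    from C1[OF that(1), of n] obtain s where s: "s \<in> carrier R" "x n = J n +> s" by (elim bexE)
    from that(2) have "r \<in> J n +> s" by (simp only: s(2))
    then have "r \<ominus> s \<in> J n" "r \<in> carrier R" using coset_mem[OF s(1)] by blast+
    then show ?thesis using s coset_eq by metis
  qed
  have C_diff: "ord_ge n (\<phi> r - \<phi> s)" if "x \<in> C" "r \<in> x n" "s \<in> x n" for x n r s
  proof -
    have "r \<ominus> s \<in> J n" using that C_coset[OF that(1,3)] C_carr coset_mem by metis
    then show ?thesis using ord[of "r \<ominus> s" n] ph_minus C_carr that by (metis J_def)
  qed
  have C_ex: "\<exists>r. r \<in> x n" if "x \<in> C" for x n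
    using that coset_self unfolding C_iff by metis
  \<comment> \<open>coset number \<open>i + j + 1\<close> determines all coefficients of total degree at most \<open>i + j\<close>\<close>
  define h where "h x = Abs_fps (\<lambda>j. Abs_fps (\<lambda>i. cf i j (\<phi> (SOME r. r \<in> x (Suc (i + j))))))" for x
  have h_ord: "ord_ge n (h x - \<phi> r)" if x: "x \<in> C" and r: "r \<in> x n" for x r n
    unfolding ord_ge_def
  proof (intro allI impI)
    fix i j assume "i + j < n"
    then have "r \<in> x (Suc (i + j))" using C_sub[OF x, of "Suc (i + j)" n] r by auto
    moreover have "(SOME r. r \<in> x (Suc (i + j))) \<in> x (Suc (i + j))" using C_ex[OF x] by (rule someI_ex)
    ultimately have "ord_ge (Suc (i + j)) (\<phi> (SOME r. r \<in> x (Suc (i + j))) - \<phi> r)" using C_diff x by blast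
    then have "cf i j (\<phi> (SOME r. r \<in> x (Suc (i + j))) - \<phi> r) = 0" by (simp add: ord_ge_def)
    then show "cf i j (h x - \<phi> r) = 0" by (simp add: h_def cf_def)
  qed
  have h_eq: "h x = F" if "x \<in> C" "\<And>n. \<exists>r\<in>x n. ord_ge n (F - \<phi> r)" for x F
  proof (rule ord_ge_eqI)
    fix n
    from that(2)[of n] obtain r where "r \<in> x n" "ord_ge n (F - \<phi> r)" by blast
    then have "ord_ge n ((h x - \<phi> r) - (F - \<phi> r))" using h_ord[OF that(1)] ord_ge_diff by blast
    then show "ord_ge n (h x - F)" by simp
  qed
  have one_C: "\<one>\<^bsub>completion R m\<^esub> = (\<lambda>n. J n +> \<one>)"
    by (simp add: completion_def FactRing_def J_def)
  have quot_mult: "(J n +> r) \<otimes>\<^bsub>R Quot J n\<^esub> (J n +> s) = J n +> (r \<otimes> s)"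
    and quot_add: "(J n +> r) \<oplus>\<^bsub>R Quot J n\<^esub> (J n +> s) = J n +> (r \<oplus> s)"
    if "r \<in> carrier R" "s \<in> carrier R" for r s n
    using ideal.rcoset_mult_add[OF JI that] ideal.a_rcos_sum[OF JI that] by (simp_all add: FactRing_def)
  have closed: "x \<otimes>\<^bsub>completion R m\<^esub> y \<in> C" "x \<oplus>\<^bsub>completion R m\<^esub> y \<in> C"
    "r \<in> x n \<Longrightarrow> s \<in> y n \<Longrightarrow> r \<otimes> s \<in> (x \<otimes>\<^bsub>completion R m\<^esub> y) n"
    "r \<in> x n \<Longrightarrow> s \<in> y n \<Longrightarrow> r \<oplus> s \<in> (x \<oplus>\<^bsub>completion R m\<^esub> y) n"
    if x: "x \<in> C" and y: "y \<in> C" for x y r s n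
  proof -
    have mu: "(x \<otimes>\<^bsub>completion R m\<^esub> y) n = J n +> (r \<otimes> s)"
      and ad: "(x \<oplus>\<^bsub>completion R m\<^esub> y) n = J n +> (r \<oplus> s)" if "r \<in> x n" "s \<in> y n" for r s n
      using that C_coset[OF x that(1)] C_coset[OF y that(2)] C_carr[OF x that(1)] C_carr[OF y that(2)]
      by (simp_all add: completion_def quot_mult quot_add flip: J_def)
    show "r \<in> x n \<Longrightarrow> s \<in> y n \<Longrightarrow> r \<otimes> s \<in> (x \<otimes>\<^bsub>completion R m\<^esub> y) n"
      "r \<in> x n \<Longrightarrow> s \<in> y n \<Longrightarrow> r \<oplus> s \<in> (x \<oplus>\<^bsub>completion R m\<^esub> y) n" for r s n
      using C_carr[OF x, of r n] C_carr[OF y, of s n] by (simp_all add: mu ad coset_self)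
    have "(\<exists>t\<in>carrier R. (x \<otimes>\<^bsub>completion R m\<^esub> y) n = J n +> t) \<and>
       (x \<otimes>\<^bsub>completion R m\<^esub> y) (Suc n) \<subseteq> (x \<otimes>\<^bsub>completion R m\<^esub> y) n \<and>
       (\<exists>t\<in>carrier R. (x \<oplus>\<^bsub>completion R m\<^esub> y) n = J n +> t) \<and>
       (x \<oplus>\<^bsub>completion R m\<^esub> y) (Suc n) \<subseteq> (x \<oplus>\<^bsub>completion R m\<^esub> y) n" for n
    proof -
      obtain r s where rs: "r \<in> x (Suc n)" "s \<in> y (Suc n)" using C_ex x y by blast
      then have rs': "r \<in> x n" "s \<in> y n" using x y C_iff by blast+
      have c: "r \<in> carrier R" "s \<in> carrier R" using rs C_carr x y by blast+
      have sub: "J (Suc n) +> t \<subseteq> J n +> t" if "t \<in> carrier R" for t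
        using that subsetD[OF JSub] by (auto simp: coset_mem)
      show ?thesis
        unfolding mu[OF rs] mu[OF rs'] ad[OF rs] ad[OF rs'] using c sub by blast
    qed
    then show "x \<otimes>\<^bsub>completion R m\<^esub> y \<in> C" "x \<oplus>\<^bsub>completion R m\<^esub> y \<in> C" unfolding C_iff by blast+
  qed
  have to_C: "(\<lambda>n. J n +> a) \<in> C" if "a \<in> carrier R" for a
    unfolding C_iff using that subsetD[OF JSub] by (auto simp: coset_mem)
  have h_to: "h (\<lambda>n. J n +> a) = \<phi> a" if "a \<in> carrier R" for a
    by (rule h_eq[OF to_C[OF that]]) (use that coset_self in \<open>auto intro!: bexI[of _ a]\<close>)
  have h_B: "h x \<in> B" if x: "x \<in> C" for x
    unfolding B
  proof (intro CollectI allI impI)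
    fix i j assume w: "\<not> W i j"
    obtain r where r: "r \<in> x (Suc (i + j))" using C_ex[OF x] by blast
    then have "\<phi> r \<in> B" using C_carr x img by blast
    with w have "cf i j (\<phi> r) = 0" by (simp add: B)
    moreover have "cf i j (h x - \<phi> r) = 0" using h_ord[OF x r] by (simp add: ord_ge_def)
    ultimately show "cf i j (h x) = 0" by simp
  qed
  have "h \<in> Ring.ring_hom (completion R m) (ring_on B)"
  proof (rule ring_hom_memI)
    fix x assume "x \<in> carrier (completion R m)"
    then show "h x \<in> carrier (ring_on B)" using h_B by (simp add: C_def)
  next
    fix x y assume "x \<in> carrier (completion R m)" "y \<in> carrier (completion R m)"
    then have x: "x \<in> C" and y: "y \<in> C" by (simp_all add: C_def)
    show "h (x \<otimes>\<^bsub>completion R m\<^esub> y) = h x \<otimes>\<^bsub>ring_on B\<^esub> h y"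
      unfolding ring_on_simps
    proof (rule h_eq[OF closed(1)[OF x y]])
      fix n
      obtain r s where rs: "r \<in> x n" "s \<in> y n" using C_ex x y by blast
      have "ord_ge n (h x * (h y - \<phi> s) + (\<phi> s) * (h x - \<phi> r))"
        using h_ord[OF x rs(1)] h_ord[OF y rs(2)] by (intro ord_ge_add ord_ge_mult_left)
      then have "ord_ge n (h x * h y - \<phi> (r \<otimes> s))"
        using ph_mult C_carr[OF x rs(1)] C_carr[OF y rs(2)] by (simp add: algebra_simps)
      then show "\<exists>r\<in>(x \<otimes>\<^bsub>completion R m\<^esub> y) n. ord_ge n (h x * h y - \<phi> r)"
        using closed(3)[OF x y rs] by blast
    qed
    show "h (x \<oplus>\<^bsub>completion R m\<^esub> y) = h x \<oplus>\<^bsub>ring_on B\<^esub> h y"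
      unfolding ring_on_simps
    proof (rule h_eq[OF closed(2)[OF x y]])
      fix n
      obtain r s where rs: "r \<in> x n" "s \<in> y n" using C_ex x y by blast
      have "ord_ge n ((h x - \<phi> r) + (h y - \<phi> s))"
        using h_ord[OF x rs(1)] h_ord[OF y rs(2)] by (intro ord_ge_add)
      then have "ord_ge n (h x + h y - \<phi> (r \<oplus> s))"
        using ph_add C_carr[OF x rs(1)] C_carr[OF y rs(2)] by (simp add: algebra_simps)
      then show "\<exists>r\<in>(x \<oplus>\<^bsub>completion R m\<^esub> y) n. ord_ge n (h x + h y - \<phi> r)"
        using closed(4)[OF x y rs] by blast
    qed
  next
    show "h \<one>\<^bsub>completion R m\<^esub> = \<one>\<^bsub>ring_on B\<^esub>"
      unfolding one_C ring_on_simps using h_to[OF one_closed] ph_one by simp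
  qed
  moreover have "bij_betw h C B"
  proof (rule bij_betwI')
    fix x y assume x: "x \<in> C" and y: "y \<in> C"
    have "x = y" if hxy: "h x = h y"
    proof
      fix n
      obtain k where k: "\<forall>z\<in>carrier R. ord_ge k (\<phi> z) \<longrightarrow> z \<in> J n" using pow[of n] unfolding J_def by blast
      define N where "N = max k n"
      obtain r s where rs: "r \<in> x N" "s \<in> y N" using C_ex x y by blast
      have c: "r \<in> carrier R" "s \<in> carrier R" using rs C_carr x y by blast+
      have "ord_ge N ((h y - \<phi> s) - (h x - \<phi> r))"
        by (rule ord_ge_diff[OF h_ord[OF y rs(2)] h_ord[OF x rs(1)]])
      then have "ord_ge N (\<phi> (r \<ominus> s))" using c by (simp add: hxy ph_minus algebra_simps)
      then have "ord_ge k (\<phi> (r \<ominus> s))" by (rule ord_ge_mono) (simp add: N_def)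
      then have "r \<ominus> s \<in> J n" using k c by simp
      then have "J n +> r = J n +> s" using c coset_eq by blast
      moreover have "r \<in> x n" "s \<in> y n" using rs C_sub[OF x, of n N] C_sub[OF y, of n N] by (auto simp: N_def)
      ultimately show "x n = y n" using C_coset x y by metis
    qed
    then show "(h x = h y) = (x = y)" by blast
  next
    fix x assume "x \<in> C" then show "h x \<in> B" by (rule h_B)
  next
    fix F assume F: "F \<in> B"
    obtain k where k: "\<And>n z. z \<in> carrier R \<Longrightarrow> ord_ge (k n) (\<phi> z) \<Longrightarrow> z \<in> J n"
      using pow unfolding J_def by metis
    obtain q where q: "\<And>n. q n \<in> carrier R" "\<And>n. ord_ge n (F - \<phi> (q n))" using dense[OF F] by metis
    \<comment> \<open>a monotone function above \<open>k\<close> and the identity, so that the cosets of the \<open>q (K n)\<close> are nested\<close>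
    define K where "K n = n + (\<Sum>i\<le>n. k i)" for n
    have K: "k n \<le> K n" "n \<le> K n" "K n \<le> K (Suc n)" for n
    proof -
      have "k n \<le> (\<Sum>i\<le>n. k i)" by (rule member_le_sum) auto
      then show "k n \<le> K n" by (simp add: K_def)
    qed (simp_all add: K_def)
    define x where "x n = J n +> q (K n)" for n
    have "x \<in> C"
      unfolding C_iff
    proof (intro allI conjI)
      fix n show "\<exists>r\<in>carrier R. x n = J n +> r" unfolding x_def using q by blast
      have "ord_ge (K n) ((F - \<phi> (q (K n))) - (F - \<phi> (q (K (Suc n)))))"
        using q(2)[of "K n"] ord_ge_mono[OF q(2)[of "K (Suc n)"] K(3)] by (rule ord_ge_diff)
      then have "ord_ge (K n) (\<phi> (q (K (Suc n)) \<ominus> q (K n)))" using q(1) by (simp add: ph_minus algebra_simps)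
      then have "ord_ge (k n) (\<phi> (q (K (Suc n)) \<ominus> q (K n)))" using K(1) ord_ge_mono by blast
      then have "q (K (Suc n)) \<ominus> q (K n) \<in> J n" using k q(1) by simp
      then have "J n +> q (K (Suc n)) = J n +> q (K n)" using coset_eq q(1) by blast
      moreover have "J (Suc n) +> q (K (Suc n)) \<subseteq> J n +> q (K (Suc n))"
        using subsetD[OF JSub] q(1) by (auto simp: coset_mem)
      ultimately show "x (Suc n) \<subseteq> x n" by (simp add: x_def)
    qed
    moreover have "h x = F"
    proof (rule h_eq[OF \<open>x \<in> C\<close>])
      fix n
      show "\<exists>r\<in>x n. ord_ge n (F - \<phi> r)"
        unfolding x_def using coset_self[OF q(1)] ord_ge_mono[OF q(2) K(2)] by blast
    qed
    ultimately show "\<exists>x\<in>C. F = h x" by blast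
  qed
  ultimately have "h \<in> ring_iso (completion R m) (ring_on B)"
    unfolding ring_iso_def C_def by simp
  moreover have "\<forall>a\<in>carrier R. h (to_completion R m a) = \<phi> a"
    unfolding to_completion_def using h_to by (simp flip: J_def)
  ultimately show ?thesis by blast
qed

section \<open>Dimension two as a growth condition\<close>

text \<open>
  Gaussian elimination: an equation that is not identically zero is solved for one unknown \<open>j0\<close>, which
  leaves one equation and one unknown less.
\<close>

lemma homogeneous_linear_system:
  fixes c :: "'j \<Rightarrow> 'k \<Rightarrow> complex"
  assumes "finite T" "finite J" "card T < card J"
  shows "\<exists>x. (\<exists>j\<in>J. x j \<noteq> 0) \<and> (\<forall>k\<in>T. (\<Sum>j\<in>J. x j * c j k) = 0)"
  using assms
proof (induction T arbitrary: J c)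
  case empty
  then have "J \<noteq> {}" by auto
  then show ?case by (intro exI[of _ "\<lambda>_. 1"]) auto
next
  case (insert k T)
  show ?case
  proof (cases "\<forall>j\<in>J. c j k = 0")
    case True
    obtain x where "\<exists>j\<in>J. x j \<noteq> 0" "\<forall>l\<in>T. (\<Sum>j\<in>J. x j * c j l) = 0"
      using insert.IH[of J c] insert.prems insert.hyps by auto
    with True show ?thesis by (intro exI[of _ x]) auto
  next
    case False
    then obtain j0 where j0: "j0 \<in> J" "c j0 k \<noteq> 0" by auto
    define J' where "J' = J - {j0}"
    have J: "J = insert j0 J'" "j0 \<notin> J'" "finite J'" using j0 insert.prems by (auto simp: J'_def)
    have "card T < card J'" using insert.prems insert.hyps J by auto
    then obtain x where x: "\<exists>j\<in>J'. x j \<noteq> 0"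
        "\<And>l. l \<in> T \<Longrightarrow> (\<Sum>j\<in>J'. x j * (c j l - c j k / c j0 k * c j0 l)) = 0"
      using insert.IH[of J' "\<lambda>j l. c j l - c j k / c j0 k * c j0 l"] J by auto
    define x' where "x' = x(j0 := - (\<Sum>j\<in>J'. x j * c j k) / c j0 k)"
    have sum: "(\<Sum>j\<in>J. x' j * c j l) = (\<Sum>j\<in>J'. x j * c j l) - (\<Sum>j\<in>J'. x j * c j k) / c j0 k * c j0 l" for l
    proof -
      have "(\<Sum>j\<in>J'. x' j * c j l) = (\<Sum>j\<in>J'. x j * c j l)"
        using J by (intro sum.cong) (auto simp: x'_def)
      then show ?thesis using J by (simp add: x'_def)
    qed
    show ?thesis
    proof (intro exI[of _ x'] conjI ballI)
      show "\<exists>j\<in>J. x' j \<noteq> 0" using x(1) J by (auto simp: x'_def)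
      fix l assume "l \<in> insert k T"
      then show "(\<Sum>j\<in>J. x' j * c j l) = 0"
      proof
        assume "l = k" then show ?thesis unfolding sum using j0 by simp
      next
        assume l: "l \<in> T"
        have "(\<Sum>j\<in>J'. x j * (c j l - c j k / c j0 k * c j0 l)) =
           (\<Sum>j\<in>J'. x j * c j l - x j * c j k * (c j0 l / c j0 k))"
          by (intro sum.cong) (auto simp: algebra_simps)
        also have "\<dots> = (\<Sum>j\<in>J'. x j * c j l) - (\<Sum>j\<in>J'. x j * c j k) * (c j0 l / c j0 k)"
          by (simp only: sum_subtractf sum_distrib_right)
        finally show ?thesis unfolding sum using x(2)[OF l] by simp
      qed
    qed
  qed
qed

text \<open>
  The terms of the sum below \<open>i0\<close> vanish, so \<open>x ^ i0\<close> can be cancelled modulo the prime \<open>Q\<close>; modulo \<open>Q'\<close>,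
  which contains \<open>x\<close>, only the term \<open>d i0\<close> is left.
\<close>

lemma (in subring_quot) prime_chain_step:
  fixes Q Q' :: "'a set"
  assumes Q: "Q \<subseteq> Q'" "\<And>u v. u \<in> A \<Longrightarrow> v \<in> A \<Longrightarrow> u * v \<in> Q \<Longrightarrow> u \<in> Q \<or> v \<in> Q" "1 \<notin> Q"
    and Q': "\<And>u v. u \<in> Q' \<Longrightarrow> v \<in> Q' \<Longrightarrow> u + v \<in> Q'" "\<And>u v. u \<in> A \<Longrightarrow> v \<in> Q' \<Longrightarrow> u * v \<in> Q'"
    and x: "x \<in> A" "x \<notin> Q" "x \<in> Q'"
    and d: "\<And>i. d i \<in> A" "\<And>i. i < i0 \<Longrightarrow> d i = 0" "i0 \<le> N" and sum: "(\<Sum>i\<le>N. d i * x ^ i) \<in> Q"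
  shows "d i0 \<in> Q'"
proof -
  define s where "s = (\<Sum>i\<in>{i0<..N}. d i * x ^ (i - Suc i0))"
  have s: "s \<in> A" unfolding s_def using d x by (intro A_sum A_mult A_power) auto
  have "(\<Sum>i\<le>N. d i * x ^ i) = (\<Sum>i\<in>{i0..N}. d i * x ^ i)"
    using d by (intro sum.mono_neutral_right) auto
  also have "{i0..N} = insert i0 {i0<..N}" using d(3) by auto
  also have "(\<Sum>i\<in>insert i0 {i0<..N}. d i * x ^ i) = d i0 * x ^ i0 + (\<Sum>i\<in>{i0<..N}. d i * x ^ i)"
    by simp
  also have "(\<Sum>i\<in>{i0<..N}. d i * x ^ i) = x ^ i0 * (x * s)"
    unfolding s_def sum_distrib_left
  proof (intro sum.cong refl)
    fix i assume "i \<in> {i0<..N}"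
    then have "i = i0 + (1 + (i - Suc i0))" by auto
    then have "x ^ i = x ^ i0 * (x * x ^ (i - Suc i0))" by (metis power_add power_one_right)
    then show "d i * x ^ i = x ^ i0 * (x * (d i * x ^ (i - Suc i0)))" by (simp add: mult_ac)
  qed
  finally have "x ^ i0 * (d i0 + x * s) \<in> Q" using sum by (simp add: algebra_simps)
  moreover have "x ^ n \<notin> Q" for n
    by (induction n) (use Q(2)[OF x(1) A_power[OF x(1)]] Q(3) x in auto)
  ultimately have "d i0 + x * s \<in> Q" using Q(2) x s d by (metis A_add A_mult A_power)
  then have "d i0 + x * s \<in> Q'" using Q by auto
  moreover have "(- s) * x \<in> Q'" using Q'(2) s x A_uminus by blast
  ultimately have "(d i0 + x * s) + (- s) * x \<in> Q'" by (rule Q'(1))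
  then show ?thesis by (simp add: algebra_simps)
qed

text \<open>
  Suppose \<open>Q 0 \<subset> Q 1 \<subset> Q 2 \<subset> Q 3\<close> are primes, with \<open>x, y, z\<close> in the successive differences. In a relation
  between \<open>x, y, z\<close>, the lowest nonzero coefficient with respect to \<open>x\<close> lies in \<open>Q 1\<close>; its lowest coefficient
  with respect to \<open>y\<close> lies in \<open>Q 2\<close>, and the lowest coefficient of that with respect to \<open>z\<close> is a nonzero
  constant in \<open>Q 3\<close>.
\<close>

lemma (in subring_quot) krull_dim_le_2:
  fixes k :: "complex \<Rightarrow> 'a"
  assumes k: "\<And>c. k c \<in> A" "k 0 = 0" "\<And>c. c \<noteq> 0 \<Longrightarrow> \<exists>u\<in>A. u * k c = 1"
    and dep: "\<And>x y z. x \<in> A \<Longrightarrow> y \<in> A \<Longrightarrow> z \<in> A \<Longrightarrow> \<exists>N c.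
       (\<exists>i\<le>N. \<exists>j\<le>N. \<exists>l\<le>N. c i j l \<noteq> 0) \<and>
       (\<Sum>i\<le>N. \<Sum>j\<le>N. \<Sum>l\<le>N. k (c i j l) * x ^ i * y ^ j * z ^ l) \<in> I"
  shows "krull_dim R \<le> 2"
proof -
  have "n \<le> 2" if ch: "\<forall>i\<le>n. primeideal (\<pp> i) R" "\<forall>i<n. \<pp> i \<subset> \<pp> (Suc i)" for n :: nat and \<pp>
  proof (rule ccontr)
    assume "\<not> n \<le> 2"
    then have n: "n \<ge> 3" by simp
    define Q where "Q i = {x \<in> A. proj x \<in> \<pp> i}" for i
    have pr: "primeideal (\<pp> i) R" if "i \<le> 3" for i using ch n that by auto
    note pc = prime_contraction[OF pr, folded Q_def]
    have QA: "Q i \<subseteq> A" for i by (auto simp: Q_def)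
    have strict: "\<exists>x. x \<in> Q (Suc i) \<and> x \<notin> Q i" if "i < 3" for i
    proof -
      have "\<pp> i \<subset> \<pp> (Suc i)" using ch n that by auto
      then obtain C where C: "C \<in> \<pp> (Suc i)" "C \<notin> \<pp> i" by blast
      interpret primeideal "\<pp> (Suc i)" R using pr that by simp
      obtain x where "x \<in> A" "C = proj x" using Icarr[OF C(1)] by (auto simp: carrier_R)
      with C show ?thesis by (auto simp: Q_def)
    qed
    have mono: "Q i \<subseteq> Q (Suc i)" if "i < 3" for i
    proof -
      have "\<pp> i \<subset> \<pp> (Suc i)" using ch n that by auto
      then show ?thesis by (auto simp: Q_def)
    qed
    obtain x where x: "x \<in> Q 1" "x \<notin> Q 0" using strict[of 0] by auto
    obtain y where y: "y \<in> Q 2" "y \<notin> Q 1" using strict[of 1] by (auto simp: numeral_2_eq_2)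
    obtain z where z: "z \<in> Q 3" "z \<notin> Q 2" using strict[of 2] by (auto simp: numeral_3_eq_3)
    have xyz: "x \<in> A" "y \<in> A" "z \<in> A" using x y z QA by auto
    have Q12: "Q 0 \<subseteq> Q 1" "Q 1 \<subseteq> Q 2" "Q 2 \<subseteq> Q 3"
      using mono[of 0] mono[of 1] mono[of 2] by (simp_all add: numeral_2_eq_2 numeral_3_eq_3)
    obtain N c where c: "\<exists>i\<le>N. \<exists>j\<le>N. \<exists>l\<le>N. c i j l \<noteq> 0"
      and S: "(\<Sum>i\<le>N. \<Sum>j\<le>N. \<Sum>l\<le>N. k (c i j l) * x ^ i * y ^ j * z ^ l) \<in> I"
      using dep[OF xyz] by blast
    define p where "p i j = (\<Sum>l\<le>N. k (c i j l) * z ^ l)" for i j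
    define q where "q i = (\<Sum>j\<le>N. p i j * y ^ j)" for i
    have p_A: "p i j \<in> A" and q_A: "q i \<in> A" for i j
      unfolding q_def p_def using k xyz by (auto intro!: A_sum A_mult A_power)
    have "(\<Sum>i\<le>N. q i * x ^ i) \<in> Q 0"
      using S pc(1)[of 0] by (auto simp: q_def p_def sum_distrib_left sum_distrib_right mult_ac)
    define i0 where "i0 = (LEAST i. i \<le> N \<and> (\<exists>j\<le>N. \<exists>l\<le>N. c i j l \<noteq> 0))"
    have i0: "i0 \<le> N \<and> (\<exists>j\<le>N. \<exists>l\<le>N. c i0 j l \<noteq> 0)"
      unfolding i0_def by (rule LeastI_ex) (use c in auto)
    have i0': "c i j l = 0" if "i < i0" "j \<le> N" "l \<le> N" for i j l
      using not_less_Least[of i "\<lambda>i. i \<le> N \<and> (\<exists>j\<le>N. \<exists>l\<le>N. c i j l \<noteq> 0)"] that i0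
      unfolding i0_def[symmetric] by auto
    define j0 where "j0 = (LEAST j. j \<le> N \<and> (\<exists>l\<le>N. c i0 j l \<noteq> 0))"
    have j0: "j0 \<le> N \<and> (\<exists>l\<le>N. c i0 j0 l \<noteq> 0)"
      unfolding j0_def by (rule LeastI_ex) (use i0 in auto)
    have j0': "c i0 j l = 0" if "j < j0" "l \<le> N" for j l
      using not_less_Least[of j "\<lambda>j. j \<le> N \<and> (\<exists>l\<le>N. c i0 j l \<noteq> 0)"] that j0
      unfolding j0_def[symmetric] by auto
    define l0 where "l0 = (LEAST l. l \<le> N \<and> c i0 j0 l \<noteq> 0)"
    have l0: "l0 \<le> N \<and> c i0 j0 l0 \<noteq> 0"
      unfolding l0_def by (rule LeastI_ex) (use j0 in auto)
    have l0': "c i0 j0 l = 0" if "l < l0" for l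
      using not_less_Least[of l "\<lambda>l. l \<le> N \<and> c i0 j0 l \<noteq> 0"] that l0
      unfolding l0_def[symmetric] by auto
    have "q i0 \<in> Q 1"
    proof (rule prime_chain_step[of "Q 0" "Q 1" x q])
      show "(\<Sum>i\<le>N. q i * x ^ i) \<in> Q 0" by fact
    qed (use x xyz i0 i0' q_A pc(2-5)[of 0] pc(2-5)[of 1] Q12 k in \<open>auto simp: q_def p_def\<close>)
    then have "(\<Sum>j\<le>N. p i0 j * y ^ j) \<in> Q 1" by (simp add: q_def)
    then have "p i0 j0 \<in> Q 2"
      by (rule prime_chain_step[of "Q 1" "Q 2" y "p i0", rotated -1])
        (use y xyz j0 j0' p_A pc(2-5)[of 1] pc(2-5)[of 2] Q12 k in \<open>auto simp: p_def\<close>)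
    then have "(\<Sum>l\<le>N. k (c i0 j0 l) * z ^ l) \<in> Q 2" by (simp add: p_def)
    then have "k (c i0 j0 l0) \<in> Q 3"
      by (rule prime_chain_step[of "Q 2" "Q 3" z "\<lambda>l. k (c i0 j0 l)", rotated -1])
        (use z xyz l0 l0' pc(2-5)[of 2] pc(2-5)[of 3] Q12 k in auto)
    from k(3) l0 obtain u where u: "u \<in> A" "u * k (c i0 j0 l0) = 1" by blast
    have "u * k (c i0 j0 l0) \<in> Q 3" by (rule pc(3)[OF order_refl u(1)]) fact
    then have "1 \<in> Q 3" by (simp only: u(2))
    then show False using pc(4)[of 3] by simp
  qed
  then have "enat n \<le> 2" if "\<exists>\<pp>. (\<forall>i\<le>n. primeideal (\<pp> i) R) \<and> (\<forall>i<n. \<pp> i \<subset> \<pp> (Suc i))" for n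
    using that by (metis enat_ord_simps(1) numeral_eq_enat)
  then show ?thesis unfolding krull_dim_def by (intro Sup_least) auto
qed

text \<open>
  The homomorphism \<open>\<psi>\<close>, followed by setting \<open>t = 0\<close>, and then by setting \<open>s = 0\<close>, has growing prime kernels;
  \<open>f\<close> and \<open>g\<close> witness that they grow strictly.
\<close>

lemma (in subring_quot) krull_dim_ge_2:
  fixes \<psi> :: "'a set \<Rightarrow> complex fps fps"
  assumes hom: "\<psi> \<in> Ring.ring_hom R (ring_on UNIV)"
    and f: "f \<in> carrier R" "\<psi> f \<noteq> 0" "fps_nth (\<psi> f) 0 = 0"
    and g: "g \<in> carrier R" "fps_nth (\<psi> g) 0 \<noteq> 0" "cf 0 0 (\<psi> g) = 0"
  shows "2 \<le> krull_dim R"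
proof -
  have c: "\<And>x y. x \<in> carrier R \<Longrightarrow> y \<in> carrier R \<Longrightarrow> \<psi> (x \<otimes>\<^bsub>R\<^esub> y) = \<psi> x * \<psi> y"
     "\<And>x y. x \<in> carrier R \<Longrightarrow> y \<in> carrier R \<Longrightarrow> \<psi> (x \<oplus>\<^bsub>R\<^esub> y) = \<psi> x + \<psi> y" "\<psi> \<one>\<^bsub>R\<^esub> = 1"
    using ring_hom_mult[OF hom] ring_hom_add[OF hom] ring_hom_one[OF hom] by (simp_all only: ring_on_simps)
  have hom1: "(\<lambda>x. fps_nth (\<psi> x) 0) \<in> Ring.ring_hom R (ring_on UNIV)"
    by (rule ring_hom_memI) (simp_all add: c)
  have hom2: "(\<lambda>x. cf 0 0 (\<psi> x)) \<in> Ring.ring_hom R (ring_on UNIV)"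
    by (rule ring_hom_memI) (simp_all add: c cf_one)
  define \<pp> where "\<pp> i = (if i = 0 then {x \<in> carrier R. \<psi> x = 0}
     else if i = 1 then {x \<in> carrier R. fps_nth (\<psi> x) 0 = 0} else {x \<in> carrier R. cf 0 0 (\<psi> x) = 0})" for i :: nat
  have "primeideal (\<pp> i) R" for i
    unfolding \<pp>_def using kernel_prime[OF cring_R hom] kernel_prime[OF cring_R hom1]
      kernel_prime[OF cring_R hom2] by simp
  moreover have "\<pp> 0 \<subset> \<pp> 1" using f by (auto simp: \<pp>_def)
  moreover have "\<pp> 1 \<subset> \<pp> 2" using g by (auto simp: \<pp>_def cf_def)
  ultimately have "\<forall>i\<le>2. primeideal (\<pp> i) R" "\<forall>i<2. \<pp> i \<subset> \<pp> (Suc i)"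
    by (simp_all add: All_less_Suc numeral_2_eq_2)
  then have "\<exists>\<pp>. (\<forall>i\<le>2. primeideal (\<pp> i) R) \<and> (\<forall>i<2::nat. \<pp> i \<subset> \<pp> (Suc i))"
    by blast
  then have "enat 2 \<le> krull_dim R" unfolding krull_dim_def by (intro Sup_upper) blast
  then show ?thesis by (simp add: numeral_eq_enat)
qed

section \<open>The relations and their Pfaffian presentation\<close>

abbreviation (input) "x0 \<equiv> Var cx0 :: pol"
abbreviation (input) "x1 \<equiv> Var cx1 :: pol"
abbreviation (input) "yy \<equiv> Var cy :: pol"
abbreviation (input) "ww \<equiv> Var cw :: pol"
abbreviation (input) "u0 \<equiv> Var cu0 :: pol"
abbreviation (input) "u1 \<equiv> Var cu1 :: pol"
abbreviation (input) "zz \<equiv> Var cz :: pol"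
abbreviation (input) "tt \<equiv> Var ct :: pol"

lemma homogeneous_vars:
  "homogeneous 1 x0" "homogeneous 1 x1" "homogeneous 2 yy" "homogeneous 3 ww"
  "homogeneous 4 u0" "homogeneous 4 u1" "homogeneous 5 zz" "homogeneous 7 tt"
  by (metis homogeneous_Var wt.simps)+

definition Qpol :: "complex \<Rightarrow> complex \<Rightarrow> pol" where
  "Qpol \<theta> \<tau> = Const \<theta> * u1 * zz + Const \<tau> * ww ^ 3"

lemma relations_eq:
  "relations \<theta> \<tau> P =
      {x0 * yy - x1 ^ 3, x0 * ww - x1 ^ 2 * yy, x1 * ww - yy ^ 2, x0 * u1 - x1 * u0,
       x1 ^ 2 * u1 - yy * u0, x1 * yy * u1 - ww * u0, x0 * tt - u0 ^ 2, x1 * tt - u0 * u1,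
       x1 * u1 ^ 2 - yy * tt, yy * u1 ^ 2 - ww * tt,
       x0 * P + x1 ^ 2 * Qpol \<theta> \<tau> + u0 * tt, x1 * P + yy * Qpol \<theta> \<tau> + u1 * tt,
       yy * P + ww * Qpol \<theta> \<tau> + u1 ^ 3, u0 * P + x1 * u1 * Qpol \<theta> \<tau> + tt ^ 2}"
  by (simp add: relations_def Qpol_def Let_def)

lemma homogeneous_Qpol: "homogeneous 9 (Qpol \<theta> \<tau>)"
proof -
  have "homogeneous (0 + 4 + 5) (Const \<theta> * u1 * zz)"
    by (intro homogeneous_mult homogeneous_Const homogeneous_vars)
  moreover have "homogeneous (0 + 3 * 3) (Const \<tau> * ww ^ 3)"
    by (intro homogeneous_mult homogeneous_Const homogeneous_power homogeneous_vars)
  ultimately show ?thesis unfolding Qpol_def by (intro homogeneous_add) simp_all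
qed

lemma relations_in_ideal:
  fixes \<theta> \<tau> :: complex and P :: pol
  defines "E \<equiv> relations \<theta> \<tau> P" and "Q \<equiv> Qpol \<theta> \<tau>"
  shows rel1: "x0 * yy - x1 ^ 3 \<in> pol_ideal E"
    and rel2: "x0 * ww - x1 ^ 2 * yy \<in> pol_ideal E"
    and rel3: "x1 * ww - yy ^ 2 \<in> pol_ideal E"
    and rel4: "x0 * u1 - x1 * u0 \<in> pol_ideal E"
    and rel5: "x1 ^ 2 * u1 - yy * u0 \<in> pol_ideal E"
    and rel6: "x1 * yy * u1 - ww * u0 \<in> pol_ideal E"
    and rel7: "x0 * tt - u0 ^ 2 \<in> pol_ideal E"
    and rel8: "x1 * tt - u0 * u1 \<in> pol_ideal E"
    and rel9: "x1 * u1 ^ 2 - yy * tt \<in> pol_ideal E"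
    and rel10: "yy * u1 ^ 2 - ww * tt \<in> pol_ideal E"
    and rel11: "x0 * P + x1 ^ 2 * Q + u0 * tt \<in> pol_ideal E"
    and rel12: "x1 * P + yy * Q + u1 * tt \<in> pol_ideal E"
    and rel13: "yy * P + ww * Q + u1 ^ 3 \<in> pol_ideal E"
    and rel14: "u0 * P + x1 * u1 * Q + tt ^ 2 \<in> pol_ideal E"
  unfolding E_def Q_def by (rule pol_ideal_base, simp add: relations_eq)+

context coeff_hom
begin

lemma eval_relations:
  "(\<forall>f\<in>relations \<theta> \<tau> P. eval_hom h X f = 0) \<longleftrightarrow>
    (let p = eval_hom h X P; q = h \<theta> * X cu1 * X cz + h \<tau> * X cw ^ 3 in
       X cx0 * X cy - X cx1 ^ 3 = 0 \<and> X cx0 * X cw - X cx1 ^ 2 * X cy = 0 \<and>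
       X cx1 * X cw - X cy ^ 2 = 0 \<and> X cx0 * X cu1 - X cx1 * X cu0 = 0 \<and>
       X cx1 ^ 2 * X cu1 - X cy * X cu0 = 0 \<and> X cx1 * X cy * X cu1 - X cw * X cu0 = 0 \<and>
       X cx0 * X ct - X cu0 ^ 2 = 0 \<and> X cx1 * X ct - X cu0 * X cu1 = 0 \<and>
       X cx1 * X cu1 ^ 2 - X cy * X ct = 0 \<and> X cy * X cu1 ^ 2 - X cw * X ct = 0 \<and>
       X cx0 * p + X cx1 ^ 2 * q + X cu0 * X ct = 0 \<and> X cx1 * p + X cy * q + X cu1 * X ct = 0 \<and>
       X cy * p + X cw * q + X cu1 ^ 3 = 0 \<and> X cu0 * p + X cx1 * X cu1 * q + X ct ^ 2 = 0)"
  by (simp add: relations_eq Qpol_def eval_hom_simps Let_def)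

end

text \<open>
  These monomials have the weights of the coordinates if \<open>l, a, b, z\<close> have weights \<open>1/5, 3/5, 17/5, 5\<close>.
\<close>

definition toric :: "'r::comm_ring_1 \<Rightarrow> 'r \<Rightarrow> 'r \<Rightarrow> 'r \<Rightarrow> coord \<Rightarrow> 'r" where
  "toric l a b z v = (case v of cx0 \<Rightarrow> l ^ 5 | cx1 \<Rightarrow> a * l ^ 2 | cy \<Rightarrow> a ^ 3 * l | cw \<Rightarrow> a ^ 5
     | cu0 \<Rightarrow> b * l ^ 3 | cu1 \<Rightarrow> a * b | cz \<Rightarrow> z | ct \<Rightarrow> b ^ 2 * l)"

lemma toric_simps [simp]:
  "toric l a b z cx0 = l ^ 5" "toric l a b z cx1 = a * l ^ 2" "toric l a b z cy = a ^ 3 * l"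
  "toric l a b z cw = a ^ 5" "toric l a b z cu0 = b * l ^ 3" "toric l a b z cu1 = a * b"
  "toric l a b z cz = z" "toric l a b z ct = b ^ 2 * l"
  by (simp_all add: toric_def)

text \<open>
  The four relations that involve \<open>P\<close> become \<open>l\<^sup>4, a l, a\<^sup>3\<close> and \<open>b l\<^sup>2\<close> times the equation in the
  assumption.
\<close>

lemma (in coeff_hom) toric_relations:
  assumes "l * eval_hom h (toric l a b z) P + a ^ 2 * (h \<theta> * (a * b) * z + h \<tau> * a ^ 15) + b ^ 3 = 0"
    and "f \<in> relations \<theta> \<tau> P"
  shows "eval_hom h (toric l a b z) f = 0"
proof -
  define p where "p = eval_hom h (toric l a b z) P"
  define q where "q = h \<theta> * (a * b) * z + h \<tau> * (a ^ 5) ^ 3"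
  have F: "l * p + a ^ 2 * q + b ^ 3 = 0" using assms(1) by (simp add: p_def q_def flip: power_mult)
  have "l ^ 5 * p + (a * l ^ 2) ^ 2 * q + b * l ^ 3 * (b ^ 2 * l) = l ^ 4 * (l * p + a ^ 2 * q + b ^ 3)"
    "a * l ^ 2 * p + a ^ 3 * l * q + a * b * (b ^ 2 * l) = a * l * (l * p + a ^ 2 * q + b ^ 3)"
    "a ^ 3 * l * p + a ^ 5 * q + (a * b) ^ 3 = a ^ 3 * (l * p + a ^ 2 * q + b ^ 3)"
    "b * l ^ 3 * p + a * l ^ 2 * (a * b) * q + (b ^ 2 * l) ^ 2 = b * l ^ 2 * (l * p + a ^ 2 * q + b ^ 3)"
    by (simp_all add: algebra_simps eval_nat_numeral)
  moreover have "l ^ 5 * (a ^ 3 * l) - (a * l ^ 2) ^ 3 = 0"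
    "l ^ 5 * a ^ 5 - (a * l ^ 2) ^ 2 * (a ^ 3 * l) = 0"
    "a * l ^ 2 * a ^ 5 - (a ^ 3 * l) ^ 2 = 0" "l ^ 5 * (a * b) - a * l ^ 2 * (b * l ^ 3) = 0"
    "(a * l ^ 2) ^ 2 * (a * b) - a ^ 3 * l * (b * l ^ 3) = 0"
    "a * l ^ 2 * (a ^ 3 * l) * (a * b) - a ^ 5 * (b * l ^ 3) = 0"
    "l ^ 5 * (b ^ 2 * l) - (b * l ^ 3) ^ 2 = 0" "a * l ^ 2 * (b ^ 2 * l) - b * l ^ 3 * (a * b) = 0"
    "a * l ^ 2 * (a * b) ^ 2 - a ^ 3 * l * (b ^ 2 * l) = 0"
    "a ^ 3 * l * (a * b) ^ 2 - a ^ 5 * (b ^ 2 * l) = 0"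
    by (simp_all add: algebra_simps eval_nat_numeral)
  ultimately have "\<forall>f\<in>relations \<theta> \<tau> P. eval_hom h (toric l a b z) f = 0"
    unfolding eval_relations Let_def toric_simps p_def[symmetric] q_def[symmetric] F by simp
  with assms(2) show ?thesis by blast
qed

lemma M_mat_entries:
  fixes \<theta> \<tau> :: complex and P :: pol
  defines "M \<equiv> M_mat \<theta> \<tau> P"
  shows "dim_row M = 6" "dim_col M = 6"
   "M $$ (0,0) = 0" "M $$ (0,1) = 0" "M $$ (0,2) = 0" "M $$ (0,3) = x0" "M $$ (0,4) = x1 ^ 2" "M $$ (0,5) = u0"
   "M $$ (1,0) = 0" "M $$ (1,1) = 0" "M $$ (1,2) = 0" "M $$ (1,3) = x1" "M $$ (1,4) = yy" "M $$ (1,5) = u1"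
   "M $$ (2,0) = 0" "M $$ (2,1) = 0" "M $$ (2,2) = 0" "M $$ (2,3) = u0" "M $$ (2,4) = x1 * u1" "M $$ (2,5) = tt"
   "M $$ (3,0) = - x0" "M $$ (3,1) = - x1" "M $$ (3,2) = - u0" "M $$ (3,3) = 0" "M $$ (3,4) = tt" "M $$ (3,5) = - Qpol \<theta> \<tau>"
   "M $$ (4,0) = - (x1 ^ 2)" "M $$ (4,1) = - yy" "M $$ (4,2) = - (x1 * u1)" "M $$ (4,3) = - tt" "M $$ (4,4) = 0" "M $$ (4,5) = P"
   "M $$ (5,0) = - u0" "M $$ (5,1) = - u1" "M $$ (5,2) = - tt" "M $$ (5,3) = Qpol \<theta> \<tau>" "M $$ (5,4) = - P" "M $$ (5,5) = 0"
  unfolding M_def M_mat_def skew_mat_def Let_def Qpol_def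
  by (simp_all add: add.commute numeral_2_eq_2 numeral_3_eq_3 eval_nat_numeral)

text \<open>
  Of the fifteen Pfaffians three are zero and two are \<open>x\<^sub>1\<close> times another one. The relations that are
  missing here are entries of \<open>M V\<close>, see \<open>M_mat_mult_V\<close>.
\<close>

lemma Pf4_M_mat:
  "Pf4 (M_mat \<theta> \<tau> P) =
    {0, - (x0 * yy - x1 ^ 3), - (x0 * u1 - x1 * u0), - (x1 ^ 2 * u1 - yy * u0),
     - (x1 * (x0 * u1 - x1 * u0)), - (x0 * tt - u0 ^ 2), - (x1 * (x1 * tt - u0 * u1)),
     x0 * P + x1 ^ 2 * Qpol \<theta> \<tau> + u0 * tt, - (x1 * tt - u0 * u1), x1 * u1 ^ 2 - yy * tt,
     x1 * P + yy * Qpol \<theta> \<tau> + u1 * tt, u0 * P + x1 * u1 * Qpol \<theta> \<tau> + tt ^ 2}"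
    (is "_ = ?S")
proof -
  let ?M = "M_mat \<theta> \<tau> P"
  let ?f = "\<lambda>i j k l. ?M $$ (i, j) * ?M $$ (k, l) - ?M $$ (i, k) * ?M $$ (j, l) + ?M $$ (i, l) * ?M $$ (j, k)"
  let ?I = "{(i, j, k, l). i < j \<and> j < k \<and> k < l \<and> l < (6::nat)}"
  have I: "?I = {(0,1,2,3), (0,1,2,4), (0,1,2,5), (0,1,3,4), (0,1,3,5), (0,1,4,5), (0,2,3,4), (0,2,3,5),
     (0,2,4,5), (0,3,4,5), (1,2,3,4), (1,2,3,5), (1,2,4,5), (1,3,4,5), (2,3,4,5)}" (is "_ = ?J")
  proof (rule equalityI; rule subrelI)
    fix i jkl assume ijkl: "(i, jkl) \<in> ?I"
    obtain j k l where kl: "jkl = (j, k, l)" by (metis prod.exhaust)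
    have o: "i < j" "j < k" "k < l" "l < 6" using ijkl kl by auto
    then have "i = 0 \<or> i = 1 \<or> i = 2" "j = 1 \<or> j = 2 \<or> j = 3" "k = 2 \<or> k = 3 \<or> k = 4" "l = 3 \<or> l = 4 \<or> l = 5"
      by linarith+
    with o show "(i, jkl) \<in> ?J"
      unfolding kl by (elim disjE) simp_all
  qed auto
  have image: "{f i j k l | i j k l. C i j k l} = (\<lambda>(i, j, k, l). f i j k l) ` {(i, j, k, l). C i j k l}"
    for f :: "nat \<Rightarrow> nat \<Rightarrow> nat \<Rightarrow> nat \<Rightarrow> pol" and C by force
  have f: "?f 0 1 2 3 = 0" "?f 0 1 2 4 = 0" "?f 0 1 2 5 = 0"
    "?f 0 1 3 4 = - (x0 * yy - x1 ^ 3)" "?f 0 1 3 5 = - (x0 * u1 - x1 * u0)"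
    "?f 0 1 4 5 = - (x1 ^ 2 * u1 - yy * u0)" "?f 0 2 3 4 = - (x1 * (x0 * u1 - x1 * u0))"
    "?f 0 2 3 5 = - (x0 * tt - u0 ^ 2)" "?f 0 2 4 5 = - (x1 * (x1 * tt - u0 * u1))"
    "?f 0 3 4 5 = x0 * P + x1 ^ 2 * Qpol \<theta> \<tau> + u0 * tt"
    "?f 1 2 3 4 = - (x1 ^ 2 * u1 - yy * u0)" "?f 1 2 3 5 = - (x1 * tt - u0 * u1)"
    "?f 1 2 4 5 = x1 * u1 ^ 2 - yy * tt" "?f 1 3 4 5 = x1 * P + yy * Qpol \<theta> \<tau> + u1 * tt"
    "?f 2 3 4 5 = u0 * P + x1 * u1 * Qpol \<theta> \<tau> + tt ^ 2"
    unfolding M_mat_entries by (simp_all add: algebra_simps power2_eq_square power3_eq_cube)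
  have "Pf4 ?M = (\<lambda>(i, j, k, l). ?f i j k l) ` ?I"
    unfolding Pf4_def M_mat_entries(1) by (rule image)
  also have "\<dots> = ?S"
    unfolding I image_insert image_empty case_prod_conv f by blast
  finally show ?thesis .
qed

lemma M_mat_mult_V:
  "set\<^sub>v (M_mat \<theta> \<tau> P *\<^sub>v V_vec) =
    {x0 * ww - x1 ^ 2 * yy, x1 * ww - yy ^ 2, - (x1 * yy * u1 - ww * u0), x1 * u1 ^ 2 - yy * tt,
     yy * u1 ^ 2 - ww * tt, yy * P + ww * Qpol \<theta> \<tau> + u1 ^ 3}" (is "_ = ?S")
proof -
  let ?M = "M_mat \<theta> \<tau> P"
  have dV: "dim_vec V_vec = 6" by (simp add: V_vec_def)
  have V: "V_vec $ 0 = 0" "V_vec $ 1 = - (u1 ^ 2)" "V_vec $ 2 = 0" "V_vec $ 3 = ww" "V_vec $ 4 = - yy" "V_vec $ 5 = 0"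
    unfolding V_vec_def by (simp_all add: vec_of_list_index eval_nat_numeral)
  have six: "{0..<6} = {0, 1, 2, 3, 4, 5::nat}" by auto
  have sum6: "sum f {0, 1, 2, 3, 4, 5} = f 0 + (f 1 + (f 2 + (f 3 + (f 4 + f (5::nat)))))"
    for f :: "nat \<Rightarrow> pol" by simp
  have e: "(?M *\<^sub>v V_vec) $ i = (\<Sum>k\<in>{0, 1, 2, 3, 4, 5}. ?M $$ (i, k) * V_vec $ k)" if "i < 6" for i
    using that by (simp add: mult_mat_vec_def scalar_prod_def dV M_mat_entries(1,2) six row_def)
  have g: "(?M *\<^sub>v V_vec) $ 0 = x0 * ww - x1 ^ 2 * yy" "(?M *\<^sub>v V_vec) $ 1 = x1 * ww - yy ^ 2"
    "(?M *\<^sub>v V_vec) $ 2 = - (x1 * yy * u1 - ww * u0)" "(?M *\<^sub>v V_vec) $ 3 = x1 * u1 ^ 2 - yy * tt"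
    "(?M *\<^sub>v V_vec) $ 4 = yy * u1 ^ 2 - ww * tt" "(?M *\<^sub>v V_vec) $ 5 = yy * P + ww * Qpol \<theta> \<tau> + u1 ^ 3"
    using e[of 0] e[of 1] e[of 2] e[of 3] e[of 4] e[of 5]
    unfolding sum6 M_mat_entries V
    by (simp_all add: algebra_simps power2_eq_square power3_eq_cube)
  have "set\<^sub>v (?M *\<^sub>v V_vec) = (\<lambda>i. (?M *\<^sub>v V_vec) $ i) ` {0, 1, 2, 3, 4, 5}"
    unfolding vec_set_def six[symmetric] dim_mult_mat_vec M_mat_entries(1) atLeast0LessThan ..
  also have "\<dots> = ?S"
    unfolding image_insert image_empty g by blast
  finally show ?thesis .
qed

theorem pfaffian_presentation:
  fixes \<theta> \<tau> :: complex and P :: pol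
  defines "N \<equiv> Pf4 (M_mat \<theta> \<tau> P) \<union> set\<^sub>v (M_mat \<theta> \<tau> P *\<^sub>v V_vec)"
  shows "\<forall>f\<in>relations \<theta> \<tau> P. f \<in> N \<or> - f \<in> N"
    and "pol_ideal N = pol_ideal (relations \<theta> \<tau> P)"
proof -
  show *: "\<forall>f\<in>relations \<theta> \<tau> P. f \<in> N \<or> - f \<in> N"
    unfolding relations_eq N_def Pf4_M_mat M_mat_mult_V by blast
  show "pol_ideal N = pol_ideal (relations \<theta> \<tau> P)"
  proof (rule antisym; rule pol_ideal_mono)
    show "relations \<theta> \<tau> P \<subseteq> pol_ideal N"
    proof
      fix f assume "f \<in> relations \<theta> \<tau> P"
      with * have "f \<in> N \<or> - f \<in> N" by blast
      then show "f \<in> pol_ideal N" using pol_ideal_uminus[of "- f" N] by (auto intro: pol_ideal_base)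
    qed
    show "N \<subseteq> pol_ideal (relations \<theta> \<tau> P)"
      unfolding N_def Pf4_M_mat M_mat_mult_V
      by (intro Un_least insert_subsetI empty_subsetI pol_ideal_0 pol_ideal_uminus pol_ideal_mult
          relations_in_ideal)
  qed
qed

section \<open>The coordinate ring grows quadratically\<close>

lemma monom_eval_Var:
  "monom_eval Var m = single m 1"
  by (simp add: single_eq_Const_monom Const_one)

lemma homogeneous_monom: "homogeneous (monomial_weight m) (monom_eval Var m)"
  by (simp add: monom_eval_Var homogeneous_single)

lemma monom_split:
  assumes "n \<le> lookup m v"
  obtains m' where "m = m' + single v n"
    "monom_eval Var m = monom_eval Var m' * Var v ^ n" "monomial_weight m = monomial_weight m' + n * wt v"
proof
  let ?m' = "m - single v n"
  show m: "m = ?m' + single v n"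
    by (rule poly_mapping_eqI) (use assms in \<open>auto simp: lookup_add lookup_minus lookup_single when_def\<close>)
  show "monom_eval Var m = monom_eval Var ?m' * Var v ^ n"
    by (subst (1) m) (simp only: monom_eval_add monom_eval_single)
  show "monomial_weight m = monomial_weight ?m' + n * wt v"
    by (subst (1) m) (simp only: monomial_weight_add monomial_weight_single)
qed

lemma Const_numeral: "Const (numeral k) = (numeral k :: 'v mpol)"
  by (metis Const_hom.h_of_nat of_nat_numeral)

lemma UNIV_coord: "(UNIV :: coord set) = {cx0, cx1, cy, cw, cu0, cu1, cz, ct}"
  using coord.exhaust by auto

instance coord :: finite
  by standard (simp add: UNIV_coord)

lemma monomial_weight_eq:
  "monomial_weight m = lookup m cx0 + lookup m cx1 + 2 * lookup m cy
     + 3 * lookup m cw + 4 * lookup m cu0 + 4 * lookup m cu1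
     + 5 * lookup m cz + 7 * lookup m ct"
  using monomial_weight_superset[OF finite_UNIV subset_UNIV, of m] by (simp add: UNIV_coord)

lemma sum_monoms:
  "f = (\<Sum>m\<in>keys f. Const (lookup f m) * monom_eval Var m)"
  by (subst (1) single_in_sum) (simp add: single_eq_Const_monom)

text \<open>
  Modulo the relations, \<open>x\<^sub>1\<^sup>3, y\<^sup>2, u\<^sub>0\<^sup>2, u\<^sub>1\<^sup>6\<close> and \<open>t\<^sup>4\<close> lie in the ideal generated by \<open>x\<^sub>0, w, z\<close>; hence the bounds
  for the exponents.
\<close>

definition reduced_monoms :: "nat \<Rightarrow> (coord \<Rightarrow>\<^sub>0 nat) set" where
  "reduced_monoms d = {m. monomial_weight m = d \<and> lookup m cx1 \<le> 2 \<and> lookup m cy \<le> 1 \<and>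
     lookup m cu0 \<le> 1 \<and> lookup m cu1 \<le> 5 \<and> lookup m ct \<le> 3}"

text \<open>
  The exponents of \<open>w\<close> and \<open>z\<close> are at most \<open>d\<close>, the weight determines the exponent of \<open>x\<^sub>0\<close>, and the bounds leave
  \<open>288 = 3 * 2 * 2 * 6 * 4\<close> choices for the others.
\<close>

lemma reduced_monoms_card:
  "finite (reduced_monoms d)" "card (reduced_monoms d) \<le> 288 * (d + 1) ^ 2"
proof -
  let ?g = "\<lambda>m. (lookup m cw, lookup m cz, lookup m cx1,
     lookup m cy, lookup m cu0, lookup m cu1, lookup m ct)"
  let ?S = "{..d} \<times> {..d} \<times> {..2::nat} \<times> {..1::nat} \<times> {..1::nat} \<times> {..5::nat} \<times> {..3::nat}"
  have inj: "inj_on ?g (reduced_monoms d)"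
  proof (rule inj_onI)
    fix m n assume *: "m \<in> reduced_monoms d" "n \<in> reduced_monoms d" "?g m = ?g n"
    then have "lookup m cx0 = lookup n cx0"
      by (auto simp: reduced_monoms_def monomial_weight_eq)
    with * have "lookup m v = lookup n v" for v by (cases v) auto
    then show "m = n" by (rule poly_mapping_eqI)
  qed
  have sub: "?g ` reduced_monoms d \<subseteq> ?S"
    by (auto simp: reduced_monoms_def monomial_weight_eq)
  show "finite (reduced_monoms d)" by (rule inj_on_finite[OF inj sub]) simp
  have "card (reduced_monoms d) \<le> card ?S" using inj sub by (rule card_inj_on_le) simp
  also have "\<dots> = 288 * (d + 1) ^ 2" by (simp add: card_cartesian_product power2_eq_square algebra_simps)
  finally show "card (reduced_monoms d) \<le> 288 * (d + 1) ^ 2" .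
qed

context
  fixes \<theta> \<tau> :: complex and P :: pol
  assumes P: "homogeneous 10 P"
begin

definition red_span :: "nat \<Rightarrow> pol set" where
  "red_span d = {f. \<exists>c. f - (\<Sum>m\<in>reduced_monoms d. Const (c m) * monom_eval Var m) \<in> pol_ideal (relations \<theta> \<tau> P)}"

lemma red_span_I: "f \<in> pol_ideal (relations \<theta> \<tau> P) \<Longrightarrow> f \<in> red_span d"
  unfolding red_span_def by (intro CollectI exI[of _ "\<lambda>_. 0"]) (simp add: Const_zero)

lemma red_span_add: "f \<in> red_span d \<Longrightarrow> g \<in> red_span d \<Longrightarrow> f + g \<in> red_span d"
proof -
  assume "f \<in> red_span d" "g \<in> red_span d"
  then obtain c c' where "f - (\<Sum>m\<in>reduced_monoms d. Const (c m) * monom_eval Var m) \<in> pol_ideal (relations \<theta> \<tau> P)"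
    "g - (\<Sum>m\<in>reduced_monoms d. Const (c' m) * monom_eval Var m) \<in> pol_ideal (relations \<theta> \<tau> P)" by (auto simp: red_span_def)
  from pol_ideal_add[OF this] show ?thesis
    unfolding red_span_def
    by (intro CollectI exI[of _ "\<lambda>m. c m + c' m"])
      (simp add: Const_add ring_distribs sum.distrib algebra_simps)
qed

lemma red_span_Const: "f \<in> red_span d \<Longrightarrow> Const k * f \<in> red_span d"
proof -
  assume "f \<in> red_span d"
  then obtain c where "f - (\<Sum>m\<in>reduced_monoms d. Const (c m) * monom_eval Var m) \<in> pol_ideal (relations \<theta> \<tau> P)" by (auto simp: red_span_def)
  from pol_ideal_mult[OF this, of "Const k"] show ?thesis
    unfolding red_span_def
    by (intro CollectI exI[of _ "\<lambda>m. k * c m"])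
      (simp add: Const_mult sum_distrib_left algebra_simps)
qed

lemma red_span_sum: "(\<And>x. x \<in> S \<Longrightarrow> f x \<in> red_span d) \<Longrightarrow> sum f S \<in> red_span d"
  by (induction S rule: infinite_finite_induct) (auto simp: red_span_add red_span_I pol_ideal_0)

lemma red_span_cong: "g \<in> red_span d \<Longrightarrow> f - g \<in> pol_ideal (relations \<theta> \<tau> P) \<Longrightarrow> f \<in> red_span d"
  using red_span_add[of g d "f - g"] red_span_I[of "f - g" d] by simp

lemma red_span_monom: "m \<in> reduced_monoms d \<Longrightarrow> monom_eval Var m \<in> red_span d"
proof -
  assume m: "m \<in> reduced_monoms d"
  have "(\<Sum>n\<in>reduced_monoms d. Const (if n = m then 1 else 0) * monom_eval Var n) =
     (\<Sum>n\<in>reduced_monoms d. if n = m then monom_eval Var n else 0)"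
    by (intro sum.cong) (auto simp: Const_one Const_zero)
  also have "\<dots> = monom_eval Var m" using m reduced_monoms_card(1)[of d] by simp
  finally show ?thesis unfolding red_span_def
    by (intro CollectI exI[of _ "\<lambda>n. if n = m then 1 else 0"]) (simp add: pol_ideal_0)
qed

lemma red_span_Var:
  assumes "v \<in> {cx0, cw, cz}" "f \<in> red_span d"
  shows "f * Var v \<in> red_span (d + wt v)"
proof -
  obtain c where c: "f - (\<Sum>m\<in>reduced_monoms d. Const (c m) * monom_eval Var m) \<in> pol_ideal (relations \<theta> \<tau> P)"
    using assms(2) by (auto simp: red_span_def)
  have "monom_eval Var m * Var v \<in> red_span (d + wt v)" if "m \<in> reduced_monoms d" for m
  proof -
    have "m + single v 1 \<in> reduced_monoms (d + wt v)"
      using that assms(1)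
      by (auto simp: reduced_monoms_def monomial_weight_add monomial_weight_single lookup_add lookup_single)
    from red_span_monom[OF this] show ?thesis by (simp add: monom_eval_add monom_eval_single)
  qed
  then have "(\<Sum>m\<in>reduced_monoms d. Const (c m) * (monom_eval Var m * Var v)) \<in> red_span (d + wt v)"
    by (intro red_span_sum red_span_Const)
  then show ?thesis
    by (rule red_span_cong) (use pol_ideal_mult_r[OF c, of "Var v"] in \<open>simp add: algebra_simps sum_distrib_left\<close>)
qed

text \<open>
  A graded Nakayama argument: a monomial that is not reduced is congruent to a combination of \<open>x\<^sub>0, w, z\<close>
  with coefficients of smaller degree, which are in the span by induction; and multiplication by
  \<open>x\<^sub>0, w, z\<close> preserves reduced monomials.
\<close>

lemma homogeneous_in_red_span: "homogeneous d f \<Longrightarrow> f \<in> red_span d"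
proof (induction d arbitrary: f rule: less_induct)
  case (less d)
  have IH: "g * Var v \<in> red_span d" if "v \<in> {cx0, cw, cz}" "homogeneous e g" "e + wt v = d" for v e g
    using red_span_Var[OF that(1) less.IH[of e g]] that by (cases v) auto
  have "monom_eval Var m \<in> red_span d" if m: "monomial_weight m = d" for m
  proof -
    consider "lookup m cx0 > 0" | "lookup m cw > 0" | "lookup m cz > 0"
      | "lookup m cx1 \<ge> 3" | "lookup m cy \<ge> 2" | "lookup m cu0 \<ge> 2"
      | "lookup m cu1 \<ge> 6" | "lookup m ct \<ge> 4" | "m \<in> reduced_monoms d"
      using m unfolding reduced_monoms_def by fastforce
    then show ?thesis
    proof cases
      case 1
      then obtain m' where m': "monom_eval Var m = monom_eval Var m' * x0 ^ 1" "monomial_weight m = monomial_weight m' + 1 * wt cx0"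
        by (metis monom_split Suc_leI One_nat_def)
      show ?thesis using IH[of cx0 "monomial_weight m'"] m m' homogeneous_monom by simp
    next
      case 2
      then obtain m' where m': "monom_eval Var m = monom_eval Var m' * ww ^ 1" "monomial_weight m = monomial_weight m' + 1 * wt cw"
        by (metis monom_split Suc_leI One_nat_def)
      show ?thesis using IH[of cw "monomial_weight m'"] m m' homogeneous_monom by simp
    next
      case 3
      then obtain m' where m': "monom_eval Var m = monom_eval Var m' * zz ^ 1" "monomial_weight m = monomial_weight m' + 1 * wt cz"
        by (metis monom_split Suc_leI One_nat_def)
      show ?thesis using IH[of cz "monomial_weight m'"] m m' homogeneous_monom by simp
    next
      case 4
      then obtain m' where m': "monom_eval Var m = monom_eval Var m' * x1 ^ 3" "monomial_weight m = monomial_weight m' + 3 * wt cx1"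
        by (metis monom_split)
      have "(monom_eval Var m' * yy) * x0 \<in> red_span d"
        using m m' by (intro IH[where e = "monomial_weight m' + 2"] homogeneous_mult homogeneous_monom homogeneous_vars) auto
      then show ?thesis
        by (rule red_span_cong)
          (use pol_ideal_mult[OF rel1, of "- monom_eval Var m'"] in \<open>simp add: m' algebra_simps\<close>)
    next
      case 5
      then obtain m' where m': "monom_eval Var m = monom_eval Var m' * yy ^ 2" "monomial_weight m = monomial_weight m' + 2 * wt cy"
        by (metis monom_split)
      have "(monom_eval Var m' * x1) * ww \<in> red_span d"
        using m m' by (intro IH[where e = "monomial_weight m' + 1"] homogeneous_mult homogeneous_monom homogeneous_vars) auto
      then show ?thesis
        by (rule red_span_cong)
          (use pol_ideal_mult[OF rel3, of "- monom_eval Var m'"] in \<open>simp add: m' algebra_simps\<close>)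
    next
      case 6
      then obtain m' where m': "monom_eval Var m = monom_eval Var m' * u0 ^ 2" "monomial_weight m = monomial_weight m' + 2 * wt cu0"
        by (metis monom_split)
      have "(monom_eval Var m' * tt) * x0 \<in> red_span d"
        using m m' by (intro IH[where e = "monomial_weight m' + 7"] homogeneous_mult homogeneous_monom homogeneous_vars) auto
      then show ?thesis
        by (rule red_span_cong)
          (use pol_ideal_mult[OF rel7, of "- monom_eval Var m'"] in \<open>simp add: m' algebra_simps\<close>)
    next
      case 7
      then obtain m' where m': "monom_eval Var m = monom_eval Var m' * u1 ^ 6" "monomial_weight m = monomial_weight m' + 6 * wt cu1"
        by (metis monom_split)
      \<comment> \<open>the square of \<open>u\<^sub>1\<^sup>3 = - (y P + w Q)\<close> is divisible by \<open>w\<close>, as \<open>y\<^sup>2 = x\<^sub>1 w\<close>\<close>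
      let ?A = "x1 * P ^ 2 + Const 2 * yy * P * Qpol \<theta> \<tau> + ww * Qpol \<theta> \<tau> ^ 2"
      have "homogeneous (0 + 2 + 10 + 9) (Const 2 * yy * P * Qpol \<theta> \<tau>)"
        by (intro homogeneous_mult homogeneous_vars P homogeneous_Qpol homogeneous_Const)
      moreover have "homogeneous (1 + 2 * 10) (x1 * P ^ 2)" "homogeneous (3 + 2 * 9) (ww * Qpol \<theta> \<tau> ^ 2)"
        by (intro homogeneous_mult homogeneous_vars P homogeneous_Qpol homogeneous_power)+
      ultimately have "homogeneous 21 ?A" by (auto intro!: homogeneous_add)
      then have "(monom_eval Var m' * ?A) * ww \<in> red_span d"
        using m m' by (intro IH[where e = "monomial_weight m' + 21"] homogeneous_mult homogeneous_monom) auto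
      moreover have "u1 ^ 6 - ?A * ww = (u1 ^ 3 - (yy * P + ww * Qpol \<theta> \<tau>)) * (yy * P + ww * Qpol \<theta> \<tau> + u1 ^ 3)
           - P ^ 2 * (x1 * ww - yy ^ 2)"
        by (simp add: Const_numeral algebra_simps eval_nat_numeral)
      moreover have "\<dots> \<in> pol_ideal (relations \<theta> \<tau> P)" by (intro pol_ideal_diff pol_ideal_mult rel3 rel13)
      ultimately have "u1 ^ 6 - ?A * ww \<in> pol_ideal (relations \<theta> \<tau> P)" "(monom_eval Var m' * ?A) * ww \<in> red_span d" by simp_all
      note * = this
      from *(2) show ?thesis
        by (rule red_span_cong)
          (use pol_ideal_mult[OF *(1), of "monom_eval Var m'"] in \<open>simp add: m' algebra_simps\<close>)
    next
      case 8
      then obtain m' where m': "monom_eval Var m = monom_eval Var m' * tt ^ 4" "monomial_weight m = monomial_weight m' + 4 * wt ct"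
        by (metis monom_split)
      \<comment> \<open>in the square of \<open>t\<^sup>2 = - (u\<^sub>0 P + x\<^sub>1 u\<^sub>1 Q)\<close>, use \<open>u\<^sub>0\<^sup>2 = x\<^sub>0 t\<close> and \<open>x\<^sub>1 u\<^sub>0 = x\<^sub>0 u\<^sub>1\<close>; the last term contains \<open>Q\<close>\<close>
      let ?A = "tt * P ^ 2 + Const 2 * u1 ^ 2 * P * Qpol \<theta> \<tau>" and ?B = "x1 ^ 2 * u1 ^ 2 * Qpol \<theta> \<tau>"
      have "homogeneous (0 + 2 * 4 + 10 + 9) (Const 2 * u1 ^ 2 * P * Qpol \<theta> \<tau>)" "homogeneous (7 + 2 * 10) (tt * P ^ 2)"
        by (intro homogeneous_mult homogeneous_vars P homogeneous_Qpol homogeneous_Const homogeneous_power)+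
      then have A: "homogeneous 27 ?A" by (auto intro!: homogeneous_add)
      have B: "homogeneous (2 * 1 + 2 * 4 + 9) ?B"
        by (intro homogeneous_mult homogeneous_vars homogeneous_Qpol homogeneous_power)
      have "homogeneous (2 * 1 + 2 * 4 + 9 + 0 + 4) (?B * Const \<theta> * u1)"
        "homogeneous (2 * 1 + 2 * 4 + 9 + 0 + 2 * 3) (?B * Const \<tau> * ww ^ 2)"
        by (intro homogeneous_mult B homogeneous_Const homogeneous_vars homogeneous_power)+
      then have BC: "homogeneous 23 (?B * Const \<theta> * u1)" "homogeneous 25 (?B * Const \<tau> * ww ^ 2)" by simp_all
      have "(monom_eval Var m' * ?A) * x0 \<in> red_span d"
        using m m' by (intro IH[OF _ homogeneous_mult[OF homogeneous_monom A]]) auto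
      moreover have "(monom_eval Var m' * (?B * Const \<theta> * u1)) * zz \<in> red_span d"
        using m m' by (intro IH[OF _ homogeneous_mult[OF homogeneous_monom BC(1)]]) auto
      moreover have "(monom_eval Var m' * (?B * Const \<tau> * ww ^ 2)) * ww \<in> red_span d"
        using m m' by (intro IH[OF _ homogeneous_mult[OF homogeneous_monom BC(2)]]) auto
      ultimately have "(monom_eval Var m' * ?A) * x0 + ((monom_eval Var m' * (?B * Const \<theta> * u1)) * zz
         + (monom_eval Var m' * (?B * Const \<tau> * ww ^ 2)) * ww) \<in> red_span d"
        by (intro red_span_add)
      moreover have "tt ^ 4 - (?A * x0 + ?B * Qpol \<theta> \<tau>) =
          (tt ^ 2 - (u0 * P + x1 * u1 * Qpol \<theta> \<tau>)) * (u0 * P + x1 * u1 * Qpol \<theta> \<tau> + tt ^ 2)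
           - P ^ 2 * (x0 * tt - u0 ^ 2) - Const 2 * u1 * P * Qpol \<theta> \<tau> * (x0 * u1 - x1 * u0)"
        by (simp add: Const_numeral algebra_simps eval_nat_numeral)
      moreover have "\<dots> \<in> pol_ideal (relations \<theta> \<tau> P)" by (intro pol_ideal_diff pol_ideal_mult rel4 rel7 rel14)
      moreover have "?B * Qpol \<theta> \<tau> = (?B * Const \<theta> * u1) * zz + (?B * Const \<tau> * ww ^ 2) * ww"
        by (simp add: Qpol_def algebra_simps eval_nat_numeral)
      ultimately have
        "(monom_eval Var m' * ?A) * x0 + ((monom_eval Var m' * (?B * Const \<theta> * u1)) * zz
         + (monom_eval Var m' * (?B * Const \<tau> * ww ^ 2)) * ww) \<in> red_span d"
        "tt ^ 4 - (?A * x0 + ((?B * Const \<theta> * u1) * zz + (?B * Const \<tau> * ww ^ 2) * ww)) \<in> pol_ideal (relations \<theta> \<tau> P)" by simp_all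
      note * = this
      from *(1) show ?thesis
        by (rule red_span_cong)
          (use pol_ideal_mult[OF *(2), of "monom_eval Var m'"] in \<open>simp add: m' algebra_simps\<close>)
    next
      case 9 then show ?thesis by (rule red_span_monom)
    qed
  qed
  then show ?case
    using less.prems by (subst sum_monoms[of f])
      (auto intro!: red_span_sum red_span_Const simp: homogeneous_def)
qed

lemma dependent_mod_ideal:
  assumes "finite J" "\<And>j. j \<in> J \<Longrightarrow> homogeneous d (v j)" "288 * (d + 1) ^ 2 < card J"
  shows "\<exists>x. (\<exists>j\<in>J. x j \<noteq> 0) \<and> (\<Sum>j\<in>J. Const (x j) * v j) \<in> pol_ideal (relations \<theta> \<tau> P)"
proof -
  let ?T = "reduced_monoms d"
  have "\<forall>j. \<exists>c. j \<in> J \<longrightarrow> v j - (\<Sum>m\<in>?T. Const (c m) * monom_eval Var m) \<in> pol_ideal (relations \<theta> \<tau> P)"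
    using homogeneous_in_red_span[OF assms(2)] by (auto simp: red_span_def)
  then obtain c where c: "\<And>j. j \<in> J \<Longrightarrow> v j - (\<Sum>m\<in>?T. Const (c j m) * monom_eval Var m) \<in> pol_ideal (relations \<theta> \<tau> P)" by metis
  obtain x where x: "\<exists>j\<in>J. x j \<noteq> 0" "\<And>m. m \<in> ?T \<Longrightarrow> (\<Sum>j\<in>J. x j * c j m) = 0"
    using homogeneous_linear_system[of ?T J c] assms reduced_monoms_card[of d] by auto
  have "(\<Sum>j\<in>J. Const (x j) * (\<Sum>m\<in>?T. Const (c j m) * monom_eval Var m)) =
     (\<Sum>m\<in>?T. \<Sum>j\<in>J. Const (x j * c j m) * monom_eval Var m)"
    by (subst sum.swap) (simp add: sum_distrib_left Const_mult mult.assoc)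
  also have "\<dots> = (\<Sum>m\<in>?T. Const (\<Sum>j\<in>J. x j * c j m) * monom_eval Var m)"
    by (simp add: Const_hom.h_sum sum_distrib_right)
  also have "\<dots> = 0" using x(2) by (intro sum.neutral) (simp add: Const_zero)
  finally have "(\<Sum>j\<in>J. Const (x j) * v j) =
      (\<Sum>j\<in>J. Const (x j) * (v j - (\<Sum>m\<in>?T. Const (c j m) * monom_eval Var m)))"
    by (simp add: right_diff_distrib sum_subtractf)
  also have "\<dots> \<in> pol_ideal (relations \<theta> \<tau> P)" using c by (intro pol_ideal_sum pol_ideal_mult)
  finally show ?thesis using x(1) by blast
qed

end

definition emb :: "pol \<Rightarrow> pol fract" where "emb f = Fract f 1"

lemma emb_0 [simp]: "emb 0 = 0" and emb_1 [simp]: "emb 1 = 1"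
  by (simp_all add: emb_def Zero_fract_def One_fract_def)

lemma emb_add: "emb (f + g) = emb f + emb g" and emb_mult: "emb (f * g) = emb f * emb g"
  and emb_diff: "emb (f - g) = emb f - emb g"
  by (simp_all add: emb_def)

lemma emb_power: "emb (f ^ n) = emb f ^ n"
  by (induction n) (simp_all add: emb_mult)

lemma emb_sum: "emb (sum s S) = (\<Sum>x\<in>S. emb (s x))"
  by (induction S rule: infinite_finite_induct) (simp_all add: emb_add)

lemmas emb_hom = emb_add emb_mult emb_diff emb_power emb_sum

lemma emb_eq_0_iff [simp]: "emb f = 0 \<longleftrightarrow> f = 0"
  by (simp add: emb_def Zero_fract_def eq_fract)

lemma Fract_emb: "g \<noteq> 0 \<Longrightarrow> Fract f g = emb f / emb g"
  by (simp add: emb_def divide_fract)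

interpretation emb_Const: coeff_hom "\<lambda>c. emb (Const c)"
  by standard (simp_all add: Const_add Const_mult Const_one emb_add emb_mult)

lemma emb_Const_in_locA: "emb (Const c) \<in> locA a"
  unfolding emb_def by (rule locA_I[of 0]) auto

locale surface_point = scheme_point "relations \<theta> \<tau> P" a for \<theta> \<tau> P a +
  assumes P: "homogeneous 10 P"
begin

text \<open>
  Three elements of the local ring have a common denominator \<open>G\<close> of some degree \<open>e\<close>. Their monomials with
  exponents at most \<open>N\<close> are \<open>(N + 1)\<^sup>3\<close> fractions with numerators of degree \<open>3 N e\<close>, and for large \<open>N\<close> this
  number exceeds the quadratic bound for the number of reduced monomials of that degree.
\<close>

lemma krull_dim_R: "krull_dim R \<le> 2"
proof (rule krull_dim_le_2)
  show "emb (Const c) \<in> locA a" for c by (rule emb_Const_in_locA)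
  show "emb (Const 0) = 0" by (simp add: Const_zero)
  show "\<exists>u\<in>locA a. u * emb (Const c) = 1" if "c \<noteq> 0" for c
    using that emb_Const.h_unit[of c]
    by (intro bexI[of _ "emb (Const (inverse c))"] emb_Const_in_locA) (simp add: mult.commute)
  fix x y z assume "x \<in> locA a" "y \<in> locA a" "z \<in> locA a"
  then obtain f1 g1 d1 f2 g2 d2 f3 g3 d3 where
      1: "x = Fract f1 g1" "homogeneous d1 f1" "homogeneous d1 g1" "eval_pol g1 a \<noteq> 0" "g1 \<noteq> 0"
    and 2: "y = Fract f2 g2" "homogeneous d2 f2" "homogeneous d2 g2" "eval_pol g2 a \<noteq> 0" "g2 \<noteq> 0"
    and 3: "z = Fract f3 g3" "homogeneous d3 f3" "homogeneous d3 g3" "eval_pol g3 a \<noteq> 0" "g3 \<noteq> 0"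
    by (meson locA_E)
  define e where "e = d1 + d2 + d3"
  define F1 where "F1 = f1 * g2 * g3"
  define F2 where "F2 = g1 * f2 * g3"
  define F3 where "F3 = g1 * g2 * f3"
  define G where "G = g1 * g2 * g3"
  have hom: "homogeneous e F1" "homogeneous e F2" "homogeneous e F3" "homogeneous e G"
    unfolding F1_def F2_def F3_def G_def e_def using 1 2 3 by (auto intro!: homogeneous_mult)
  have G0: "eval_pol G a \<noteq> 0" "G \<noteq> 0" using 1 2 3 by (auto simp: G_def eval_pol_simps)
  have xyz: "x = emb F1 / emb G" "y = emb F2 / emb G" "z = emb F3 / emb G"
    unfolding 1(1) 2(1) 3(1) Fract_emb[OF 1(5)] Fract_emb[OF 2(5)] Fract_emb[OF 3(5)]
      F1_def F2_def F3_def G_def emb_hom using 1 2 3 by simp_all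
  \<comment> \<open>then \<open>288 (3 N e + 1)\<^sup>2 \<le> 288 (3 e + 1)\<^sup>2 (N + 1)\<^sup>2 = N (N + 1)\<^sup>2\<close>\<close>
  define N where "N = 288 * (3 * e + 1) ^ 2"
  define v where "v = (\<lambda>(i, j, k). F1 ^ i * F2 ^ j * F3 ^ k * G ^ (3 * N - i - j - k))"
  define J where "J = {..N} \<times> {..N} \<times> {..N}"
  have vhom: "homogeneous (3 * N * e) (v j)" if "j \<in> J" for j
  proof -
    obtain i k l where j: "j = (i, k, l)" by (metis prod.exhaust)
    have "homogeneous (i * e + k * e + l * e + (3 * N - i - k - l) * e) (v j)"
      unfolding v_def j case_prod_conv by (intro homogeneous_mult homogeneous_power hom)
    moreover have "i * e + k * e + l * e + (3 * N - i - k - l) * e = (i + k + l + (3 * N - i - k - l)) * e"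
      by (simp add: algebra_simps)
    moreover have "i + k + l + (3 * N - i - k - l) = 3 * N" using that by (auto simp: J_def j)
    ultimately show ?thesis by simp
  qed
  have "3 * N * e + 1 \<le> (3 * e + 1) * (N + 1)" by (simp add: algebra_simps)
  then have "288 * (3 * N * e + 1) ^ 2 \<le> 288 * ((3 * e + 1) * (N + 1)) ^ 2" by (intro mult_left_mono power_mono) auto
  also have "\<dots> = N * (N + 1) ^ 2" by (simp only: N_def power_mult_distrib mult.assoc)
  also have "\<dots> < (N + 1) * (N + 1) ^ 2" by simp
  also have "\<dots> = card J" by (simp add: J_def card_cartesian_product power2_eq_square)
  finally have "288 * (3 * N * e + 1) ^ 2 < card J" .
  note card = this
  have "finite J" by (simp add: J_def)
  have "\<exists>c. (\<exists>j\<in>J. c j \<noteq> 0) \<and> (\<Sum>j\<in>J. Const (c j) * v j) \<in> pol_ideal (relations \<theta> \<tau> P)"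
    by (rule dependent_mod_ideal[OF P \<open>finite J\<close> _ card]) (rule vhom)
  then obtain c where c: "\<exists>j\<in>J. c j \<noteq> 0" "(\<Sum>j\<in>J. Const (c j) * v j) \<in> pol_ideal (relations \<theta> \<tau> P)"
    by (elim exE conjE)
  have "Fract (\<Sum>j\<in>J. Const (c j) * v j) (G ^ (3 * N)) \<in> locI (relations \<theta> \<tau> P) a"
  proof (rule locI_I)
    show "homogeneous (3 * N * e) (\<Sum>j\<in>J. Const (c j) * v j)"
      using vhom homogeneous_mult[OF homogeneous_Const] by (intro homogeneous_sum) fastforce
    show "homogeneous (3 * N * e) (G ^ (3 * N))" by (rule homogeneous_power) (rule hom)
    show "eval_pol (G ^ (3 * N)) a \<noteq> 0" using G0 by (simp add: eval_pol_simps)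
  qed (rule c)
  moreover have "Fract (\<Sum>j\<in>J. Const (c j) * v j) (G ^ (3 * N)) =
    (\<Sum>j\<in>J. emb (Const (c j)) * (emb (v j) / emb G ^ (3 * N)))"
    using G0 by (subst Fract_emb) (simp_all add: emb_hom sum_divide_distrib)
  moreover have "\<dots> = (\<Sum>(i, j, k)\<in>J. emb (Const (c (i, j, k))) * x ^ i * y ^ j * z ^ k)"
  proof (rule sum.cong[OF refl], clarify)
    fix i j k assume "(i, j, k) \<in> J"
    then have "3 * N = i + j + k + (3 * N - i - j - k)" by (auto simp: J_def)
    then have pow: "emb G ^ (3 * N) = emb G ^ i * emb G ^ j * emb G ^ k * emb G ^ (3 * N - i - j - k)"
      by (metis power_add)
    show "emb (Const (c (i, j, k))) * (emb (v (i, j, k)) / emb G ^ (3 * N)) =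
        emb (Const (c (i, j, k))) * x ^ i * y ^ j * z ^ k"
      unfolding pow xyz v_def case_prod_conv emb_hom power_divide using G0 by simp
  qed
  moreover have "\<dots> = (\<Sum>i\<le>N. \<Sum>j\<le>N. \<Sum>k\<le>N. emb (Const (c (i, j, k))) * x ^ i * y ^ j * z ^ k)"
    unfolding J_def by (simp add: sum.cartesian_product)
  ultimately have "(\<Sum>i\<le>N. \<Sum>j\<le>N. \<Sum>k\<le>N. emb (Const (c (i, j, k))) * x ^ i * y ^ j * z ^ k)
      \<in> locI (relations \<theta> \<tau> P) a" by metis
  moreover have "\<exists>i\<le>N. \<exists>j\<le>N. \<exists>k\<le>N. c (i, j, k) \<noteq> 0" using c(1) by (auto simp: J_def)
  ultimately show "\<exists>N c. (\<exists>i\<le>N. \<exists>j\<le>N. \<exists>l\<le>N. c i j l \<noteq> 0) \<and>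
       (\<Sum>i\<le>N. \<Sum>j\<le>N. \<Sum>l\<le>N. emb (Const (c i j l)) * x ^ i * y ^ j * z ^ l) \<in> locI (relations \<theta> \<tau> P) a"
    by (intro exI[of _ N] exI[of _ "\<lambda>i j l. c (i, j, l)"]) blast
qed

end

section \<open>Points with power series coordinates\<close>

lemma cf_0_0_eval: "cf 0 0 (eval_hom fc X f) = eval_pol f (\<lambda>v. cf 0 0 (X v))"
  unfolding eval_pol_eq
  by (rule eval_hom_compose[OF fc_hom.coeff_hom_axioms id_hom.coeff_hom_axioms])
    (simp_all add: cf_fc)

lemma formal_pointI:
  assumes "\<And>v. cf 0 0 (X v) = a v"
  shows "formal_point fc X a"
proof
  fix d g assume "homogeneous d g" "eval_pol g a \<noteq> 0"
  then have "cf 0 0 (eval_hom fc X g) \<noteq> 0" using assms by (simp add: cf_0_0_eval)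
  then show "eval_hom fc X g dvd 1" by (rule fps2_unit)
qed

locale formal_surface_point = surface_point \<theta> \<tau> P a + formal_point fc X a for \<theta> \<tau> P a X +
  assumes const_term: "cf 0 0 (X v) = a v"
    and on_surface: "f \<in> relations \<theta> \<tau> P \<Longrightarrow> eval_hom fc X f = 0"
begin

lemma cf_Phi:
  assumes "x \<in> locA a"
  shows "cf 0 0 (Phi x) = value_at a x"
  using assms
proof (rule locA_E)
  fix f g d assume *: "x = Fract f g" "homogeneous d f" "homogeneous d g" "eval_pol g a \<noteq> 0"
  have "cf 0 0 (Phi x * eval_hom fc X g) = cf 0 0 (eval_hom fc X f)"
    unfolding *(1) by (simp only: Phi_Fract[OF *(2-4)])
  then have "cf 0 0 (Phi x) * eval_pol g a = eval_pol f a"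
    by (simp add: cf_0_0_eval const_term)
  moreover have "value_at a x * eval_pol g a = eval_pol f a"
    unfolding *(1) using value_at_Fract[OF *(2-4)] *(4) by simp
  ultimately show ?thesis using *(4) by (metis mult_right_cancel)
qed

lemma Phi_locI: "x \<in> locI (relations \<theta> \<tau> P) a \<Longrightarrow> Phi x = 0"
  by (rule Phi_ideal[OF on_surface])

definition phi :: "pol fract set \<Rightarrow> complex fps fps" where "phi = lift Phi"

lemma phi_proj: "x \<in> locA a \<Longrightarrow> phi (proj x) = Phi x"
  unfolding phi_def by (rule lift_proj) (simp_all add: Phi_add Phi_locI)

lemma phi_hom: "phi \<in> Ring.ring_hom R (ring_on UNIV)"
  unfolding phi_def by (rule lift_hom) (simp_all add: Phi_add Phi_mult Phi_one Phi_locI)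

lemma Phi_uminus: "x \<in> locA a \<Longrightarrow> Phi (- x) = - Phi x"
  using Phi_add[of x "- x"] A_uminus[of x] Phi_locI[OF I_0] by (simp add: eq_neg_iff_add_eq_0 add.commute)

lemma Phi_diff: "x \<in> locA a \<Longrightarrow> y \<in> locA a \<Longrightarrow> Phi (x - y) = Phi x - Phi y"
  using Phi_add[of x "- y"] A_uminus[of y] Phi_uminus[of y] by simp

lemma Phi_sum: "(\<And>s. s \<in> S \<Longrightarrow> f s \<in> locA a) \<Longrightarrow> Phi (sum f S) = (\<Sum>s\<in>S. Phi (f s))"
  by (induction S rule: infinite_finite_induct) (simp_all add: Phi_locI[OF I_0] Phi_add A_sum)

lemma ord_phi_ideal_pow: "x \<in> ideal_pow R (proj ` locM a) n \<Longrightarrow> ord_ge n (phi x)"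
proof (induction n arbitrary: x)
  case (Suc n)
  have carr: "ideal_pow R (proj ` locM a) n \<subseteq> carrier R" for n
    using ideal.Icarr[OF ideal_ideal_pow] by blast
  interpret cring R by (rule cring_R)
  have sub: "ideal_prod R (ideal_pow R (proj ` locM a) n) (proj ` locM a) \<subseteq> carrier R"
    by (rule ideal_prod_in_carrier[OF ideal_ideal_pow ideal_M])
  from Suc.prems have "x \<in> ideal_prod R (ideal_pow R (proj ` locM a) n) (proj ` locM a)"
    unfolding ideal_pow_Suc .
  then show ?case
  proof induction
    case (prod i j)
    then obtain m where m: "m \<in> locM a" "j = proj m" by blast
    have jc: "j \<in> carrier R" and ic: "i \<in> carrier R" using m M_sub proj_in carr[of n] prod by blast+
    have "cf 0 0 (phi j) = 0" using m M_sub by (auto simp: phi_proj cf_Phi locM_def)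
    then have "ord_ge 1 (phi j)" by (simp add: ord_ge_def)
    with Suc.IH[OF prod(1)] have "ord_ge (n + 1) (phi i * phi j)" by (rule ord_ge_mult)
    then show ?case using ring_hom_mult[OF phi_hom ic jc] by simp
  next
    case (sum s t)
    have "phi (s \<oplus>\<^bsub>R\<^esub> t) = phi s + phi t"
      using ring_hom_add[OF phi_hom, of s t] sum.hyps sub by (auto simp: subset_iff)
    then show ?case using sum.IH by (simp add: ord_ge_add)
  qed
qed simp

lemma ord_Phi_MP: "x \<in> MP n \<Longrightarrow> ord_ge n (Phi x)"
  using ord_phi_ideal_pow[of "proj x" n] phi_proj[of x] by (auto simp: MP_def)

end

section \<open>The point where only the coordinate of weight five is nonzero\<close>

definition pz :: "coord \<Rightarrow> complex" where "pz v = (if v = cz then 1 else 0)"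

lemma toric_pz: "toric 0 0 0 1 = pz"
proof
  show "toric 0 0 0 1 v = pz v" for v by (cases v) (simp_all add: pz_def)
qed

lemma monom_eval_pz:
  "monom_eval pz m = (if m = single cz (lookup m cz) then 1 else 0)"
proof (cases "keys m \<subseteq> {cz}")
  case True
  then have "m = single cz (lookup m cz)"
    by (intro poly_mapping_eqI) (auto simp: lookup_single when_def in_keys_iff)
  with True show ?thesis by (simp add: monom_eval_superset[of "{cz}"] pz_def)
next
  case False
  then obtain v where v: "v \<in> keys m" "v \<noteq> cz" by auto
  then have "monom_eval pz m = 0"
    unfolding monom_eval_def by (intro prod_zero) (auto simp: pz_def in_keys_iff zero_power intro!: bexI[of _ v])
  moreover have "m \<noteq> single cz (lookup m cz)"
  proof
    assume "m = single cz (lookup m cz)"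
    then have "keys m \<subseteq> {cz}" by (metis keys_single subset_refl empty_subsetI)
    with False show False by simp
  qed
  ultimately show ?thesis by simp
qed

text \<open>A form of degree \<open>d\<close> restricts to its coefficient at a power of \<open>z\<close>.\<close>

lemma eval_pol_pz:
  assumes "homogeneous d f"
  shows "eval_pol f pz = (if 5 dvd d then lookup f (single cz (d div 5)) else 0)"
proof -
  let ?s = "single cz (d div 5)"
  have *: "lookup f m * monom_eval pz m =
      (if m = ?s then (if 5 dvd d then lookup f m else 0) else 0)"
    if "m \<in> keys f" for m
  proof -
    have "monomial_weight m = d" using that assms by (auto simp: homogeneous_def)
    then have "m = single cz (lookup m cz) \<longleftrightarrow> m = ?s \<and> 5 dvd d"
      by (metis (no_types, lifting) dvd_triv_right lookup_single_eq monomial_weight_single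
          nonzero_mult_div_cancel_right wt.simps(7) zero_neq_numeral dvd_div_mult_self)
    then show ?thesis by (auto simp: monom_eval_pz)
  qed
  have "eval_pol f pz = (\<Sum>m\<in>keys f. if m = ?s then (if 5 dvd d then lookup f m else 0) else 0)"
    unfolding eval_pol_eq eval_hom_def using * by (intro sum.cong) auto
  also have "\<dots> = (if 5 dvd d then lookup f ?s else 0)"
    by (simp add: in_keys_iff)
  finally show ?thesis .
qed

lemma toric_hom:
  assumes "\<And>x y. g (x * y) = g x * g y" "g 1 = 1"
  shows "(\<lambda>v. g (toric l a b z v)) = toric (g l) (g a) (g b) (g z)"
proof
  have "g (x ^ n) = g x ^ n" for x n by (induction n) (simp_all add: assms)
  then show "g (toric l a b z v) = toric (g l) (g a) (g b) (g z) v" for v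
    by (cases v) (simp_all add: assms)
qed

text \<open>
  The variables \<open>s\<close> and \<open>t\<close> of the power series ring; at the point \<open>pz\<close> they are substituted for \<open>a\<close> and \<open>b\<close>.
\<close>

definition sV :: "complex fps fps" where "sV = fps_const fps_X"
definition tV :: "complex fps fps" where "tV = fps_X"

lemma cf_st: "cf i j (sV ^ p * tV ^ q) = (if i = p \<and> j = q then 1 else 0)"
proof -
  have "sV ^ p = fps_const (fps_X ^ p)" by (simp add: sV_def fps_const_power)
  then show ?thesis
    by (auto simp: cf_def tV_def fps_X_power_mult_right_nth fps_X_power_nth)
qed

lemma map_poly_cf_hom:
  "map_poly (cf 0 0) (p + q) = map_poly (cf 0 0) p + map_poly (cf 0 0) q"
  "map_poly (cf 0 0) (p * q) = map_poly (cf 0 0) p * map_poly (cf 0 0) q"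
  by (rule poly_eqI, simp add: coeff_map_poly coeff_mult cf_sum)+

lemma poly_hom: "coeff_hom h \<Longrightarrow> coeff_hom (\<lambda>c. [:h c:])"
  unfolding coeff_hom_def by (simp add: one_pCons)

text \<open>
  For \<open>s = t = 0\<close> the equation reads \<open>l * L0 l = 0\<close>, where \<open>L0 0\<close> is the value \<open>1\<close> of \<open>P\<close> at the point. So \<open>l = 0\<close> is
  a simple root, and it lifts by Hensel's lemma.
\<close>

lemma exists_toric_lift_pz:
  assumes "P \<in> P10_forms"
  obtains l where "cf 0 0 l = 0"
    "l * eval_hom fc (toric l sV tV 1) P + sV ^ 2 * (fc \<theta> * (sV * tV) * 1 + fc \<tau> * sV ^ 15) + tV ^ 3 = 0"
proof -
  have hp: "coeff_hom (\<lambda>c. [:fc c:])" "coeff_hom (\<lambda>c::complex. [:c:])"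
    by (rule poly_hom, rule fc_hom.coeff_hom_axioms id_hom.coeff_hom_axioms)+
  define L where "L = eval_hom (\<lambda>c. [:fc c:]) (toric [:0, 1:] [:sV:] [:tV:] 1) P"
  define F where "F = [:0, 1:] * L + [:sV ^ 2 * (fc \<theta> * (sV * tV) + fc \<tau> * sV ^ 15) + tV ^ 3:]"
  have st: "cf 0 0 sV = 0" "cf 0 0 tV = 0" using cf_st[of 0 0 1 0] cf_st[of 0 0 0 1] by simp_all
  have pl: "poly L l = eval_hom fc (toric l sV tV 1) P" for l
  proof -
    have "poly L l = eval_hom fc (\<lambda>v. poly (toric [:0, 1:] [:sV:] [:tV:] 1 v) l) P"
      unfolding L_def by (rule eval_hom_compose[OF hp(1) fc_hom.coeff_hom_axioms]) simp_all
    also have "(\<lambda>v. poly (toric [:0, 1:] [:sV:] [:tV:] 1 v) l) = toric l sV tV 1"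
      by (subst toric_hom) simp_all
    finally show ?thesis .
  qed
  define L0 where "L0 = eval_hom (\<lambda>c::complex. [:c:]) (toric [:0, 1:] 0 0 1) P"
  have mL: "map_poly (cf 0 0) L = L0"
  proof -
    have mp: "map_poly (cf 0 0) [:c:] = [:cf 0 0 c:]" for c by (simp add: map_poly_pCons)
    have "map_poly (cf 0 0) L = eval_hom (\<lambda>c::complex. [:c:]) (\<lambda>v. map_poly (cf 0 0) (toric [:0, 1:] [:sV:] [:tV:] 1 v)) P"
      unfolding L_def by (rule eval_hom_compose[OF hp]) (simp_all add: map_poly_cf_hom mp cf_fc)
    also have "(\<lambda>v. map_poly (cf 0 0) (toric [:0, 1:] [:sV:] [:tV:] 1 v)) = toric [:0, 1:] 0 0 1"
      by (subst toric_hom) (simp_all add: map_poly_cf_hom mp st cf_one map_poly_pCons one_pCons)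
    finally show ?thesis by (simp only: L0_def)
  qed
  have "cf 0 0 (sV ^ 2 * (fc \<theta> * (sV * tV) + fc \<tau> * sV ^ 15) + tV ^ 3) = 0"
    by (simp add: st power2_eq_square power3_eq_cube)
  then have mF: "map_poly (cf 0 0) F = [:0, 1:] * L0"
    unfolding F_def map_poly_cf_hom mL by (simp add: map_poly_pCons cf_one)
  have "poly L0 0 = eval_hom (\<lambda>c. c) (\<lambda>v. poly (toric [:0, 1:] 0 0 1 v) 0) P"
    unfolding L0_def by (rule eval_hom_compose[OF hp(2) id_hom.coeff_hom_axioms]) simp_all
  also have "(\<lambda>v. poly (toric [:0, 1:] 0 0 1 v) 0) = pz"
    by (subst toric_hom) (simp_all add: toric_pz)
  also have "eval_hom (\<lambda>c. c) pz P = 1"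
    using assms using eval_pol_pz[of 10 P] by (simp add: P10_forms_def flip: eval_pol_eq)
  finally have L00: "poly L0 0 = 1" .
  have "poly (map_poly (cf 0 0) F) 0 = 0" "poly (pderiv (map_poly (cf 0 0) F)) 0 \<noteq> 0"
    unfolding mF using L00 by (simp_all add: pderiv_mult pderiv_pCons)
  then obtain l where "cf 0 0 l = 0" "poly F l = 0" using fps2_hensel by blast
  then show ?thesis by (intro that[of l]) (simp_all add: F_def pl algebra_simps)
qed

locale point_z = formal_surface_point \<theta> \<tau> P pz "toric l sV tV 1" for \<theta> \<tau> P l +
  assumes P_form: "P \<in> P10_forms"
    and l_eq: "l * eval_hom fc (toric l sV tV 1) P + sV ^ 2 * (fc \<theta> * (sV * tV) * 1 + fc \<tau> * sV ^ 15) + tV ^ 3 = 0"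
begin

abbreviation "E \<equiv> relations \<theta> \<tau> P"

text \<open>
  On the parametrized surface \<open>t P + u\<^sub>1\<^sup>2 Q = b\<^sup>2 (l P + a\<^sup>2 Q) = - b\<^sup>5\<close>. So \<open>w, u\<^sub>1, T\<close> correspond to the
  generators \<open>a\<^sup>5, a b, b\<^sup>5\<close> of the invariants of the fifth roots of unity acting by \<open>(e, 1/e)\<close>, and \<open>wT\<close> is the relation
  between them.
\<close>

definition T :: pol where "T = - (tt * P + u1 ^ 2 * Qpol \<theta> \<tau>)"

lemma homogeneous_T: "homogeneous 17 T"
proof -
  have "homogeneous (7 + 10) (tt * P)" "homogeneous (2 * 4 + 9) (u1 ^ 2 * Qpol \<theta> \<tau>)"
    by (intro homogeneous_mult homogeneous_power homogeneous_vars P homogeneous_Qpol)+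
  then show ?thesis unfolding T_def by (intro homogeneous_uminus homogeneous_add) simp_all
qed

lemma ev_T: "eval_hom fc (toric l sV tV 1) T = tV ^ 5"
proof -
  define p where "p = eval_hom fc (toric l sV tV 1) P"
  define q where "q = fc \<theta> * (sV * tV) * 1 + fc \<tau> * sV ^ 15"
  have e: "l * p + sV ^ 2 * q + tV ^ 3 = 0" using l_eq by (simp add: p_def q_def)
  have "eval_hom fc (toric l sV tV 1) T = - (tV ^ 2 * l * p + (sV * tV) ^ 2 * q)"
    by (simp add: T_def Qpol_def eval_hom_simps p_def q_def flip: power_mult)
  also have "\<dots> = tV ^ 5 - tV ^ 2 * (l * p + sV ^ 2 * q + tV ^ 3)"
    by (simp add: algebra_simps eval_nat_numeral)
  finally show ?thesis unfolding e by simp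
qed

lemma wT: "ww * T - u1 ^ 5 \<in> pol_ideal E"
proof -
  have "ww * T - u1 ^ 5 = P * (yy * u1 ^ 2 - ww * tt) - u1 ^ 2 * (yy * P + ww * Qpol \<theta> \<tau> + u1 ^ 3)"
    by (simp add: T_def algebra_simps eval_nat_numeral)
  then show ?thesis by (simp only:) (intro pol_ideal_diff pol_ideal_mult rel10 rel13)
qed

section \<open>Generators of the local ring at this point\<close>

text \<open>
  The forms of degree \<open>d\<close> that are congruent to a polynomial in \<open>w, u\<^sub>1, T, z\<close>.
\<close>

inductive_set G :: "nat \<Rightarrow> pol set" for d where
  ideal: "f \<in> pol_ideal E \<Longrightarrow> homogeneous d f \<Longrightarrow> f \<in> G d"
| monom: "3 * i + 4 * j + 17 * k + 5 * n = d \<Longrightarrow> Const c * ww ^ i * u1 ^ j * T ^ k * zz ^ n \<in> G d"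
| add: "f \<in> G d \<Longrightarrow> g \<in> G d \<Longrightarrow> f + g \<in> G d"

lemma homogeneous_monom_wuTz:
  "homogeneous (3 * i + 4 * j + 17 * k + 5 * n) (Const c * ww ^ i * u1 ^ j * T ^ k * zz ^ n)"
proof -
  have "homogeneous (0 + i * 3 + j * 4 + k * 17 + n * 5) (Const c * ww ^ i * u1 ^ j * T ^ k * zz ^ n)"
    by (intro homogeneous_mult homogeneous_power homogeneous_vars homogeneous_T homogeneous_Const)
  then show ?thesis by (simp add: mult.commute)
qed

lemma G_homogeneous: "f \<in> G d \<Longrightarrow> homogeneous d f"
  by (induction rule: G.induct) (auto intro: homogeneous_monom_wuTz homogeneous_add)

lemma G_mult:
  assumes "f \<in> G d" "g \<in> G e" shows "f * g \<in> G (d + e)"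
  using assms(1)
proof induction
  case (ideal f)
  then show ?case using G_homogeneous[OF assms(2)]
    by (intro G.ideal pol_ideal_mult_r homogeneous_mult)
next
  case (monom i j k n c)
  note m = monom
  show ?case using assms(2)
  proof induction
    case (ideal f)
    then show ?case using homogeneous_monom_wuTz[of i j k n c] m
      by (intro G.ideal pol_ideal_mult homogeneous_mult) simp_all
  next
    case (monom i' j' k' n' c')
    have "Const c * ww ^ i * u1 ^ j * T ^ k * zz ^ n * (Const c' * ww ^ i' * u1 ^ j' * T ^ k' * zz ^ n') =
      Const (c * c') * ww ^ (i + i') * u1 ^ (j + j') * T ^ (k + k') * zz ^ (n + n')"
      by (simp add: Const_mult power_add mult_ac)
    then show ?case by (simp only:) (rule G.monom, use m monom in simp)
  next
    case (add f g) then show ?case by (simp add: ring_distribs G.add)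
  qed
next
  case (add f g) then show ?case by (simp add: ring_distribs G.add)
qed

lemma G_uminus: "f \<in> G d \<Longrightarrow> - f \<in> G d"
  using G_mult[OF G.monom[of 0 0 0 0 0 "- 1"], of f d] by (simp add: Const_hom.h_uminus Const_one)

lemma G_diff: "f \<in> G d \<Longrightarrow> g \<in> G d \<Longrightarrow> f - g \<in> G d"
  using G.add[of f d "- g"] G_uminus by simp

lemma G_one: "1 \<in> G 0" using G.monom[of 0 0 0 0 0 1] by (simp add: Const_one)

lemma G_power: "f \<in> G d \<Longrightarrow> f ^ n \<in> G (n * d)"
  by (induction n) (use G_one G_mult in auto)

lemma G_w: "ww \<in> G 3" using G.monom[of 1 0 0 0 3 1] by (simp add: Const_one)
lemma G_u1: "u1 \<in> G 4" using G.monom[of 0 1 0 0 4 1] by (simp add: Const_one)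
lemma G_T: "T \<in> G 17" using G.monom[of 0 0 1 0 17 1] by (simp add: Const_one)
lemma G_z: "zz \<in> G 5" using G.monom[of 0 0 0 1 5 1] by (simp add: Const_one)

lemma G_Q: "Qpol \<theta> \<tau> \<in> G 9"
proof -
  have "Const \<theta> * u1 * zz \<in> G 9" using G.monom[of 0 1 0 1 9 \<theta>] by simp
  moreover have "Const \<tau> * ww ^ 3 \<in> G 9" using G.monom[of 3 0 0 0 9 \<tau>] by simp
  ultimately show ?thesis unfolding Qpol_def by (rule G.add)
qed

lemma G_mult': "f \<in> G d \<Longrightarrow> g \<in> G e \<Longrightarrow> d + e = n \<Longrightarrow> f * g \<in> G n"
  using G_mult by blast

text \<open>
  Here and below, the relations that contain \<open>P\<close> are solved one after the other for \<open>P\<close> times a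
  coordinate: for \<open>t\<close> by definition of \<open>T\<close>, then for \<open>y, x\<^sub>1, u\<^sub>0, x\<^sub>0\<close> with growing powers of \<open>P\<close>.
\<close>

lemma G_t: "P * tt \<in> G 17"
proof -
  have "P * tt = - T - u1 ^ 2 * Qpol \<theta> \<tau>" by (simp add: T_def algebra_simps)
  moreover have "\<dots> \<in> G 17"
    by (intro G_diff G_uminus G_T G_mult'[OF G_power[OF G_u1] G_Q]) simp
  ultimately show ?thesis by simp
qed

lemma homogeneous_rel:
  "homogeneous 11 (x0 * P + x1 ^ 2 * Qpol \<theta> \<tau> + u0 * tt)" "homogeneous 11 (x1 * P + yy * Qpol \<theta> \<tau> + u1 * tt)"
  "homogeneous 12 (yy * P + ww * Qpol \<theta> \<tau> + u1 ^ 3)" "homogeneous 14 (u0 * P + x1 * u1 * Qpol \<theta> \<tau> + tt ^ 2)"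
proof -
  have "homogeneous (1 + 10) (x0 * P)" "homogeneous (2 * 1 + 9) (x1 ^ 2 * Qpol \<theta> \<tau>)" "homogeneous (4 + 7) (u0 * tt)"
    "homogeneous (1 + 10) (x1 * P)" "homogeneous (2 + 9) (yy * Qpol \<theta> \<tau>)" "homogeneous (4 + 7) (u1 * tt)"
    "homogeneous (2 + 10) (yy * P)" "homogeneous (3 + 9) (ww * Qpol \<theta> \<tau>)" "homogeneous (3 * 4) (u1 ^ 3)"
    "homogeneous (4 + 10) (u0 * P)" "homogeneous (1 + 4 + 9) (x1 * u1 * Qpol \<theta> \<tau>)" "homogeneous (2 * 7) (tt ^ 2)"
    by (intro homogeneous_mult homogeneous_power homogeneous_vars P homogeneous_Qpol)+
  then show "homogeneous 11 (x0 * P + x1 ^ 2 * Qpol \<theta> \<tau> + u0 * tt)" "homogeneous 11 (x1 * P + yy * Qpol \<theta> \<tau> + u1 * tt)"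
     "homogeneous 12 (yy * P + ww * Qpol \<theta> \<tau> + u1 ^ 3)" "homogeneous 14 (u0 * P + x1 * u1 * Qpol \<theta> \<tau> + tt ^ 2)"
    by (auto intro!: homogeneous_add)
qed

lemma homogeneous_Pn: "homogeneous (n * 10) (P ^ n)"
  by (rule homogeneous_power[OF P])

lemma G_y: "P * yy \<in> G 12"
proof -
  have "P * yy = (yy * P + ww * Qpol \<theta> \<tau> + u1 ^ 3) - ww * Qpol \<theta> \<tau> - u1 ^ 3" by (simp add: algebra_simps)
  moreover have "\<dots> \<in> G 12"
  proof (intro G_diff)
    show "yy * P + ww * Qpol \<theta> \<tau> + u1 ^ 3 \<in> G 12" by (rule G.ideal[OF rel13 homogeneous_rel(3)])
    show "ww * Qpol \<theta> \<tau> \<in> G 12" by (rule G_mult'[OF G_w G_Q]) simp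
    show "u1 ^ 3 \<in> G 12" using G_power[OF G_u1, of 3] by simp
  qed
  ultimately show ?thesis by (simp only:)
qed

lemma G_x1: "P ^ 2 * x1 \<in> G 21"
proof -
  have "P ^ 2 * x1 = P * (x1 * P + yy * Qpol \<theta> \<tau> + u1 * tt) - (P * yy) * Qpol \<theta> \<tau> - u1 * (P * tt)"
    by (simp add: algebra_simps power2_eq_square)
  moreover have "\<dots> \<in> G 21"
  proof (intro G_diff)
    show "P * (x1 * P + yy * Qpol \<theta> \<tau> + u1 * tt) \<in> G 21"
      using homogeneous_mult[OF P homogeneous_rel(2)] by (intro G.ideal pol_ideal_mult rel12) simp
  qed (rule G_mult'[OF G_y G_Q] G_mult'[OF G_u1 G_t], simp)+
  ultimately show ?thesis by simp
qed

lemma G_u0: "P ^ 3 * u0 \<in> G 34"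
proof -
  have "P ^ 3 * u0 = P ^ 2 * (u0 * P + x1 * u1 * Qpol \<theta> \<tau> + tt ^ 2) - (P ^ 2 * x1) * (u1 * Qpol \<theta> \<tau>) - (P * tt) ^ 2"
    by (simp add: algebra_simps eval_nat_numeral)
  moreover have "\<dots> \<in> G 34"
  proof (intro G_diff)
    show "P ^ 2 * (u0 * P + x1 * u1 * Qpol \<theta> \<tau> + tt ^ 2) \<in> G 34"
      using homogeneous_mult[OF homogeneous_Pn homogeneous_rel(4), of 2]
      by (intro G.ideal pol_ideal_mult rel14) simp
    show "(P ^ 2 * x1) * (u1 * Qpol \<theta> \<tau>) \<in> G 34" by (rule G_mult'[OF G_x1 G_mult[OF G_u1 G_Q]]) simp
    show "(P * tt) ^ 2 \<in> G 34" using G_power[OF G_t, of 2] by simp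
  qed
  ultimately show ?thesis by simp
qed

lemma G_x0: "P ^ 5 * x0 \<in> G 51"
proof -
  have "P ^ 5 * x0 = P ^ 4 * (x0 * P + x1 ^ 2 * Qpol \<theta> \<tau> + u0 * tt) - (P ^ 2 * x1) ^ 2 * Qpol \<theta> \<tau> - (P ^ 3 * u0) * (P * tt)"
    by (simp add: algebra_simps eval_nat_numeral)
  moreover have "\<dots> \<in> G 51"
  proof (intro G_diff)
    show "P ^ 4 * (x0 * P + x1 ^ 2 * Qpol \<theta> \<tau> + u0 * tt) \<in> G 51"
      using homogeneous_mult[OF homogeneous_Pn homogeneous_rel(1), of 4]
      by (intro G.ideal pol_ideal_mult rel11) simp
  qed (rule G_mult'[OF G_power[OF G_x1] G_Q] G_mult'[OF G_u0 G_t], simp)+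
  ultimately show ?thesis by simp
qed

lemma G_Var: "\<exists>n. P ^ n * Var v \<in> G (wt v + 10 * n)"
proof (cases v)
  case cx0 then show ?thesis using G_x0 by (auto intro!: exI[of _ 5])
next
  case cx1 then show ?thesis using G_x1 by (auto intro!: exI[of _ 2])
next
  case cy then show ?thesis using G_y by (auto intro!: exI[of _ 1])
next
  case cw then show ?thesis using G_w by (auto intro!: exI[of _ 0])
next
  case cu0 then show ?thesis using G_u0 by (auto intro!: exI[of _ 3])
next
  case cu1 then show ?thesis using G_u1 by (auto intro!: exI[of _ 0])
next
  case cz then show ?thesis using G_z by (auto intro!: exI[of _ 0])
next
  case ct then show ?thesis using G_t by (auto intro!: exI[of _ 1])
qed

lemma G_monom: "\<exists>n. P ^ n * monom_eval Var m \<in> G (monomial_weight m + 10 * n)"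
proof -
  have mult: "\<exists>n. P ^ n * (f * g) \<in> G (d + e + 10 * n)"
    if "\<exists>n. P ^ n * f \<in> G (d + 10 * n)" "\<exists>n. P ^ n * g \<in> G (e + 10 * n)" for f g d e
  proof -
    from that obtain n n' where "P ^ n * f \<in> G (d + 10 * n)" "P ^ n' * g \<in> G (e + 10 * n')" by blast
    from G_mult[OF this] show ?thesis
      by (intro exI[of _ "n + n'"]) (simp add: power_add algebra_simps)
  qed
  have pow: "\<exists>n. P ^ n * Var v ^ k \<in> G (k * wt v + 10 * n)" for v k
  proof (induction k)
    case 0 show ?case using G_one by (auto intro!: exI[of _ 0])
  next
    case (Suc k)
    from mult[OF G_Var Suc] show ?case by simp
  qed
  have "\<exists>n. P ^ n * (\<Prod>v\<in>V. Var v ^ k v) \<in> G ((\<Sum>v\<in>V. k v * wt v) + 10 * n)" if "finite V" for V k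
    using that
  proof (induction V)
    case empty show ?case using G_one by (auto intro!: exI[of _ 0])
  next
    case (insert v V)
    from mult[OF pow insert.IH] insert.hyps show ?case by simp
  qed
  from this[of "keys m" "lookup m"]
  show ?thesis by (simp add: monom_eval_def monomial_weight_def)
qed

lemma z_nz: "eval_pol (zz ^ e) pz \<noteq> 0" "homogeneous (5 * e) (zz ^ e)" "zz ^ e \<noteq> 0"
proof -
  show 1: "eval_pol (zz ^ e) pz \<noteq> 0" by (simp add: eval_pol_simps pz_def)
  show "homogeneous (5 * e) (zz ^ e)" using homogeneous_power[OF homogeneous_vars(7), of e] by (simp add: mult.commute)
  show "zz ^ e \<noteq> 0" using 1 by (rule eval_pol_nz)
qed

text \<open>
  A subring of the local ring that contains \<open>I\<close> and approximates every element up to powers of the maximal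
  ideal (\<open>Sp_plus_MP\<close>). Its elements have explicit images in the power series ring.
\<close>

inductive_set Sp :: "pol fract set" where
  ideal: "x \<in> locI E pz \<Longrightarrow> x \<in> Sp"
| monom: "3 * i + 4 * j + 17 * k = 5 * e \<Longrightarrow> Fract (Const c * ww ^ i * u1 ^ j * T ^ k) (zz ^ e) \<in> Sp"
| add: "x \<in> Sp \<Longrightarrow> y \<in> Sp \<Longrightarrow> x + y \<in> Sp"

lemma Sp_monom_in_locA: "3 * i + 4 * j + 17 * k = 5 * e \<Longrightarrow> Fract (Const c * ww ^ i * u1 ^ j * T ^ k) (zz ^ e) \<in> locA pz"
  using homogeneous_monom_wuTz[of i j k 0 c] z_nz[of e] by (intro locA_I[of "5 * e"]) simp_all

lemma Sp_sub: "x \<in> Sp \<Longrightarrow> x \<in> locA pz"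
  by (induction rule: Sp.induct) (use I_sub Sp_monom_in_locA A_add in auto)

lemma Sp_mult:
  assumes "x \<in> Sp" "y \<in> Sp" shows "x * y \<in> Sp"
  using assms(1)
proof induction
  case (ideal f)
  then show ?case using Sp_sub[OF assms(2)] by (intro Sp.ideal I_mult_r)
next
  case (monom i j k e c)
  note m = monom
  show ?case using assms(2)
  proof induction
    case (ideal f)
    then show ?case using Sp_monom_in_locA m by (intro Sp.ideal I_mult)
  next
    case (monom i' j' k' e' c')
    have "Fract (Const c * ww ^ i * u1 ^ j * T ^ k) (zz ^ e) * Fract (Const c' * ww ^ i' * u1 ^ j' * T ^ k') (zz ^ e') =
      Fract (Const (c * c') * ww ^ (i + i') * u1 ^ (j + j') * T ^ (k + k')) (zz ^ (e + e'))"
      by (simp add: Const_mult power_add mult_ac)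
    then show ?case by (simp only:) (rule Sp.monom, use m monom in simp)
  next
    case (add f g) then show ?case by (simp add: ring_distribs Sp.add)
  qed
next
  case (add f g) then show ?case by (simp add: ring_distribs Sp.add)
qed

lemma Sp_Const: "emb (Const c) \<in> Sp"
  using Sp.monom[of 0 0 0 0 c] by (simp add: emb_def)

lemma Sp_sum: "(\<And>x. x \<in> S \<Longrightarrow> f x \<in> Sp) \<Longrightarrow> sum f S \<in> Sp"
  using Sp.ideal[OF I_0] by (induction S rule: infinite_finite_induct) (auto intro: Sp.add)

lemma G_Sp: "f \<in> G (5 * e) \<Longrightarrow> Fract f (zz ^ e) \<in> Sp"
proof (induction rule: G.induct)
  case (ideal f)
  then show ?case using z_nz[of e] by (intro Sp.ideal locI_I)
next
  case (monom i j k n c)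
  then have "n \<le> e" by simp
  then have "zz ^ e = zz ^ (e - n) * zz ^ n" by (metis le_add_diff_inverse2 power_add)
  then have "Fract (Const c * ww ^ i * u1 ^ j * T ^ k * zz ^ n) (zz ^ e) = Fract (Const c * ww ^ i * u1 ^ j * T ^ k) (zz ^ (e - n))"
    using z_nz(3)[of n] z_nz(3)[of "e - n"] by (simp add: eq_fract mult_ac)
  then show ?case by (simp only:) (rule Sp.monom, use monom \<open>n \<le> e\<close> in simp)
next
  case (add f g)
  have "Fract (f + g) (zz ^ e) = Fract f (zz ^ e) + Fract g (zz ^ e)"
    using z_nz(3)[of e] by (simp add: Fract_emb emb_add add_divide_distrib)
  then show ?case using add.IH by (simp add: Sp.add)
qed

lemma P_pz: "eval_pol P pz = 1"
  using P_form eval_pol_pz[of 10 P] by (simp add: P10_forms_def)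

text \<open>
  The maximal ideal is generated by its elements in \<open>Sp\<close>: multiply each monomial of the numerator by the
  power of \<open>P\<close>, a unit at the point, that brings it into \<open>G\<close>. A pure power of \<open>z\<close> does not occur, since the numerator
  vanishes at the point.
\<close>

lemma locM_generated:
  assumes "x \<in> locM pz"
  shows "\<exists>S c s. finite (S :: (coord \<Rightarrow>\<^sub>0 nat) set) \<and> (\<forall>m\<in>S. c m \<in> locA pz \<and> s m \<in> Sp \<and> s m \<in> locM pz) \<and> x = (\<Sum>m\<in>S. c m * s m)"
proof -
  obtain f g d where 1: "x = Fract f g" "homogeneous d f" "homogeneous d g" "eval_pol g pz \<noteq> 0" "g \<noteq> 0"
    using assms by (auto simp: locM_def elim: locA_E)
  have f0: "eval_pol f pz = 0" using assms 1 by (auto simp: locM_def value_at_Fract)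
  have "5 dvd d" using 1(4) eval_pol_pz[OF 1(3)] by (auto split: if_splits)
  then obtain e where e: "d = 5 * e" by auto
  define S where "S = keys f"
  define nn where "nn m = (SOME n. P ^ n * monom_eval Var m \<in> G (monomial_weight m + 10 * n))" for m
  have nn: "P ^ nn m * monom_eval Var m \<in> G (5 * (e + 2 * nn m))" if "m \<in> S" for m
  proof -
    have "monomial_weight m = 5 * e" using that 1(2) e by (auto simp: homogeneous_def S_def)
    then show ?thesis using someI_ex[OF G_monom[of m]] by (simp add: nn_def)
  qed
  \<comment> \<open>\<open>P\<close> has the degree of \<open>z\<^sup>2\<close>, hence the exponent \<open>e + 2 * nn m\<close>\<close>
  define s where "s m = Fract (P ^ nn m * monom_eval Var m) (zz ^ (e + 2 * nn m))" for m
  define c where "c m = Fract (Const (lookup f m) * zz ^ (e + 2 * nn m)) (P ^ nn m * g)" for m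
  have P0: "P \<noteq> 0" using P_pz by (intro eval_pol_nz[of P pz]) simp
  have "s m \<in> Sp" if "m \<in> S" for m unfolding s_def by (rule G_Sp[OF nn[OF that]])
  moreover have "c m \<in> locA pz" if "m \<in> S" for m
    unfolding c_def
  proof (rule locA_I)
    show "homogeneous (5 * (e + 2 * nn m)) (Const (lookup f m) * zz ^ (e + 2 * nn m))"
      using homogeneous_mult[OF homogeneous_Const z_nz(2)[of "e + 2 * nn m"]] by (simp only: add_0)
    show "homogeneous (5 * (e + 2 * nn m)) (P ^ nn m * g)"
      using homogeneous_mult[OF homogeneous_Pn 1(3), of "nn m"] e by (simp add: algebra_simps)
    show "eval_pol (P ^ nn m * g) pz \<noteq> 0" using 1(4) P_pz by (simp add: eval_pol_simps)
  qed
  moreover have "s m \<in> locM pz" if "m \<in> S" for m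
  proof -
    have A: "s m \<in> locA pz" using that \<open>m \<in> S \<Longrightarrow> s m \<in> Sp\<close> Sp_sub by blast
    have h: "homogeneous (5 * (e + 2 * nn m)) (P ^ nn m * monom_eval Var m)"
      using nn[OF that] by (rule G_homogeneous)
    have ev: "eval_pol (monom_eval Var m) pz = monom_eval pz m"
      by (simp add: monom_eval_Var eval_pol_eq id_hom.eval_hom_single)
    have w: "monomial_weight m = 5 * e" using that 1(2) e by (auto simp: homogeneous_def S_def)
    have "monom_eval pz m = 0"
    proof (rule ccontr)
      assume "monom_eval pz m \<noteq> 0"
      then have m: "m = single cz (lookup m cz)"
        by (simp add: monom_eval_pz split: if_splits)
      then have "monomial_weight m = lookup m cz * 5" by (metis monomial_weight_single wt.simps(7))
      then have "m = single cz e" using m w by simp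
      then have "lookup f m = eval_pol f pz" using eval_pol_pz[OF 1(2)] e by simp
      then show False using f0 that by (simp add: S_def in_keys_iff)
    qed
    then show ?thesis using A value_at_Fract[OF h z_nz(2) z_nz(1)]
      by (simp add: locM_def s_def eval_pol_simps ev)
  qed
  moreover have "x = (\<Sum>m\<in>S. c m * s m)"
  proof -
    have "c m * s m = emb (Const (lookup f m) * monom_eval Var m) / emb g" for m
      unfolding c_def s_def using P0 1(5) z_nz(3)[of 1] by (simp add: Fract_emb emb_mult emb_power)
    then have "(\<Sum>m\<in>S. c m * s m) = emb (\<Sum>m\<in>S. Const (lookup f m) * monom_eval Var m) / emb g"
      by (simp add: emb_sum sum_divide_distrib)
    then have "(\<Sum>m\<in>S. c m * s m) = emb f / emb g"
      unfolding S_def sum_monoms[of f, symmetric] .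
    then show ?thesis using 1 by (simp add: Fract_emb)
  qed
  moreover have "finite S" by (simp add: S_def)
  ultimately show ?thesis
    by (intro exI[of _ S] exI[of _ c] exI[of _ s] conjI ballI)
qed

lemma value_const: "value_at a (emb (Const c)) = c"
  using val.Phi_const[of a c] by (simp add: emb_def)

lemma locM_minus_value: "x \<in> locA pz \<Longrightarrow> x - emb (Const (value_at pz x)) \<in> locM pz"
proof -
  assume x: "x \<in> locA pz"
  have c: "x - emb (Const (value_at pz x)) = x + emb (Const (- value_at pz x))"
    by (simp only: emb_Const.h_uminus diff_conv_add_uminus)
  have "value_at pz (x + emb (Const (- value_at pz x))) = 0"
    using val.Phi_add[OF x emb_Const_in_locA] by (simp add: value_const)
  moreover have "x + emb (Const (- value_at pz x)) \<in> locA pz" using x emb_Const_in_locA by (rule A_add)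
  ultimately show ?thesis unfolding c by (simp add: locM_def)
qed

text \<open>
  The residue field consists of the constants, so \<open>x\<close> is a constant plus a combination of elements of
  \<open>Sp\<close> in the maximal ideal; approximating the coefficients modulo a power of the maximal ideal
  approximates \<open>x\<close> modulo the next one.
\<close>

lemma Sp_plus_MP: "x \<in> locA pz \<Longrightarrow> \<exists>s\<in>Sp. x - s \<in> MP n"
proof (induction n arbitrary: x)
  case 0
  then show ?case using Sp.ideal[OF I_0] by (intro bexI[of _ 0]) (auto simp: MP_0)
next
  case (Suc n)
  define k where "k = emb (Const (value_at pz x))"
  obtain S c s where S: "finite (S :: (coord \<Rightarrow>\<^sub>0 nat) set)" "\<And>m. m \<in> S \<Longrightarrow> c m \<in> locA pz \<and> s m \<in> Sp \<and> s m \<in> locM pz"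
    "x - k = (\<Sum>m\<in>S. c m * s m)"
    using locM_generated[OF locM_minus_value[OF Suc.prems]] unfolding k_def by blast
  have "\<forall>m. \<exists>r. m \<in> S \<longrightarrow> r \<in> Sp \<and> c m - r \<in> MP n" using Suc.IH S(2) by blast
  then obtain r where r: "\<And>m. m \<in> S \<Longrightarrow> r m \<in> Sp \<and> c m - r m \<in> MP n" by metis
  have "k + (\<Sum>m\<in>S. r m * s m) \<in> Sp"
    unfolding k_def using r S by (intro Sp.add Sp_Const Sp_sum Sp_mult) auto
  moreover have "x - (k + (\<Sum>m\<in>S. r m * s m)) = (\<Sum>m\<in>S. (c m - r m) * s m)"
    using S(3) by (simp add: left_diff_distrib sum_subtractf algebra_simps)
  moreover have "(\<Sum>m\<in>S. (c m - r m) * s m) \<in> MP (Suc n)"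
    using r S by (intro MP_sum MP_Suc) auto
  ultimately show ?case by metis
qed

section \<open>Invariant monomials\<close>

text \<open>
  The exponents of the monomials \<open>a\<^sup>p b\<^sup>q\<close> that are invariant under \<open>(e, e\<^sup>1\<^sup>4)\<close> for \<open>e\<^sup>2\<^sup>5 = 1\<close>. Such a monomial
  equals \<open>(a\<^sup>5)\<^sup>i (a b)\<^sup>j (b\<^sup>5)\<^sup>k\<close> with \<open>j = min p q\<close>, and it is the image of the fraction \<open>mu p q\<close> with numerator
  \<open>w\<^sup>i u\<^sub>1\<^sup>j T\<^sup>k\<close> of degree \<open>deg p q\<close> (\<open>Phi_mu\<close>).
\<close>

definition inv_exp :: "(nat \<times> nat) set" where "inv_exp = {(p, q). 25 dvd p + 14 * q}"

definition num :: "nat \<Rightarrow> nat \<Rightarrow> pol" where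
  "num p q = ww ^ ((p - min p q) div 5) * u1 ^ min p q * T ^ ((q - min p q) div 5)"

definition deg :: "nat \<Rightarrow> nat \<Rightarrow> nat" where
  "deg p q = 3 * ((p - min p q) div 5) + 4 * min p q + 17 * ((q - min p q) div 5)"

definition mu :: "nat \<Rightarrow> nat \<Rightarrow> pol fract" where
  "mu p q = Fract (num p q) (zz ^ (deg p q div 5))"

lemma inv_exp_cong:
  assumes "25 dvd p + 14 * q" shows "p mod 5 = q mod (5::nat)"
proof -
  obtain m where "p + 14 * q = 25 * m" using assms by (rule dvdE)
  then have "p + 5 * (3 * q) = q + 5 * (5 * m)" by simp
  then have "(p + 5 * (3 * q)) mod 5 = (q + 5 * (5 * m)) mod 5" by (simp only:)
  then show ?thesis by (simp only: mod_mult_self2)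
qed

lemma inv_expE:
  assumes "(p, q) \<in> inv_exp"
  obtains i j k where "p = 5 * i + j" "q = 5 * k + j" "num p q = ww ^ i * u1 ^ j * T ^ k"
    "deg p q = 3 * i + 4 * j + 17 * k"
proof -
  have pq: "p mod 5 = q mod 5" using assms inv_exp_cong by (auto simp: inv_exp_def)
  define j where "j = min p q"
  have "5 dvd p - j" "5 dvd q - j" using pq unfolding j_def min_def
    by (auto simp: mod_eq_dvd_iff_nat intro: mod_eq_dvd_iff_nat[THEN iffD1])
  then have "p = 5 * ((p - j) div 5) + j" "q = 5 * ((q - j) div 5) + j" by (auto simp: j_def)
  then show ?thesis
    by (rule that[of "(p - j) div 5" j "(q - j) div 5"]) (simp_all only: num_def deg_def j_def)
qed

text \<open>
  The number \<open>p + 14 q\<close> equals \<open>5 (i + 3 j + 14 k)\<close>, and \<open>3 (i + 3 j + 14 k)\<close> is congruent to the weight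
  \<open>3 i + 4 j + 17 k\<close> modulo \<open>5\<close>. So the invariants are the monomials whose weight is that of a power of \<open>z\<close>.
\<close>

lemma inv_exp_iff: "(5 * i + j, 5 * k + j) \<in> inv_exp \<longleftrightarrow> 5 dvd 3 * i + 4 * j + 17 * k"
proof -
  have "(5 * i + j, 5 * k + j) \<in> inv_exp \<longleftrightarrow> 5 * 5 dvd 5 * (i + 3 * j + 14 * k)"
    by (simp add: inv_exp_def algebra_simps)
  also have "\<dots> \<longleftrightarrow> 5 dvd i + 3 * j + 14 * k" by (subst nat_mult_dvd_cancel_disj) simp
  also have "\<dots> \<longleftrightarrow> 5 dvd 3 * i + 4 * j + 17 * k"
  proof
    assume "5 dvd i + 3 * j + 14 * k"
    then have "5 dvd 3 * (i + 3 * j + 14 * k)" by (rule dvd_mult)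
    also have "3 * (i + 3 * j + 14 * k) = (3 * i + 4 * j + 17 * k) + 5 * (j + 5 * k)" by simp
    finally show "5 dvd 3 * i + 4 * j + 17 * k" by (subst (asm) dvd_add_left_iff) simp_all
  next
    assume "5 dvd 3 * i + 4 * j + 17 * k"
    then have "5 dvd 2 * (3 * i + 4 * j + 17 * k)" by (rule dvd_mult)
    also have "2 * (3 * i + 4 * j + 17 * k) = (i + 3 * j + 14 * k) + 5 * (i + j + 4 * k)" by simp
    finally show "5 dvd i + 3 * j + 14 * k" by (subst (asm) dvd_add_left_iff) simp_all
  qed
  finally show ?thesis .
qed

lemma deg_dvd: "(p, q) \<in> inv_exp \<Longrightarrow> 5 * (deg p q div 5) = deg p q"
proof -
  assume pq: "(p, q) \<in> inv_exp"
  then obtain i j k where *: "p = 5 * i + j" "q = 5 * k + j" "num p q = ww ^ i * u1 ^ j * T ^ k" "deg p q = 3 * i + 4 * j + 17 * k"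
    by (rule inv_expE)
  note *(4)
  moreover have "5 dvd 3 * i + 4 * j + 17 * k" using pq unfolding *(1,2) inv_exp_iff .
  ultimately have "5 dvd deg p q" by (simp only:)
  then show ?thesis by simp
qed

lemma num_homogeneous: "homogeneous (deg p q) (num p q)"
  using homogeneous_monom_wuTz[of "(p - min p q) div 5" "min p q" "(q - min p q) div 5" 0 1]
  by (simp add: deg_def num_def Const_one)

lemma mu_locA: "(p, q) \<in> inv_exp \<Longrightarrow> mu p q \<in> locA pz"
  unfolding mu_def using z_nz[of "deg p q div 5"] num_homogeneous[of p q] deg_dvd[of p q]
  by (intro locA_I[of "deg p q"]) simp_all

text \<open>
  By \<open>wT\<close>, a common power of \<open>w\<close> and \<open>T\<close> can be traded for \<open>u\<^sub>1\<close>.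
\<close>

lemma num_cong: "ww ^ i * u1 ^ j * T ^ k - num (5 * i + j) (5 * k + j) \<in> pol_ideal E"
proof -
  have wTn: "(ww * T) ^ r - (u1 ^ 5) ^ r \<in> pol_ideal E" for r
  proof (induction r)
    case 0 show ?case by (simp add: pol_ideal_0)
  next
    case (Suc r)
    have "(ww * T) ^ Suc r - (u1 ^ 5) ^ Suc r =
        (ww * T) * ((ww * T) ^ r - (u1 ^ 5) ^ r) + (u1 ^ 5) ^ r * (ww * T - u1 ^ 5)"
      by (simp add: algebra_simps)
    then show ?case using Suc wT by (simp only:) (intro pol_ideal_add pol_ideal_mult)
  qed
  define r where "r = min i k"
  have i: "i = r + (i - r)" and k: "k = r + (k - r)" by (auto simp: r_def)
  have m: "min (5 * i + j) (5 * k + j) = 5 * r + j" by (auto simp: r_def min_def)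
  define Y where "Y = ww ^ (i - r) * u1 ^ j * T ^ (k - r)"
  have "u1 ^ (5 * r + j) = (u1 ^ 5) ^ r * u1 ^ j" by (simp only: power_add power_mult)
  moreover have "num (5 * i + j) (5 * k + j) = ww ^ (i - r) * u1 ^ (5 * r + j) * T ^ (k - r)"
    unfolding num_def m by (simp flip: diff_mult_distrib2)
  ultimately have 1: "num (5 * i + j) (5 * k + j) = (u1 ^ 5) ^ r * Y"
    by (simp only: Y_def mult_ac)
  have "ww ^ i = ww ^ r * ww ^ (i - r)" "T ^ k = T ^ r * T ^ (k - r)" using i k by (metis power_add)+
  then have 2: "ww ^ i * u1 ^ j * T ^ k = (ww * T) ^ r * Y" by (simp only: Y_def power_mult_distrib mult_ac)
  show ?thesis unfolding 1 2 left_diff_distrib[symmetric] by (rule pol_ideal_mult_r[OF wTn])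
qed

text \<open>
  By \<open>num_cong\<close>, a generator of \<open>Sp\<close> depends modulo the ideal only on its image \<open>a\<^sup>p b\<^sup>q\<close>.
\<close>

lemma Sp_normal_form:
  "x \<in> Sp \<Longrightarrow> \<exists>F c. finite F \<and> F \<subseteq> inv_exp \<and> x - (\<Sum>(p, q)\<in>F. emb (Const (c p q)) * mu p q) \<in> locI E pz"
proof (induction rule: Sp.induct)
  case (ideal x)
  then show ?case by (intro exI[of _ "{}"]) auto
next
  case (monom i j k e c)
  let ?p = "5 * i + j" and ?q = "5 * k + j"
  have pq: "(?p, ?q) \<in> inv_exp" unfolding inv_exp_iff using monom by simp
  have d: "deg ?p ?q = 5 * e"
  proof -
    have "min ?p ?q = 5 * min i k + j" by (auto simp: min_def)
    then have "deg ?p ?q = 3 * (i - min i k) + 4 * (5 * min i k + j) + 17 * (k - min i k)"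
      unfolding deg_def by (simp flip: diff_mult_distrib2)
    also have "\<dots> = 3 * i + 4 * j + 17 * k" by (auto simp: min_def)
    finally show ?thesis using monom by simp
  qed
  have "Fract (Const c * (ww ^ i * u1 ^ j * T ^ k - num ?p ?q)) (zz ^ e) \<in> locI E pz"
  proof (rule locI_I)
    show "Const c * (ww ^ i * u1 ^ j * T ^ k - num ?p ?q) \<in> pol_ideal E" by (intro pol_ideal_mult num_cong)
    have "homogeneous (0 + 5 * e) (Const c * (ww ^ i * u1 ^ j * T ^ k - num ?p ?q))"
      using homogeneous_monom_wuTz[of i j k 0 1] num_homogeneous[of ?p ?q] d monom
      by (intro homogeneous_mult homogeneous_Const homogeneous_diff) (simp_all add: Const_one)
    then show "homogeneous (5 * e) (Const c * (ww ^ i * u1 ^ j * T ^ k - num ?p ?q))" by simp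
  qed (use z_nz in auto)
  moreover have "Fract (Const c * (ww ^ i * u1 ^ j * T ^ k - num ?p ?q)) (zz ^ e) =
     Fract (Const c * ww ^ i * u1 ^ j * T ^ k) (zz ^ e) - emb (Const c) * mu ?p ?q"
    unfolding mu_def d using z_nz(3)[of e]
    by (simp add: Fract_emb emb_hom diff_divide_distrib right_diff_distrib mult.assoc)
  ultimately show ?case
    using pq by (intro exI[of _ "{(?p, ?q)}"] exI[of _ "\<lambda>_ _. c"]) auto
next
  case (add x y)
  then obtain F c F' c' where *: "finite F" "F \<subseteq> inv_exp" "x - (\<Sum>(p, q)\<in>F. emb (Const (c p q)) * mu p q) \<in> locI E pz"
    "finite F'" "F' \<subseteq> inv_exp" "y - (\<Sum>(p, q)\<in>F'. emb (Const (c' p q)) * mu p q) \<in> locI E pz" by blast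
  let ?c = "\<lambda>p q. (if (p, q) \<in> F then c p q else 0) + (if (p, q) \<in> F' then c' p q else 0)"
  have "(\<Sum>(p, q)\<in>F. emb (Const (c p q)) * mu p q) =
      (\<Sum>(p, q)\<in>F \<union> F'. emb (Const (if (p, q) \<in> F then c p q else 0)) * mu p q)"
    using * by (intro sum.mono_neutral_cong_left) (auto simp: Const_zero)
  moreover have "(\<Sum>(p, q)\<in>F'. emb (Const (c' p q)) * mu p q) =
      (\<Sum>(p, q)\<in>F \<union> F'. emb (Const (if (p, q) \<in> F' then c' p q else 0)) * mu p q)"
    using * by (intro sum.mono_neutral_cong_left) (auto simp: Const_zero)
  ultimately have "(\<Sum>(p, q)\<in>F \<union> F'. emb (Const (?c p q)) * mu p q) =
     (\<Sum>(p, q)\<in>F. emb (Const (c p q)) * mu p q) + (\<Sum>(p, q)\<in>F'. emb (Const (c' p q)) * mu p q)"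
    by (simp only: emb_Const.h_add distrib_right sum.distrib case_prod_unfold)
  moreover have "(x - (\<Sum>(p, q)\<in>F. emb (Const (c p q)) * mu p q)) + (y - (\<Sum>(p, q)\<in>F'. emb (Const (c' p q)) * mu p q)) \<in> locI E pz"
    using * by (intro I_add)
  ultimately have "x + y - (\<Sum>(p, q)\<in>F \<union> F'. emb (Const (?c p q)) * mu p q) \<in> locI E pz"
    by (simp add: algebra_simps)
  then show ?case using * by (intro exI[of _ "F \<union> F'"] exI[of _ ?c]) auto
qed

lemma approx_by_mu:
  assumes "x \<in> locA pz"
  shows "\<exists>F c. finite F \<and> F \<subseteq> inv_exp \<and> x - (\<Sum>(p, q)\<in>F. emb (Const (c p q)) * mu p q) \<in> MP n"
proof -
  obtain s where s: "s \<in> Sp" "x - s \<in> MP n" using Sp_plus_MP[OF assms] by blast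
  obtain F c where F: "finite F" "F \<subseteq> inv_exp" "s - (\<Sum>(p, q)\<in>F. emb (Const (c p q)) * mu p q) \<in> locI E pz"
    using Sp_normal_form[OF s(1)] by blast
  have "(x - s) + (s - (\<Sum>(p, q)\<in>F. emb (Const (c p q)) * mu p q)) \<in> MP n"
    using s F I_MP by (intro MP_add) auto
  then show ?thesis using F by auto
qed

lemma Phi_mu: assumes "(p, q) \<in> inv_exp" shows "Phi (mu p q) = sV ^ p * tV ^ q"
  using assms
proof (rule inv_expE)
  fix i j k assume *: "p = 5 * i + j" "q = 5 * k + j" and n: "num p q = ww ^ i * u1 ^ j * T ^ k"
  have "Phi (Fract (num p q) (zz ^ (deg p q div 5))) * eval_hom fc (toric l sV tV 1) (zz ^ (deg p q div 5)) =
      eval_hom fc (toric l sV tV 1) (num p q)"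
    using num_homogeneous[of p q] deg_dvd[OF assms] z_nz[of "deg p q div 5"] by (intro Phi_Fract) simp_all
  then have "Phi (mu p q) = eval_hom fc (toric l sV tV 1) (num p q)"
    by (simp add: mu_def eval_hom_simps)
  also have "\<dots> = (sV ^ 5) ^ i * (sV * tV) ^ j * (tV ^ 5) ^ k"
    unfolding n by (simp add: eval_hom_simps ev_T)
  also have "\<dots> = sV ^ p * tV ^ q"
  proof -
    have "sV ^ p = (sV ^ 5) ^ i * sV ^ j" "tV ^ q = (tV ^ 5) ^ k * tV ^ j"
      by (simp_all only: * power_add power_mult)
    then show ?thesis by (simp only: power_mult_distrib mult_ac)
  qed
  finally show ?thesis .
qed

lemma Phi_mu_sum:
  assumes "finite F" "F \<subseteq> inv_exp"
  shows "(\<Sum>(p, q)\<in>F. emb (Const (c p q)) * mu p q) \<in> locA pz"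
    and "Phi (\<Sum>(p, q)\<in>F. emb (Const (c p q)) * mu p q) = (\<Sum>(p, q)\<in>F. fc (c p q) * (sV ^ p * tV ^ q))"
    and "cf i j (Phi (\<Sum>(p, q)\<in>F. emb (Const (c p q)) * mu p q)) = (if (i, j) \<in> F then c i j else 0)"
proof -
  have A: "(case x of (p, q) \<Rightarrow> emb (Const (c p q)) * mu p q) \<in> locA pz" if "x \<in> F" for x
    using that assms mu_locA emb_Const_in_locA by (cases x) (auto intro!: A_mult)
  show "(\<Sum>(p, q)\<in>F. emb (Const (c p q)) * mu p q) \<in> locA pz" using A by (rule A_sum)
  have "Phi (\<Sum>(p, q)\<in>F. emb (Const (c p q)) * mu p q) = (\<Sum>x\<in>F. Phi (case x of (p, q) \<Rightarrow> emb (Const (c p q)) * mu p q))"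
    using A by (rule Phi_sum)
  also have "\<dots> = (\<Sum>(p, q)\<in>F. fc (c p q) * (sV ^ p * tV ^ q))"
  proof (rule sum.cong[OF refl], clarify)
    fix p q assume "(p, q) \<in> F"
    then have "(p, q) \<in> inv_exp" using assms by blast
    then show "Phi (emb (Const (c p q)) * mu p q) = fc (c p q) * (sV ^ p * tV ^ q)"
      using Phi_mult[OF emb_Const_in_locA mu_locA, of p q "c p q"] Phi_const[of "c p q"] by (simp add: Phi_mu emb_def)
  qed
  finally show P: "Phi (\<Sum>(p, q)\<in>F. emb (Const (c p q)) * mu p q) = (\<Sum>(p, q)\<in>F. fc (c p q) * (sV ^ p * tV ^ q))" .
  have "cf i j (\<Sum>(p, q)\<in>F. fc (c p q) * (sV ^ p * tV ^ q)) = (\<Sum>x\<in>F. if x = (i, j) then c i j else 0)"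
    unfolding cf_sum by (intro sum.cong) (auto simp: cf_st split: if_splits)
  then show "cf i j (Phi (\<Sum>(p, q)\<in>F. emb (Const (c p q)) * mu p q)) = (if (i, j) \<in> F then c i j else 0)"
    unfolding P using assms by simp
qed

section \<open>The completed local ring as a ring of invariants\<close>

definition inv_series :: "complex fps fps set" where
  "inv_series = {F. \<forall>i j. (i, j) \<notin> inv_exp \<longrightarrow> cf i j F = 0}"

lemma Phi_invariant: "x \<in> locA pz \<Longrightarrow> Phi x \<in> inv_series"
  unfolding inv_series_def
proof (intro CollectI allI impI)
  fix i j assume x: "x \<in> locA pz" and ij: "(i, j) \<notin> inv_exp"
  obtain F c where F: "finite F" "F \<subseteq> inv_exp" "x - (\<Sum>(p, q)\<in>F. emb (Const (c p q)) * mu p q) \<in> MP (Suc (i + j))"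
    using approx_by_mu[OF x] by blast
  have "cf i j (Phi (x - (\<Sum>(p, q)\<in>F. emb (Const (c p q)) * mu p q))) = 0"
    using ord_Phi_MP[OF F(3)] by (simp add: ord_ge_def)
  moreover have "cf i j (Phi (\<Sum>(p, q)\<in>F. emb (Const (c p q)) * mu p q)) = 0"
    using Phi_mu_sum(3)[OF F(1,2)] F(2) ij by auto
  ultimately show "cf i j (Phi x) = 0" using Phi_diff[OF x Phi_mu_sum(1)[OF F(1,2)]] by simp
qed

text \<open>
  From \<open>p + q = 5 i + 2 j + 5 k \<le> 12 max (i, j, k)\<close>, one of the exponents is at least \<open>5 n\<close>, and
  \<open>w\<^sup>5 / z\<^sup>3\<close>, \<open>u\<^sub>1\<^sup>5 / z\<^sup>4\<close> and \<open>T\<^sup>5 / z\<^sup>1\<^sup>7\<close> belong to the maximal ideal.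
\<close>

lemma mu_in_MP:
  assumes "(p, q) \<in> inv_exp" "60 * n \<le> p + q"
  shows "mu p q \<in> MP n"
  using assms(1)
proof (rule inv_expE)
  fix i j k assume *: "p = 5 * i + j" "q = 5 * k + j" and num: "num p q = ww ^ i * u1 ^ j * T ^ k"
    and deg: "deg p q = 3 * i + 4 * j + 17 * k"
  define e where "e = deg p q div 5"
  have e: "5 * e = 3 * i + 4 * j + 17 * k" using deg_dvd[OF assms(1)] deg by (simp add: e_def)
  have main: "mu p q \<in> MP n"
    if f: "num p q = f ^ n * g" "homogeneous (5 * d) f" "eval_pol f pz = 0" "homogeneous (5 * (e - n * d)) g" "n * d \<le> e" for f g d
  proof -
    have M: "Fract f (zz ^ d) \<in> locM pz"
      using locA_I[OF f(2) z_nz(2) z_nz(1)] value_at_Fract[OF f(2) z_nz(2) z_nz(1)] f(3) by (simp add: locM_def)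
    have "zz ^ e = (zz ^ d) ^ n * zz ^ (e - n * d)"
      using f(5) by (metis le_add_diff_inverse mult.commute power_add power_mult)
    then have "mu p q = Fract g (zz ^ (e - n * d)) * Fract f (zz ^ d) ^ n"
      unfolding mu_def e_def[symmetric] f(1) using z_nz(3)[of 1]
      by (simp add: Fract_emb emb_hom power_divide mult_ac)
    moreover have "Fract g (zz ^ (e - n * d)) \<in> locA pz" using locA_I[OF f(4) z_nz(2) z_nz(1)] .
    ultimately show ?thesis using MP_mult[OF _ MP_power[OF M]] by simp
  qed
  have "12 * max i (max j k) \<ge> 60 * n" using assms(2) * by linarith
  then consider "5 * n \<le> i" | "5 * n \<le> j" | "5 * n \<le> k" by linarith
  then show ?thesis
  proof cases
    case 1
    then have i: "ww ^ i = (ww ^ 5) ^ n * ww ^ (i - 5 * n)" by (metis le_add_diff_inverse power_add power_mult)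
    show ?thesis
    proof (rule main)
      show "num p q = (ww ^ 5) ^ n * (ww ^ (i - 5 * n) * u1 ^ j * T ^ k)" unfolding num i by (simp add: mult_ac)
      show "homogeneous (5 * 3) (ww ^ 5)" by (rule homogeneous_power[OF homogeneous_vars(4)])
      show "eval_pol (ww ^ 5) pz = 0" by (simp add: eval_pol_simps pz_def)
      show "n * 3 \<le> e" using e 1 by linarith
      have "5 * (e - n * 3) = 3 * (i - 5 * n) + 4 * j + 17 * k" using e 1 by linarith
      then show "homogeneous (5 * (e - n * 3)) (ww ^ (i - 5 * n) * u1 ^ j * T ^ k)"
        using homogeneous_monom_wuTz[of "i - 5 * n" j k 0 1] by (simp add: Const_one)
    qed
  next
    case 2
    then have j: "u1 ^ j = (u1 ^ 5) ^ n * u1 ^ (j - 5 * n)" by (metis le_add_diff_inverse power_add power_mult)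
    show ?thesis
    proof (rule main)
      show "num p q = (u1 ^ 5) ^ n * (ww ^ i * u1 ^ (j - 5 * n) * T ^ k)" unfolding num j by (simp add: mult_ac)
      show "homogeneous (5 * 4) (u1 ^ 5)" by (rule homogeneous_power[OF homogeneous_vars(6)])
      show "eval_pol (u1 ^ 5) pz = 0" by (simp add: eval_pol_simps pz_def)
      show "n * 4 \<le> e" using e 2 by linarith
      have "5 * (e - n * 4) = 3 * i + 4 * (j - 5 * n) + 17 * k" using e 2 by linarith
      then show "homogeneous (5 * (e - n * 4)) (ww ^ i * u1 ^ (j - 5 * n) * T ^ k)"
        using homogeneous_monom_wuTz[of i "j - 5 * n" k 0 1] by (simp add: Const_one)
    qed
  next
    case 3
    then have k: "T ^ k = (T ^ 5) ^ n * T ^ (k - 5 * n)" by (metis le_add_diff_inverse power_add power_mult)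
    show ?thesis
    proof (rule main)
      show "num p q = (T ^ 5) ^ n * (ww ^ i * u1 ^ j * T ^ (k - 5 * n))" unfolding num k by (simp add: mult_ac)
      show "homogeneous (5 * 17) (T ^ 5)" by (rule homogeneous_power[OF homogeneous_T])
      show "eval_pol (T ^ 5) pz = 0" by (simp add: T_def eval_pol_simps pz_def)
      show "n * 17 \<le> e" using e 3 by linarith
      have "5 * (e - n * 17) = 3 * i + 4 * j + 17 * (k - 5 * n)" using e 3 by linarith
      then show "homogeneous (5 * (e - n * 17)) (ww ^ i * u1 ^ j * T ^ (k - 5 * n))"
        using homogeneous_monom_wuTz[of i j "k - 5 * n" 0 1] by (simp add: Const_one)
    qed
  qed
qed

text \<open>
  The order filtration of the power series ring induces the topology of the maximal ideal: in an
  approximation of \<open>x\<close> by the \<open>mu p q\<close>, the terms with \<open>p + q < 60 n\<close> have coefficient \<open>0\<close>, and the others are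
  in \<open>MP n\<close> by \<open>mu_in_MP\<close>.
\<close>

lemma ord_imp_MP:
  assumes x: "x \<in> locA pz" and ord: "ord_ge (60 * n) (Phi x)"
  shows "x \<in> MP n"
proof -
  obtain F c where F: "finite F" "F \<subseteq> inv_exp" "x - (\<Sum>(p, q)\<in>F. emb (Const (c p q)) * mu p q) \<in> MP (60 * n)"
    using approx_by_mu[OF x] by blast
  let ?s = "\<Sum>(p, q)\<in>F. emb (Const (c p q)) * mu p q"
  have s: "?s \<in> locA pz" by (rule Phi_mu_sum(1)[OF F(1,2)])
  have "ord_ge (60 * n) (Phi x - Phi (x - ?s))" by (rule ord_ge_diff[OF ord ord_Phi_MP[OF F(3)]])
  then have o: "ord_ge (60 * n) (Phi ?s)" using Phi_diff[OF x s] by simp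
  have "(case pq of (p, q) \<Rightarrow> emb (Const (c p q)) * mu p q) \<in> MP n" if "pq \<in> F" for pq
  proof (cases pq)
    case (Pair p q)
    show ?thesis
    proof (cases "60 * n \<le> p + q")
      case True
      then have "mu p q \<in> MP n" using that F(2) Pair by (intro mu_in_MP) auto
      then show ?thesis using Pair emb_Const_in_locA by (auto intro: MP_mult)
    next
      case False
      then have "cf p q (Phi ?s) = 0" using o by (simp add: ord_ge_def)
      then have "c p q = 0" using Phi_mu_sum(3)[OF F(1,2)] that Pair by simp
      then show ?thesis using Pair I_MP I_0 by (auto simp: Const_zero)
    qed
  qed
  then have "?s \<in> MP n" by (rule MP_sum)
  moreover have "x - ?s \<in> MP n" using F(3) MP_mono[of n "60 * n"] by auto
  ultimately have "(x - ?s) + ?s \<in> MP n" by (intro MP_add)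
  then show ?thesis by simp
qed

lemma Phi_dense:
  assumes "F \<in> inv_series"
  shows "\<exists>x\<in>locA pz. ord_ge k (F - Phi x)"
proof -
  define S where "S = {(p, q). p + q < k} \<inter> inv_exp"
  have "S \<subseteq> {..k} \<times> {..k}" by (auto simp: S_def)
  then have S: "finite S" "S \<subseteq> inv_exp" by (auto simp: S_def intro: finite_subset)
  have "ord_ge k (F - Phi (\<Sum>(p, q)\<in>S. emb (Const (cf p q F)) * mu p q))"
    unfolding ord_ge_def
  proof (intro allI impI)
    fix i j assume "i + j < k"
    then have "(i, j) \<in> S \<or> cf i j F = 0" using assms by (auto simp: S_def inv_series_def)
    then show "cf i j (F - Phi (\<Sum>(p, q)\<in>S. emb (Const (cf p q F)) * mu p q)) = 0"
      unfolding cf_diff Phi_mu_sum(3)[OF S] by auto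
  qed
  then show ?thesis by (rule bexI) (rule Phi_mu_sum(1)[OF S])
qed

text \<open>
  A series is invariant iff its monomials are, and a primitive \<open>25\<close>-th root of unity detects the invariant
  monomials.
\<close>

lemma invariant_ring: "quotient_plane_ring 25 1 14 = ring_on inv_series"
  unfolding quotient_plane_ring_def
proof (rule arg_cong[of _ _ ring_on], rule equalityI; rule subsetI)
  have cf_diag: "cf i j (diag_subst 1 14 e F) = e ^ (i + 14 * j) * cf i j F" for i j e F
    by (simp add: cf_def diag_subst_def power_add power_mult)
  {
    fix F assume F: "F \<in> {F. \<forall>e. e ^ 25 = 1 \<longrightarrow> diag_subst 1 14 e F = F}"
    define e where "e = cis (2 * pi / 25)"
    have "e ^ 25 = 1" unfolding e_def by (simp add: DeMoivre)
    then have "diag_subst 1 14 e F = F" using F by blast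
    then have *: "e ^ (i + 14 * j) * cf i j F = cf i j F" for i j using cf_diag[of i j e F] by simp
    show "F \<in> inv_series"
      unfolding inv_series_def
    proof (intro CollectI allI impI)
      fix i j assume ij: "(i, j) \<notin> inv_exp"
      have "e ^ (i + 14 * j) \<noteq> 1"
      proof
        assume "e ^ (i + 14 * j) = 1"
        then have "cis (real (i + 14 * j) * (2 * pi / 25)) = 1" by (simp only: e_def DeMoivre)
        then have "cos (real (i + 14 * j) * (2 * pi / 25)) = 1" by (simp add: complex_eq_iff)
        then obtain n :: int where n: "real (i + 14 * j) * (2 * pi / 25) = of_int n * 2 * pi"
          unfolding cos_one_2pi_int by blast
        then have "pi * real (i + 14 * j) = pi * real_of_int (25 * n)" by (simp add: field_simps)
        then have "real (i + 14 * j) = real_of_int (25 * n)" by (metis mult_left_cancel pi_neq_zero)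
        then have "int (i + 14 * j) = 25 * n" by linarith
        then have "25 dvd int (i + 14 * j)" by simp
        then have "25 dvd i + 14 * j" by presburger
        with ij show False by (simp add: inv_exp_def)
      qed
      then show "cf i j F = 0" using *[of i j] by simp
    qed
  next
    fix F assume F: "F \<in> inv_series"
    have "diag_subst 1 14 e F = F" if e: "e ^ 25 = 1" for e
    proof (rule cf_eqI)
      fix i j
      show "cf i j (diag_subst 1 14 e F) = cf i j F"
      proof (cases "(i, j) \<in> inv_exp")
        case True
        then obtain m where "i + 14 * j = 25 * m" by (auto simp: inv_exp_def)
        then have "e ^ (i + 14 * j) = 1" using e by (metis power_mult power_one)
        then show ?thesis unfolding cf_diag by simp
      next
        case False then show ?thesis unfolding cf_diag using F by (simp add: inv_series_def)
      qed
    qed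
    then show "F \<in> {F. \<forall>e. e ^ 25 = 1 \<longrightarrow> diag_subst 1 14 e F = F}" by blast
  }
qed

lemma completed_local_ring:
  "\<exists>h\<in>ring_iso (completion R (proj ` locM pz)) (quotient_plane_ring 25 1 14).
     \<forall>c\<in>carrier R. h (to_completion R (proj ` locM pz) c) = phi c"
  unfolding invariant_ring
proof (rule completion_iso[where W = "\<lambda>i j. (i, j) \<in> inv_exp"])
  show "cring R" by (rule cring_R)
  show "ideal (proj ` locM pz) R" by (rule ideal_M)
  show "phi \<in> Ring.ring_hom R (ring_on UNIV)" by (rule phi_hom)
  show "ord_ge n (phi x)" if "x \<in> ideal_pow R (proj ` locM pz) n" for n x using that by (rule ord_phi_ideal_pow)
  show "\<exists>k. \<forall>x\<in>carrier R. ord_ge k (phi x) \<longrightarrow> x \<in> ideal_pow R (proj ` locM pz) n" for n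
  proof (intro exI[of _ "60 * n"] ballI impI)
    fix x assume "x \<in> carrier R" "ord_ge (60 * n) (phi x)"
    then obtain y where "y \<in> locA pz" "x = proj y" by (auto simp: carrier_R)
    with ord_imp_MP[of y n] \<open>ord_ge (60 * n) (phi x)\<close> show "x \<in> ideal_pow R (proj ` locM pz) n"
      by (auto simp: phi_proj MP_def)
  qed
  show "\<exists>x\<in>carrier R. ord_ge k (F - phi x)" if "F \<in> inv_series" for F k
    using Phi_dense[OF that, of k] by (auto simp: phi_proj intro!: bexI[OF _ proj_in])
  show "inv_series = {F. \<forall>i j. (i, j) \<notin> inv_exp \<longrightarrow> cf i j F = 0}" by (simp add: inv_series_def)
  show "phi x \<in> inv_series" if "x \<in> carrier R" for x
    using that Phi_invariant by (auto simp: carrier_R phi_proj)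
qed

section \<open>The cotangent space at this point\<close>

text \<open>
  The coefficients of \<open>a\<^sup>2\<^sup>5, a\<^sup>1\<^sup>1 b\<close> and \<open>b\<^sup>2\<^sup>5\<close>. These monomials are not products of two nonconstant
  invariant ones, so the coefficients are linear functionals on the cotangent space of the ring of
  invariants (\<open>cot_mult\<close>).
\<close>

definition cot :: "nat \<Rightarrow> complex fps fps \<Rightarrow> complex" where
  "cot k F = (if k = 0 then cf 25 0 F else if k = 1 then cf 11 1 F else cf 0 25 F)"

lemma cot_mult:
  assumes "F \<in> inv_series" "H \<in> inv_series" "cf 0 0 H = 0"
  shows "cot k (F * H) = cf 0 0 F * cot k H"
proof -
  have z: "cf i j F = 0" if "\<not> 25 dvd i + 14 * j" for i j
    using that assms(1) by (simp add: inv_series_def inv_exp_def)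
  have 1: "cf 25 0 (F * H) = cf 0 0 F * cf 25 0 H"
  proof -
    have "cf 25 0 (F * H) = (\<Sum>p\<le>25. cf p 0 F * cf (25 - p) 0 H)" by (simp add: cf_mult)
    also have "\<dots> = (\<Sum>p\<in>{0}. cf p 0 F * cf (25 - p) 0 H)"
    proof (rule sum.mono_neutral_right; (intro ballI)?)
      fix p assume "p \<in> {..25::nat} - {0}"
      then have "p = 25 \<or> \<not> 25 dvd p + 14 * 0" by (auto dest: dvd_imp_le)
      then show "cf p 0 F * cf (25 - p) 0 H = 0" using z[of p 0] assms(3) by auto
    qed auto
    finally show ?thesis by simp
  qed
  have 2: "cf 0 25 (F * H) = cf 0 0 F * cf 0 25 H"
  proof -
    have "cf 0 25 (F * H) = (\<Sum>q\<le>25. cf 0 q F * cf 0 (25 - q) H)" by (simp add: cf_mult)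
    also have "\<dots> = (\<Sum>q\<in>{0}. cf 0 q F * cf 0 (25 - q) H)"
    proof (rule sum.mono_neutral_right; (intro ballI)?)
      fix q assume "q \<in> {..25::nat} - {0}"
      then have q: "0 < q" "q \<le> 25" by auto
      have "q = 25" if "25 dvd 0 + 14 * q"
      proof -
        have "25 dvd 9 * (0 + 14 * q)" using that by (rule dvd_mult)
        also have "9 * (0 + 14 * q) = q + 25 * (5 * q)" by simp
        finally have "25 dvd q" by (subst (asm) dvd_add_left_iff) simp_all
        then show ?thesis using q by (auto dest: dvd_imp_le)
      qed
      then have "q = 25 \<or> \<not> 25 dvd 0 + 14 * q" by blast
      then show "cf 0 q F * cf 0 (25 - q) H = 0" using z[of 0 q] assms(3) by auto
    qed auto
    finally show ?thesis by simp
  qed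
  have 3: "cf 11 1 (F * H) = cf 0 0 F * cf 11 1 H"
  proof -
    have "cf 11 1 (F * H) = (\<Sum>p\<le>11. cf p 0 F * cf (11 - p) 1 H) + (\<Sum>p\<le>11. cf p 1 F * cf (11 - p) 0 H)"
      by (simp add: cf_mult)
    also have "(\<Sum>p\<le>11. cf p 0 F * cf (11 - p) 1 H) = (\<Sum>p\<in>{0}. cf p 0 F * cf (11 - p) 1 H)"
    proof (rule sum.mono_neutral_right; (intro ballI)?)
      fix p assume "p \<in> {..11::nat} - {0}"
      then have "\<not> 25 dvd p + 14 * 0" by (auto dest: dvd_imp_le)
      then show "cf p 0 F * cf (11 - p) 1 H = 0" using z[of p 0] by auto
    qed auto
    also have "(\<Sum>p\<le>11. cf p 1 F * cf (11 - p) 0 H) = 0"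
    proof (rule sum.neutral, rule ballI)
      fix p assume "p \<in> {..11::nat}"
      then have p: "p \<le> 11" by simp
      have "p = 11" if "25 dvd p + 14 * 1"
        using dvd_imp_le[OF that] p by simp
      then have "p = 11 \<or> \<not> 25 dvd p + 14 * 1" by blast
      then show "cf p 1 F * cf (11 - p) 0 H = 0" using z[of p 1] assms(3) by auto
    qed
    finally show ?thesis by simp
  qed
  show ?thesis using 1 2 3 by (simp add: cot_def)
qed

text \<open>
  If the maximal ideal had two generators \<open>f, g\<close>, the vectors of the three coefficients \<open>cot\<close> of its elements
  would lie in the plane spanned by those of \<open>f\<close> and \<open>g\<close>. But three elements give the unit vectors.
\<close>

lemma not_regular: "\<not> regular_local_ring R"
proof
  assume "regular_local_ring R"
  then obtain S where S: "finite S" "S \<subseteq> carrier R" "Idl\<^bsub>R\<^esub> S = proj ` locM pz" "enat (card S) = krull_dim R"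
    unfolding regular_local_ring_def nonunits_R by blast
  interpret cring R by (rule cring_R)
  interpret m: ideal "proj ` locM pz" R by (rule ideal_M)
  have SM: "S \<subseteq> proj ` locM pz" using genideal_self[OF S(2)] S(3) by simp
  have "enat (card S) \<le> 2" using S(4) krull_dim_R by simp
  then have "card S \<le> 2" by (simp add: numeral_eq_enat)
  then have "card S = 0 \<or> card S = 1 \<or> card S = 2" by linarith
  then obtain f g where fg: "S \<subseteq> {f, g}"
    using S(1) by (elim disjE) (auto simp: card_1_singleton_iff card_2_iff)
  define K where "K = {x \<in> proj ` locM pz. \<exists>\<alpha> \<beta>. \<forall>k. cot k (phi x) = \<alpha> * cot k (phi f) + \<beta> * cot k (phi g)}"
  have ph: "phi (x \<oplus>\<^bsub>R\<^esub> y) = phi x + phi y" "phi (x \<otimes>\<^bsub>R\<^esub> y) = phi x * phi y" if "x \<in> carrier R" "y \<in> carrier R" for x y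
    using ring_hom_add[OF phi_hom that] ring_hom_mult[OF phi_hom that] by simp_all
  have inv: "phi x \<in> inv_series" if "x \<in> carrier R" for x
    using that Phi_invariant by (auto simp: carrier_R phi_proj)
  have m0: "cf 0 0 (phi x) = 0" if "x \<in> proj ` locM pz" for x
    using that M_sub by (auto simp: phi_proj cf_Phi locM_def)
  have carr: "x \<in> carrier R" if "x \<in> proj ` locM pz" for x using that by (rule m.Icarr)
  have mult: "r \<otimes>\<^bsub>R\<^esub> x \<in> K" if "r \<in> carrier R" "x \<in> K" for r x
  proof -
    from that obtain \<alpha> \<beta> where x: "x \<in> proj ` locM pz" "\<And>k. cot k (phi x) = \<alpha> * cot k (phi f) + \<beta> * cot k (phi g)"
      by (auto simp: K_def)
    have "cot k (phi (r \<otimes>\<^bsub>R\<^esub> x)) = (cf 0 0 (phi r) * \<alpha>) * cot k (phi f) + (cf 0 0 (phi r) * \<beta>) * cot k (phi g)" for k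
      using ph(2)[OF that(1) carr[OF x(1)]] cot_mult[OF inv[OF that(1)] inv[OF carr[OF x(1)]] m0[OF x(1)]] x(2)
      by (simp add: algebra_simps)
    then show ?thesis using m.I_l_closed[OF x(1) that(1)] by (auto simp: K_def)
  qed
  have "ideal K R"
  proof (rule idealI)
    show "ring R" by (rule ring_axioms)
    show "subgroup K (add_monoid R)"
    proof (rule group.subgroupI)
      show "Group.group (add_monoid R)" by (rule add.is_group)
      show "K \<subseteq> carrier (add_monoid R)" using carr by (auto simp: K_def)
      have zero: "\<zero>\<^bsub>R\<^esub> \<in> proj ` locM pz" by (rule additive_subgroup.zero_closed[OF m.is_additive_subgroup])
      have "phi \<zero>\<^bsub>R\<^esub> = 0" using ph(1)[OF zero_closed zero_closed] by simp
      then have "\<zero>\<^bsub>R\<^esub> \<in> K" using zero by (auto simp: K_def cot_def intro!: exI[of _ 0])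
      then show "K \<noteq> {}" by blast
    next
      fix x assume x: "x \<in> K"
      then have "x \<in> carrier R" using carr by (auto simp: K_def)
      then have "inv\<^bsub>add_monoid R\<^esub> x = (\<ominus>\<^bsub>R\<^esub> \<one>\<^bsub>R\<^esub>) \<otimes>\<^bsub>R\<^esub> x"
        unfolding a_inv_def[symmetric] using l_minus[of "\<one>\<^bsub>R\<^esub>" x] by simp
      then show "inv\<^bsub>add_monoid R\<^esub> x \<in> K" using mult[OF _ x] by simp
    next
      fix x y assume "x \<in> K" "y \<in> K"
      then obtain \<alpha> \<beta> \<alpha>' \<beta>' where xy: "x \<in> proj ` locM pz" "y \<in> proj ` locM pz"
        "\<And>k. cot k (phi x) = \<alpha> * cot k (phi f) + \<beta> * cot k (phi g)"
        "\<And>k. cot k (phi y) = \<alpha>' * cot k (phi f) + \<beta>' * cot k (phi g)"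
        by (auto simp: K_def)
      have "cot k (phi (x \<oplus>\<^bsub>R\<^esub> y)) = (\<alpha> + \<alpha>') * cot k (phi f) + (\<beta> + \<beta>') * cot k (phi g)" for k
      proof -
        have "cot k (phi (x \<oplus>\<^bsub>R\<^esub> y)) = cot k (phi x) + cot k (phi y)"
          using ph(1)[OF carr[OF xy(1)] carr[OF xy(2)]] by (simp add: cot_def)
        then show ?thesis using xy(3,4) by (simp add: algebra_simps)
      qed
      moreover have "x \<oplus>\<^bsub>R\<^esub> y \<in> proj ` locM pz"
        by (rule additive_subgroup.a_closed[OF m.is_additive_subgroup xy(1,2)])
      ultimately show "x \<otimes>\<^bsub>add_monoid R\<^esub> y \<in> K" by (auto simp: K_def)
    qed
  next
    fix x r assume x: "x \<in> K" and r: "r \<in> carrier R"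
    show "r \<otimes>\<^bsub>R\<^esub> x \<in> K" by (rule mult[OF r x])
    moreover have "x \<in> carrier R" using x carr by (auto simp: K_def)
    ultimately show "x \<otimes>\<^bsub>R\<^esub> r \<in> K" using m_comm[OF _ r] by simp
  qed
  moreover have "S \<subseteq> K"
  proof
    fix x assume "x \<in> S"
    then consider "x = f" | "x = g" using fg by blast
    then show "x \<in> K"
    proof cases
      case 1
      have "\<forall>k. cot k (phi f) = 1 * cot k (phi f) + 0 * cot k (phi g)" by simp
      then show ?thesis unfolding 1 K_def using \<open>x \<in> S\<close> SM 1 by blast
    next
      case 2
      have "\<forall>k. cot k (phi g) = 0 * cot k (phi f) + 1 * cot k (phi g)" by simp
      then show ?thesis unfolding 2 K_def using \<open>x \<in> S\<close> SM 2 by blast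
    qed
  qed
  ultimately have MK: "proj ` locM pz \<subseteq> K" using genideal_minimal S(3) by metis
  have ex: "\<exists>\<alpha> \<beta>. \<forall>k. cot k (sV ^ p * tV ^ q) = \<alpha> * cot k (phi f) + \<beta> * cot k (phi g)"
    if pq: "(p, q) \<in> inv_exp" "p + q > 0" for p q
  proof -
    have A: "mu p q \<in> locA pz" by (rule mu_locA[OF pq(1)])
    have "value_at pz (mu p q) = cf 0 0 (sV ^ p * tV ^ q)" using cf_Phi[OF A] Phi_mu[OF pq(1)] by simp
    then have "mu p q \<in> locM pz" using A pq(2) by (auto simp: locM_def cf_st)
    then have "proj (mu p q) \<in> K" using MK by blast
    then show ?thesis using A by (auto simp: K_def phi_proj Phi_mu[OF pq(1)])
  qed
  define U where "U k = cot k (phi f)" for k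
  define V where "V k = cot k (phi g)" for k
  obtain a1 b1 where 1: "\<And>k. cot k (sV ^ 25 * tV ^ 0) = a1 * U k + b1 * V k"
    using ex[of 25 0] by (auto simp: inv_exp_def U_def V_def)
  obtain a2 b2 where 2: "\<And>k. cot k (sV ^ 11 * tV ^ 1) = a2 * U k + b2 * V k"
    using ex[of 11 1] by (auto simp: inv_exp_def U_def V_def)
  obtain a3 b3 where 3: "\<And>k. cot k (sV ^ 0 * tV ^ 25) = a3 * U k + b3 * V k"
    using ex[of 0 25] by (auto simp: inv_exp_def U_def V_def)
  have e: "a1 * U 0 + b1 * V 0 = 1" "a1 * U 1 + b1 * V 1 = 0" "a1 * U 2 + b1 * V 2 = 0"
     "a2 * U 0 + b2 * V 0 = 0" "a2 * U 1 + b2 * V 1 = 1" "a2 * U 2 + b2 * V 2 = 0"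
     "a3 * U 0 + b3 * V 0 = 0" "a3 * U 1 + b3 * V 1 = 0" "a3 * U 2 + b3 * V 2 = 1"
    unfolding 1[symmetric] 2[symmetric] 3[symmetric] cot_def cf_st by simp_all
  let ?X = "\<lambda>a b k. a * U k + b * V k"
  \<comment> \<open>the determinant of three vectors in a plane\<close>
  have "?X a1 b1 0 * (?X a2 b2 1 * ?X a3 b3 2 - ?X a2 b2 2 * ?X a3 b3 1)
      - ?X a1 b1 1 * (?X a2 b2 0 * ?X a3 b3 2 - ?X a2 b2 2 * ?X a3 b3 0)
      + ?X a1 b1 2 * (?X a2 b2 0 * ?X a3 b3 1 - ?X a2 b2 1 * ?X a3 b3 0) = 0"
    by (simp add: algebra_simps)
  then show False unfolding e by simp
qed

end

section \<open>Partial derivatives and smooth points\<close>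

text \<open>
  The derivative of the restriction of \<open>f\<close> to the line through \<open>a\<close> in direction \<open>v\<close>. On this line polynomials
  become univariate, so that Hensel's lemma applies.
\<close>

definition pdiff :: "'v \<Rightarrow> 'v mpol \<Rightarrow> ('v \<Rightarrow> complex) \<Rightarrow> complex" where
  "pdiff v f a = poly (pderiv (eval_hom (\<lambda>c. [:c:]) (\<lambda>w. if w = v then [:0, 1:] else [:a w:]) f)) (a v)"

interpretation pC: coeff_hom "\<lambda>c::complex. [:c:]"
  by (rule poly_hom[OF id_hom.coeff_hom_axioms])

interpretation pfc: coeff_hom "\<lambda>c. [:fc c:]"
  by (rule poly_hom[OF fc_hom.coeff_hom_axioms])

lemma poly_line:
  "poly (eval_hom (\<lambda>c. [:c:]) (\<lambda>w. if w = v then [:0, 1:] else [:a w:]) f) (a v) = eval_pol f a"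
proof -
  have "poly (eval_hom (\<lambda>c. [:c:]) (\<lambda>w. if w = v then [:0, 1:] else [:a w:]) f) (a v) =
     eval_hom (\<lambda>c. c) (\<lambda>w. poly (if w = v then [:0, 1:] else [:a w:]) (a v)) f"
    by (rule eval_hom_compose[OF pC.coeff_hom_axioms id_hom.coeff_hom_axioms]) simp_all
  also have "(\<lambda>w. poly (if w = v then [:0, 1:] else [:a w:]) (a v)) = a" by auto
  finally show ?thesis by (simp add: eval_pol_eq)
qed

lemma pdiff_Const [simp]: "pdiff v (Const c) a = 0"
  and pdiff_Var: "pdiff v (Var w) a = (if w = v then 1 else 0)"
  and pdiff_add: "pdiff v (f + g) a = pdiff v f a + pdiff v g a"
  and pdiff_mult: "pdiff v (f * g) a = pdiff v f a * eval_pol g a + eval_pol f a * pdiff v g a"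
  using poly_line[of v a f] poly_line[of v a g]
  by (simp_all add: pdiff_def pC.eval_hom_simps pderiv_add pderiv_mult pderiv_pCons)

lemma pdiff_power: "pdiff v (f ^ n) a = of_nat n * eval_pol f a ^ (n - 1) * pdiff v f a"
proof (induction n)
  case 0 then show ?case using pdiff_Const[of v 1 a] by (simp add: Const_one)
next
  case (Suc n)
  then show ?case by (cases n) (simp_all add: pdiff_mult eval_pol_simps algebra_simps)
qed

lemma pdiff_sum: "pdiff v (sum f S) a = (\<Sum>x\<in>S. pdiff v (f x) a)"
  using pdiff_Const[of v 0 a]
  by (induction S rule: infinite_finite_induct) (simp_all add: pdiff_add Const_zero)

lemma pdiff_one: "pdiff v 1 a = 0"
  using pdiff_Const[of v 1 a] by (simp add: Const_one)

text \<open>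
  The formal implicit function theorem: over the power series ring, \<open>g\<close> is a univariate polynomial in
  coordinate \<open>v\<close> that has the simple root \<open>q v\<close> modulo the variables.
\<close>

lemma formal_implicit:
  assumes "eval_pol g q = 0" "pdiff v g q \<noteq> 0" "\<And>w. cf 0 0 (e w) = 0"
  obtains Y where "\<And>w. cf 0 0 (Y w) = q w" "\<And>w. w \<noteq> v \<Longrightarrow> Y w = fc (q w) + e w" "eval_hom fc Y g = 0"
proof -
  define F where "F = eval_hom (\<lambda>c. [:fc c:]) (\<lambda>w. if w = v then [:0, 1:] else [:fc (q w) + e w:]) g"
  have "map_poly (cf 0 0) F = eval_hom (\<lambda>c. [:c:]) (\<lambda>w. map_poly (cf 0 0) (if w = v then [:0, 1:] else [:fc (q w) + e w:])) g"
    unfolding F_def by (rule eval_hom_compose[OF pfc.coeff_hom_axioms pC.coeff_hom_axioms])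
      (simp_all add: map_poly_cf_hom map_poly_pCons cf_fc)
  also have "(\<lambda>w. map_poly (cf 0 0) (if w = v then [:0, 1:] else [:fc (q w) + e w:])) = (\<lambda>w. if w = v then [:0, 1:] else [:q w:])"
    using assms(3) by (auto simp: map_poly_pCons cf_fc cf_one)
  finally have F0: "map_poly (cf 0 0) F = eval_hom (\<lambda>c. [:c:]) (\<lambda>w. if w = v then [:0, 1:] else [:q w:]) g" .
  obtain r where r: "cf 0 0 r = q v" "poly F r = 0"
    using fps2_hensel[of F "q v"] assms(1,2) poly_line[of v q g] unfolding F0 pdiff_def by metis
  have "poly F r = eval_hom fc (\<lambda>w. poly (if w = v then [:0, 1:] else [:fc (q w) + e w:]) r) g"
    unfolding F_def by (rule eval_hom_compose[OF pfc.coeff_hom_axioms fc_hom.coeff_hom_axioms]) simp_all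
  also have "(\<lambda>w. poly (if w = v then [:0, 1:] else [:fc (q w) + e w:]) r) = (\<lambda>w. if w = v then r else fc (q w) + e w)"
    by auto
  finally have "eval_hom fc (\<lambda>w. if w = v then r else fc (q w) + e w) g = 0" using r(2) by simp
  then show ?thesis using r(1) assms(3) by (intro that[of "\<lambda>w. if w = v then r else fc (q w) + e w"]) (auto simp: cf_fc)
qed

lemma (in subring_quot) eval_in_A:
  assumes "coeff_hom k" "\<And>c. k c \<in> A" "\<And>v. X v \<in> A"
  shows "eval_hom k X f \<in> A"
  by (induction f rule: mpol_induct)
    (simp_all add: assms A_add A_mult coeff_hom.eval_hom_simps[OF assms(1)]
      coeff_hom.eval_hom_Const[OF assms(1)] coeff_hom.eval_hom_Var[OF assms(1)])

lemma (in subring_quot) eval_cong: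
  assumes k: "coeff_hom k" "\<And>c. k c \<in> A" and X: "\<And>v. X v \<in> A" "\<And>v. Y v \<in> A"
    and J: "0 \<in> J" "\<And>x y. x \<in> J \<Longrightarrow> y \<in> J \<Longrightarrow> x + y \<in> J" "\<And>x y. x \<in> A \<Longrightarrow> y \<in> J \<Longrightarrow> x * y \<in> J"
    and XY: "\<And>v. X v - Y v \<in> J"
  shows "eval_hom k X f - eval_hom k Y f \<in> J"
proof (induction f rule: mpol_induct)
  case (add f g)
  from J(2)[OF this] show ?case by (simp add: coeff_hom.eval_hom_simps[OF k(1)] algebra_simps)
next
  case (mult f g)
  have "eval_hom k X f * (eval_hom k X g - eval_hom k Y g) + eval_hom k Y g * (eval_hom k X f - eval_hom k Y f) \<in> J"
    using mult eval_in_A[OF k X(1)] eval_in_A[OF k X(2)] by (intro J)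
  then show ?case by (simp add: coeff_hom.eval_hom_simps[OF k(1)] algebra_simps)
qed (simp_all add: coeff_hom.eval_hom_Const[OF k(1)] coeff_hom.eval_hom_Var[OF k(1)] XY J)

text \<open>
  The ideal \<open>N\<close> contains the products of any two of the increments \<open>c v\<close>, so that the Taylor expansion
  modulo \<open>N\<close> stops after the linear terms. The induction over \<open>f\<close> uses the product rule.
\<close>

lemma (in subring_quot) eval_taylor:
  fixes a :: "'v::finite \<Rightarrow> complex"
  assumes k: "coeff_hom k" "\<And>c. k c \<in> A" and c: "\<And>v. c v \<in> A"
    and N: "0 \<in> N" "\<And>x y. x \<in> N \<Longrightarrow> y \<in> N \<Longrightarrow> x + y \<in> N" "\<And>x y. x \<in> A \<Longrightarrow> y \<in> N \<Longrightarrow> x * y \<in> N"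
    and cN: "\<And>v w. c v * c w \<in> N"
  shows "eval_hom k (\<lambda>v. k (a v) + c v) f - k (eval_pol f a) - (\<Sum>v\<in>UNIV. k (pdiff v f a) * c v) \<in> N"
proof -
  interpret k: coeff_hom k by (rule k)
  define L where "L f = (\<Sum>v\<in>UNIV. k (pdiff v f a) * c v)" for f
  define e where "e f = eval_hom k (\<lambda>v. k (a v) + c v) f" for f
  have eA: "e f \<in> A" for f unfolding e_def using k c by (intro eval_in_A A_add)
  have LA: "L f \<in> A" for f unfolding L_def using k c by (intro A_sum A_mult)
  have N_sum: "(\<And>x. x \<in> S \<Longrightarrow> h x \<in> N) \<Longrightarrow> sum h S \<in> N" for h and S :: "('v \<times> 'v) set"
    by (induction S rule: infinite_finite_induct) (auto simp: N)
  have LL: "L f * L g \<in> N" for f g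
  proof -
    have "L f * L g = (\<Sum>(v, w)\<in>UNIV \<times> UNIV. (k (pdiff v f a) * k (pdiff w g a)) * (c v * c w))"
      unfolding L_def sum_product by (simp add: sum.cartesian_product mult_ac)
    moreover have "\<dots> \<in> N"
    proof (rule N_sum)
      show "(case x of (v, w) \<Rightarrow> (k (pdiff v f a) * k (pdiff w g a)) * (c v * c w)) \<in> N" for x
        by (cases x) (simp only: prod.case, rule N(3)[OF A_mult[OF k(2) k(2)] cN])
    qed
    ultimately show ?thesis by simp
  qed
  have "e f - k (eval_pol f a) - L f \<in> N"
  proof (induction f rule: mpol_induct)
    case (Const d)
    then show ?case by (simp add: e_def L_def k.h_zero N)
  next
    case (Var w)
    have "L (Var w) = (\<Sum>v\<in>UNIV. if v = w then c v else 0)"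
      unfolding L_def by (intro sum.cong) (auto simp: pdiff_Var k.h_one k.h_zero)
    then show ?case by (simp add: e_def N)
  next
    case (add f g)
    have L: "L (f + g) = L f + L g" by (simp add: L_def pdiff_add k.h_add ring_distribs sum.distrib)
    from N(2)[OF add] show ?case by (simp add: L e_def k.eval_hom_simps eval_pol_simps k.h_add algebra_simps)
  next
    case (mult f g)
    let ?F = "k (eval_pol f a)" and ?G = "k (eval_pol g a)"
    have L: "L (f * g) = L f * ?G + ?F * L g"
      by (simp add: L_def pdiff_mult k.h_add k.h_mult ring_distribs sum.distrib sum_distrib_left sum_distrib_right mult_ac)
    have "e g * (e f - ?F - L f) + ((?F + L f) * (e g - ?G - L g) + L f * L g) \<in> N"
      by (rule N(2)[OF N(3)[OF eA mult(1)] N(2)[OF N(3)[OF A_add[OF k(2) LA] mult(2)] LL]])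
    then show ?case by (simp add: L e_def k.eval_hom_simps eval_pol_simps k.h_mult algebra_simps)
  qed
  then show ?thesis by (simp add: e_def L_def)
qed

section \<open>Affine coordinates at a point\<close>

abbreviation kc :: "complex \<Rightarrow> pol fract" where "kc \<equiv> \<lambda>c. emb (Const c)"

text \<open>
  The quotient \<open>num / den\<close> has degree \<open>1\<close> and value \<open>1\<close> at the point. Dividing each coordinate by its power
  of the same weight gives elements \<open>af v\<close> of the local ring with the value \<open>a v\<close>: affine coordinates on the
  slice \<open>num = den\<close>.
\<close>

locale chart = surface_point \<theta> \<tau> P a for \<theta> \<tau> P a +
  fixes num den :: pol and n :: nat
  assumes num_den: "homogeneous (Suc n) num" "homogeneous n den" "eval_pol num a = eval_pol den a" "eval_pol den a \<noteq> 0"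
begin

definition af :: "coord \<Rightarrow> pol fract" where
  "af v = Fract (Var v * den ^ wt v) (num ^ wt v)"

lemma num_den_nz: "num \<noteq> 0" "den \<noteq> 0"
  using num_den by (auto intro: eval_pol_nz)

lemma homogeneous_num_den: "homogeneous (wt v + wt v * n) (Var v * den ^ wt v)" "homogeneous (wt v + wt v * n) (num ^ wt v)"
  using homogeneous_mult[OF homogeneous_Var homogeneous_power[OF num_den(2)]] homogeneous_power[OF num_den(1), of "wt v"] by simp_all

lemma af_locA: "af v \<in> locA a"
  unfolding af_def using num_den by (intro locA_I[OF homogeneous_num_den]) (simp add: eval_pol_simps)

lemma value_af: "value_at a (af v) = a v"
  unfolding af_def using num_den value_at_Fract[OF homogeneous_num_den(1) homogeneous_num_den(2), of v a] by (simp add: eval_pol_simps)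

lemma af_eq: "af v = (emb den / emb num) ^ wt v * emb (Var v)"
  unfolding af_def using num_den_nz by (simp add: Fract_emb emb_hom power_divide)

lemma eval_af: "homogeneous d f \<Longrightarrow> eval_hom kc af f = Fract (f * den ^ d) (num ^ d)"
proof -
  assume f: "homogeneous d f"
  have "emb f = eval_hom kc (\<lambda>v. emb (Var v)) f"
    using eval_hom_compose[OF Const_hom.coeff_hom_axioms emb_Const.coeff_hom_axioms, of emb Var f]
    by (simp add: emb_hom)
  then have "eval_hom kc af f = (emb den / emb num) ^ d * emb f"
    using emb_Const.eval_hom_scale[OF f, of "emb den / emb num" "\<lambda>v. emb (Var v)"]
    unfolding af_eq[abs_def] by simp
  then show ?thesis using num_den_nz by (simp add: Fract_emb emb_hom power_divide)
qed

lemma homogeneous_num_den': "homogeneous d f \<Longrightarrow> homogeneous (d + d * n) (f * den ^ d)" "homogeneous (d + d * n) (num ^ d)"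
  using homogeneous_mult[OF _ homogeneous_power[OF num_den(2)], of d f d] homogeneous_power[OF num_den(1), of d] by simp_all

lemma eval_af_ideal:
  assumes "homogeneous d f" "f \<in> pol_ideal (relations \<theta> \<tau> P)"
  shows "eval_hom kc af f \<in> locI (relations \<theta> \<tau> P) a"
  unfolding eval_af[OF assms(1)] using num_den homogeneous_num_den'(1)[OF assms(1)] homogeneous_num_den'(2)[of d] assms(2)
  by (intro locI_I) (auto intro: pol_ideal_mult_r simp: eval_pol_simps)

lemma af_minus_locM: "af v - kc (a v) \<in> locM a"
proof -
  have c: "af v - kc (a v) = af v + kc (- a v)" by (simp only: emb_Const.h_uminus diff_conv_add_uminus)
  have kv: "value_at a (kc z) = z" for z using val.Phi_const[of a z] by (simp add: emb_def)
  have "value_at a (af v + kc (- a v)) = 0"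
    using val.Phi_add[OF af_locA emb_Const_in_locA] by (simp add: kv value_af)
  then show ?thesis unfolding c using A_add[OF af_locA emb_Const_in_locA] by (simp add: locM_def)
qed

text \<open>
  Up to a unit, an element of the maximal ideal is its numerator evaluated at the affine coordinates,
  and modulo \<open>J\<close> this is the numerator evaluated at \<open>a\<close>, which is \<open>0\<close>.
\<close>

lemma locM_sub:
  assumes J: "0 \<in> J" "\<And>x y. x \<in> J \<Longrightarrow> y \<in> J \<Longrightarrow> x + y \<in> J" "\<And>x y. x \<in> locA a \<Longrightarrow> y \<in> J \<Longrightarrow> x * y \<in> J"
    and c: "\<And>v. af v - kc (a v) \<in> J"
  shows "locM a \<subseteq> J"
proof
  fix x assume "x \<in> locM a"
  then obtain f g d where 1: "x = Fract f g" "homogeneous d f" "homogeneous d g" "eval_pol g a \<noteq> 0" "g \<noteq> 0" and x: "value_at a x = 0"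
    by (auto simp: locM_def elim: locA_E)
  have f0: "eval_pol f a = 0" using x value_at_Fract[OF 1(2-4)] 1 by simp
  have "eval_hom kc af f - eval_hom kc (\<lambda>v. kc (a v)) f \<in> J"
    by (rule eval_cong[OF emb_Const.coeff_hom_axioms emb_Const_in_locA af_locA emb_Const_in_locA J c])
  moreover have "eval_hom kc (\<lambda>v. kc (a v)) f = kc (eval_pol f a)"
    using eval_hom_compose[OF id_hom.coeff_hom_axioms emb_Const.coeff_hom_axioms, of kc a f]
    by (simp add: emb_Const.h_add emb_Const.h_mult eval_pol_eq)
  ultimately have "Fract (f * den ^ d) (num ^ d) \<in> J" using f0 by (simp add: eval_af[OF 1(2)] Const_zero)
  moreover have "Fract (num ^ d) (g * den ^ d) \<in> locA a"
    using homogeneous_num_den'(1)[OF 1(3)] homogeneous_num_den'(2)[of d] num_den 1(4) by (intro locA_I) (auto simp: eval_pol_simps)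
  ultimately have "Fract (num ^ d) (g * den ^ d) * Fract (f * den ^ d) (num ^ d) \<in> J" by (rule J(3)[rotated])
  moreover have "Fract (num ^ d) (g * den ^ d) * Fract (f * den ^ d) (num ^ d) = x"
    unfolding 1(1) using num_den_nz 1(5) by (simp add: eq_fract)
  ultimately show "x \<in> J" by simp
qed

lemma af_relations:
  shows "af cx0 * af cy - af cx1 ^ 3 \<in> locI (relations \<theta> \<tau> P) a"
    "af cx0 * af cw - af cx1 ^ 2 * af cy \<in> locI (relations \<theta> \<tau> P) a"
    "af cx1 * af cw - af cy ^ 2 \<in> locI (relations \<theta> \<tau> P) a"
    "af cx0 * af cu1 - af cx1 * af cu0 \<in> locI (relations \<theta> \<tau> P) a"
    "af cx1 * af cy * af cu1 - af cw * af cu0 \<in> locI (relations \<theta> \<tau> P) a"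
    "af cx0 * af ct - af cu0 ^ 2 \<in> locI (relations \<theta> \<tau> P) a"
    "af cy * af cu1 ^ 2 - af cw * af ct \<in> locI (relations \<theta> \<tau> P) a"
    "af cx0 * eval_hom kc af P + af cx1 ^ 2 * (kc \<theta> * af cu1 * af cz + kc \<tau> * af cw ^ 3) + af cu0 * af ct \<in> locI (relations \<theta> \<tau> P) a"
    "af cy * eval_hom kc af P + af cw * (kc \<theta> * af cu1 * af cz + kc \<tau> * af cw ^ 3) + af cu1 ^ 3 \<in> locI (relations \<theta> \<tau> P) a"
proof -
  note hom = homogeneous_mult homogeneous_power homogeneous_vars P homogeneous_Qpol
  have "homogeneous (1 + 2) (x0 * yy)" "homogeneous (3 * 1) (x1 ^ 3)" "homogeneous (1 + 3) (x0 * ww)"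
    "homogeneous (2 * 1 + 2) (x1 ^ 2 * yy)" "homogeneous (1 + 3) (x1 * ww)" "homogeneous (2 * 2) (yy ^ 2)"
    "homogeneous (1 + 4) (x0 * u1)" "homogeneous (1 + 4) (x1 * u0)" "homogeneous (1 + 2 + 4) (x1 * yy * u1)"
    "homogeneous (3 + 4) (ww * u0)" "homogeneous (1 + 7) (x0 * tt)" "homogeneous (2 * 4) (u0 ^ 2)"
    "homogeneous (2 + 2 * 4) (yy * u1 ^ 2)" "homogeneous (3 + 7) (ww * tt)"
    "homogeneous (1 + 10) (x0 * P)" "homogeneous (2 * 1 + 9) (x1 ^ 2 * Qpol \<theta> \<tau>)" "homogeneous (4 + 7) (u0 * tt)"
    "homogeneous (2 + 10) (yy * P)" "homogeneous (3 + 9) (ww * Qpol \<theta> \<tau>)" "homogeneous (3 * 4) (u1 ^ 3)"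
    by (intro hom)+
  then have "homogeneous 3 (x0 * yy - x1 ^ 3)" "homogeneous 4 (x0 * ww - x1 ^ 2 * yy)" "homogeneous 4 (x1 * ww - yy ^ 2)"
    "homogeneous 5 (x0 * u1 - x1 * u0)" "homogeneous 7 (x1 * yy * u1 - ww * u0)" "homogeneous 8 (x0 * tt - u0 ^ 2)"
    "homogeneous 10 (yy * u1 ^ 2 - ww * tt)" "homogeneous 11 (x0 * P + x1 ^ 2 * Qpol \<theta> \<tau> + u0 * tt)"
    "homogeneous 12 (yy * P + ww * Qpol \<theta> \<tau> + u1 ^ 3)"
    by (auto intro!: homogeneous_diff homogeneous_add simp del: One_nat_def add_2_eq_Suc add_2_eq_Suc')
  note e = this[THEN eval_af_ideal]
  show "af cx0 * af cy - af cx1 ^ 3 \<in> locI (relations \<theta> \<tau> P) a"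
    "af cx0 * af cw - af cx1 ^ 2 * af cy \<in> locI (relations \<theta> \<tau> P) a"
    "af cx1 * af cw - af cy ^ 2 \<in> locI (relations \<theta> \<tau> P) a"
    "af cx0 * af cu1 - af cx1 * af cu0 \<in> locI (relations \<theta> \<tau> P) a"
    "af cx1 * af cy * af cu1 - af cw * af cu0 \<in> locI (relations \<theta> \<tau> P) a"
    "af cx0 * af ct - af cu0 ^ 2 \<in> locI (relations \<theta> \<tau> P) a"
    "af cy * af cu1 ^ 2 - af cw * af ct \<in> locI (relations \<theta> \<tau> P) a"
    "af cx0 * eval_hom kc af P + af cx1 ^ 2 * (kc \<theta> * af cu1 * af cz + kc \<tau> * af cw ^ 3) + af cu0 * af ct \<in> locI (relations \<theta> \<tau> P) a"
    "af cy * eval_hom kc af P + af cw * (kc \<theta> * af cu1 * af cz + kc \<tau> * af cw ^ 3) + af cu1 ^ 3 \<in> locI (relations \<theta> \<tau> P) a"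
    using e(1)[OF rel1] e(2)[OF rel2] e(3)[OF rel3] e(4)[OF rel4] e(5)[OF rel6] e(6)[OF rel7] e(7)[OF rel10]
      e(8)[OF rel11] e(9)[OF rel13]
    by (simp_all only: emb_Const.eval_hom_simps emb_Const.eval_hom_Var emb_Const.eval_hom_Const Qpol_def)
qed

end

text \<open>
  The images of \<open>r1\<close> and \<open>r2\<close> show that the dimension is at least two, hence exactly two, and \<open>r1, r2\<close> generate the
  maximal ideal.
\<close>

lemma (in formal_surface_point) regular_criterion:
  assumes M: "r1 \<in> locM a" "r2 \<in> locM a"
    and gen: "\<And>J. r1 \<in> J \<Longrightarrow> r2 \<in> J \<Longrightarrow> locI (relations \<theta> \<tau> P) a \<subseteq> J \<Longrightarrow>
       (\<And>x y. x \<in> J \<Longrightarrow> y \<in> J \<Longrightarrow> x + y \<in> J) \<Longrightarrow> (\<And>x y. x \<in> locA a \<Longrightarrow> y \<in> J \<Longrightarrow> x * y \<in> J) \<Longrightarrow> locM a \<subseteq> J"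
    and f: "Phi r1 \<noteq> 0" "fps_nth (Phi r1) 0 = 0" and g: "fps_nth (Phi r2) 0 \<noteq> 0"
  shows "regular_local_ring R"
proof -
  have A: "r1 \<in> locA a" "r2 \<in> locA a" using M M_sub by auto
  have "2 \<le> krull_dim R"
  proof (rule krull_dim_ge_2[OF phi_hom])
    show "proj r1 \<in> carrier R" "proj r2 \<in> carrier R" using A by (simp_all add: proj_in)
    show "phi (proj r1) \<noteq> 0" "fps_nth (phi (proj r1)) 0 = 0" "fps_nth (phi (proj r2)) 0 \<noteq> 0"
      using A f g by (simp_all add: phi_proj)
    show "cf 0 0 (phi (proj r2)) = 0" using A M by (simp add: phi_proj cf_Phi locM_def)
  qed
  then have dim: "krull_dim R = 2" using krull_dim_R by (rule antisym[rotated])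
  have ne: "proj r1 \<noteq> proj r2" using A f g by (metis phi_proj)
  have "Idl\<^bsub>R\<^esub> (proj ` {r1, r2}) = proj ` locM a"
  proof (rule generated_by_proj)
    show "{r1, r2} \<subseteq> locA a" "locM a \<subseteq> locA a" "{r1, r2} \<subseteq> locM a" using A M M_sub by auto
    show "ideal (proj ` locM a) R" by (rule ideal_M)
    fix J assume "{r1, r2} \<subseteq> J" "locI (relations \<theta> \<tau> P) a \<subseteq> J" "\<And>x y. x \<in> J \<Longrightarrow> y \<in> J \<Longrightarrow> x + y \<in> J"
      "\<And>x y. x \<in> locA a \<Longrightarrow> y \<in> J \<Longrightarrow> x * y \<in> J"
    then show "locM a \<subseteq> J" by (intro gen) auto
  qed
  moreover have "card (proj ` {r1, r2}) = 2" using ne by simp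
  moreover have "proj ` {r1, r2} \<subseteq> carrier R" using A by (simp add: proj_in)
  ultimately show ?thesis
    unfolding regular_local_ring_def nonunits_R dim
    by (intro exI[of _ "proj ` {r1, r2}"]) (simp add: numeral_eq_enat)
qed

section \<open>The chart where the first coordinate is nonzero\<close>

text \<open>
  The equation \<open>l P + a\<^sup>2 Q + b\<^sup>3\<close> for \<open>l = 1\<close>. There \<open>x\<^sub>1 = a\<close> and \<open>u\<^sub>0 = b\<close>, so the variables are called \<open>x\<^sub>1, u\<^sub>0, z\<close>.
\<close>

definition affine_eq :: "complex \<Rightarrow> complex \<Rightarrow> pol \<Rightarrow> pol" where
  "affine_eq \<theta> \<tau> P = eval_hom Const (toric 1 x1 u0 zz) P +
     x1 ^ 2 * (Const \<theta> * (x1 * u0) * zz + Const \<tau> * x1 ^ 15) + u0 ^ 3"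

lemma (in coeff_hom) eval_subst:
  "eval_hom h X (eval_hom Const Y f) = eval_hom h (\<lambda>v. eval_hom h X (Y v)) f"
  by (rule eval_hom_compose[OF Const_hom.coeff_hom_axioms coeff_hom_axioms])
    (simp_all add: eval_hom_add eval_hom_mult)

lemma (in coeff_hom) eval_toric:
  "(\<lambda>v. eval_hom h X (toric l a b z v)) = toric (eval_hom h X l) (eval_hom h X a) (eval_hom h X b) (eval_hom h X z)"
  by (rule toric_hom) (simp_all add: eval_hom_mult)

lemma (in coeff_hom) eval_affine_eq:
  "eval_hom h X (affine_eq \<theta> \<tau> P) = eval_hom h (toric 1 (X cx1) (X cu0) (X cz)) P +
     X cx1 ^ 2 * (h \<theta> * (X cx1 * X cu0) * X cz + h \<tau> * X cx1 ^ 15) + X cu0 ^ 3"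
  by (simp add: affine_eq_def eval_hom_simps eval_subst eval_toric)

lemma toric_const: "(\<lambda>v. cf 0 0 (toric l a b z v)) = toric (cf 0 0 l) (cf 0 0 a) (cf 0 0 b) (cf 0 0 z)"
  by (rule toric_hom) (simp_all add: cf_one)

lemma cf_st_0: "cf 0 0 sV = 0" "cf 0 0 tV = 0"
  using cf_st[of 0 0 1 0] cf_st[of 0 0 0 1] by simp_all

lemma formal_surface_pointI:
  assumes "surface_point \<theta> \<tau> P a" "\<And>v. cf 0 0 (X v) = a v"
    "\<And>f. f \<in> relations \<theta> \<tau> P \<Longrightarrow> eval_hom fc X f = 0"
  shows "formal_surface_point \<theta> \<tau> P a X"
  by (intro formal_surface_point.intro formal_surface_point_axioms.intro assms formal_pointI)

lemma affine_point:
  assumes "surface_point \<theta> \<tau> P a" "a cx0 = 1"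
  shows "a = toric 1 (a cx1) (a cu0) (a cz)" "eval_pol (affine_eq \<theta> \<tau> P) a = 0"
proof -
  interpret surface_point \<theta> \<tau> P a by fact
  have "\<forall>f\<in>relations \<theta> \<tau> P. eval_hom (\<lambda>c. c) a f = 0" using vanish by (simp add: eval_pol_eq)
  note r = this[unfolded id_hom.eval_relations Let_def assms(2)]
  have y: "a cy = a cx1 ^ 3" and u1: "a cu1 = a cx1 * a cu0" and t: "a ct = a cu0 ^ 2" using r by simp_all
  have w: "a cw = a cx1 ^ 5" using r by (simp add: y eval_nat_numeral)
  show a: "a = toric 1 (a cx1) (a cu0) (a cz)"
  proof
    show "a v = toric 1 (a cx1) (a cu0) (a cz) v" for v by (cases v) (simp_all add: assms(2) y w u1 t mult_ac)
  qed
  have A: "eval_hom (\<lambda>c. c) a P + a cx1 ^ 2 * (\<theta> * a cu1 * a cz + \<tau> * a cw ^ 3) + a cu0 * a ct = 0"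
  proof -
    from r have "1 * eval_hom (\<lambda>c. c) a P + a cx1 ^ 2 * (\<theta> * a cu1 * a cz + \<tau> * a cw ^ 3) + a cu0 * a ct = 0"
      by blast
    then show ?thesis by (simp only: mult_1_left)
  qed
  show "eval_pol (affine_eq \<theta> \<tau> P) a = 0"
    unfolding eval_pol_eq id_hom.eval_affine_eq a[symmetric]
    using A unfolding w u1 t by (simp add: power3_eq_cube power2_eq_square mult.assoc flip: power_mult)
qed

lemma (in local_quot) M_minus_unit:
  assumes "x \<in> A" "x \<notin> M" "m \<in> M" "z \<in> A" "(x - m) * z \<in> J" "\<And>x y. x \<in> A \<Longrightarrow> y \<in> J \<Longrightarrow> x * y \<in> J"
  shows "z \<in> J"
proof -
  have "x - m \<notin> M" using M_add[of "x - m" m] assms by auto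
  then obtain s where s: "s \<in> A" "(x - m) * s = 1" using A_unit[of "x - m"] A_diff assms M_sub by blast
  have "s * ((x - m) * z) \<in> J" using assms s by blast
  then show ?thesis using s by (simp add: mult_ac) (metis mult.assoc mult.commute mult_1_left)
qed

text \<open>
  The generators of the maximal ideal are the two affine coordinates \<open>v1, v2\<close> other than \<open>v0\<close>. The implicit
  function theorem gives a power series point on which they are independent variables. An ideal \<open>J\<close> that
  contains their increments contains that of \<open>v0\<close> as well: by Taylor expansion of the equation, the increment
  times the sum of a nonzero constant and an element of the maximal ideal lies in \<open>J\<close>.
\<close>

theorem regular_affine_chart:
  assumes sp: "surface_point \<theta> \<tau> P a" and a0: "a cx0 = 1"
    and v0: "v0 \<in> {cx1, cu0, cz}" "pdiff v0 (affine_eq \<theta> \<tau> P) a \<noteq> 0"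
  shows "regular_local_ring (local_ring (relations \<theta> \<tau> P) (orbit a))"
proof -
  obtain v1 v2 where v12: "{v0, v1, v2} = {cx1, cu0, cz}" "v0 \<noteq> v1" "v0 \<noteq> v2" "v1 \<noteq> v2"
  proof -
    from v0(1) consider "v0 = cx1" | "v0 = cu0" | "v0 = cz" by auto
    then show ?thesis
      by cases (use that[of cu0 cz] that[of cx1 cz] that[of cx1 cu0] in auto)
  qed
  note pt = affine_point[OF sp a0]
  define e where "e w = (if w = v1 then tV else if w = v2 then sV else 0)" for w
  have e0: "cf 0 0 (e w) = 0" for w by (simp add: e_def cf_st_0)
  obtain Y where Y: "\<And>w. cf 0 0 (Y w) = a w" "\<And>w. w \<noteq> v0 \<Longrightarrow> Y w = fc (a w) + e w"
    "eval_hom fc Y (affine_eq \<theta> \<tau> P) = 0"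
    by (rule formal_implicit[where e = e, OF pt(2) v0(2) e0]) blast
  define X where "X = toric 1 (Y cx1) (Y cu0) (Y cz)"
  have X3: "X v = Y v" if "v \<in> {cx1, cu0, cz}" for v using that by (auto simp: X_def)
  have Xa: "cf 0 0 (X v) = a v" for v
  proof -
    have "(\<lambda>v. cf 0 0 (X v)) = toric 1 (a cx1) (a cu0) (a cz)" unfolding X_def toric_const by (simp add: Y cf_one)
    then show ?thesis using pt(1) by metis
  qed
  have XE: "eval_hom fc X f = 0" if "f \<in> relations \<theta> \<tau> P" for f
    unfolding X_def
  proof (rule fc_hom.toric_relations[OF _ that])
    show "1 * eval_hom fc (toric 1 (Y cx1) (Y cu0) (Y cz)) P + Y cx1 ^ 2 * (fc \<theta> * (Y cx1 * Y cu0) * Y cz + fc \<tau> * Y cx1 ^ 15) + Y cu0 ^ 3 = 0"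
      using Y(3) by (simp add: fc_hom.eval_affine_eq)
  qed
  interpret formal_surface_point \<theta> \<tau> P a X by (rule formal_surface_pointI[OF sp Xa XE])
  interpret chart \<theta> \<tau> P a "Var cx0" 1 0
    by standard (use homogeneous_Var[of cx0] a0 in simp_all)
  have af0: "af cx0 = 1" using num_den_nz by (simp add: af_def One_fract_def eq_fract)
  have Phi_af: "Phi (af v) = X v" for v
    using Phi_Fract[OF homogeneous_num_den, of v] a0
    by (simp add: af_def fc_hom.eval_hom_simps eval_pol_simps X_def)
  have Phi_c: "Phi (af v - kc (a v)) = X v - fc (a v)" for v
    using Phi_diff[OF af_locA emb_Const_in_locA] Phi_af Phi_const[of "a v"] by (simp add: emb_def)
  have vv: "v1 \<in> {cx1, cu0, cz}" "v2 \<in> {cx1, cu0, cz}" using v12 by auto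
  have P1: "Phi (af v1 - kc (a v1)) = tV" and P2: "Phi (af v2 - kc (a v2)) = sV"
    unfolding Phi_c X3[OF vv(1)] X3[OF vv(2)] using Y(2)[of v1] Y(2)[of v2] v12 by (auto simp: e_def)
  have "regular_local_ring R"
  proof (rule regular_criterion[OF af_minus_locM af_minus_locM])
    show "Phi (af v1 - kc (a v1)) \<noteq> 0" "fps_nth (Phi (af v1 - kc (a v1))) 0 = 0" "fps_nth (Phi (af v2 - kc (a v2))) 0 \<noteq> 0"
      unfolding P1 P2 by (simp_all add: tV_def sV_def)
  next
    fix J assume J12: "af v1 - kc (a v1) \<in> J" "af v2 - kc (a v2) \<in> J" and IJ: "locI (relations \<theta> \<tau> P) a \<subseteq> J"
      and Jadd: "\<And>x y. x \<in> J \<Longrightarrow> y \<in> J \<Longrightarrow> x + y \<in> J"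
      and Jmult: "\<And>x y. x \<in> locA a \<Longrightarrow> y \<in> J \<Longrightarrow> x * y \<in> J"
    have J0: "0 \<in> J" using IJ I_0 by auto
    have Jdiff: "x - y \<in> J" if "x \<in> J" "y \<in> J" for x y
      using Jadd[of x "(- 1) * y"] Jmult[of "- 1" y] that A_uminus[OF A_1] by simp
    define t where "t = toric 1 (af cx1) (af cu0) (af cz)"
    note rel = af_relations[unfolded af0]
    have tI: "af v - t v \<in> locI (relations \<theta> \<tau> P) a" for v
    proof (cases v)
      case cw
      have "(1 * af cw - af cx1 ^ 2 * af cy) + af cx1 ^ 2 * (1 * af cy - af cx1 ^ 3) \<in> locI (relations \<theta> \<tau> P) a"
        by (intro I_add I_mult A_power af_locA rel(1,2))
      then show ?thesis using cw by (simp add: t_def algebra_simps eval_nat_numeral)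
    qed (use rel(1,4,6) I_0 in \<open>simp_all add: t_def af0 mult_ac\<close>)
    have tA: "t v \<in> locA a" for v
      using A_diff[OF af_locA[of v], of "af v - t v"] tI[of v] I_sub by auto
    \<comment> \<open>the equation has only the variables of the chart, so the other coordinates are kept constant\<close>
    define r where "r v = (if v \<in> {cx1, cu0, cz} then af v else kc (a v))" for v
    define c where "c v = (if v \<in> {cx1, cu0, cz} then af v - kc (a v) else 0)" for v
    have rA: "r v \<in> locA a" for v by (simp add: r_def af_locA emb_Const_in_locA)
    have cM: "c v \<in> locM a" for v using af_minus_locM M_0 by (simp add: c_def)
    have cA: "c v \<in> locA a" for v using cM M_sub by auto
    \<comment> \<open>the equation of the chart holds in the local ring\<close>
    let ?g = "x0 * P + x1 ^ 2 * (Const \<theta> * u1 * zz + Const \<tau> * ww ^ 3) + u0 * tt"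
    have "eval_hom kc af ?g \<in> locI (relations \<theta> \<tau> P) a"
      using rel(8) by (simp add: emb_Const.eval_hom_simps af0)
    moreover have "eval_hom kc af ?g - eval_hom kc t ?g \<in> locI (relations \<theta> \<tau> P) a"
      by (rule eval_cong[OF emb_Const.coeff_hom_axioms emb_Const_in_locA af_locA tA I_0 I_add I_mult tI])
    ultimately have "eval_hom kc af ?g - (eval_hom kc af ?g - eval_hom kc t ?g) \<in> locI (relations \<theta> \<tau> P) a" by (rule I_diff)
    moreover have "eval_hom kc t ?g = eval_hom kc r (affine_eq \<theta> \<tau> P)"
      unfolding emb_Const.eval_affine_eq
      by (simp add: emb_Const.eval_hom_simps t_def r_def power3_eq_cube power2_eq_square flip: power_mult)
    ultimately have gI: "eval_hom kc r (affine_eq \<theta> \<tau> P) \<in> J" using IJ by auto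
    \<comment> \<open>\<open>N\<close> contains all products of two increments: of these only \<open>(c v0)\<^sup>2\<close> need not be in \<open>J\<close>\<close>
    define N where "N = {j + m * c v0 | j m. j \<in> J \<and> m \<in> locM a}"
    have NI: "j + m * c v0 \<in> N" if "j \<in> J" "m \<in> locM a" for j m using that by (auto simp: N_def)
    have JN: "j \<in> N" if "j \<in> J" for j using NI[OF that M_0] by simp
    have N_add: "x + y \<in> N" if "x \<in> N" "y \<in> N" for x y
    proof -
      from that obtain j m j' m' where "x = j + m * c v0" "y = j' + m' * c v0" "j \<in> J" "j' \<in> J" "m \<in> locM a" "m' \<in> locM a"
        by (auto simp: N_def)
      then show ?thesis using NI[of "j + j'" "m + m'"] Jadd M_add by (simp add: algebra_simps)
    qed
    have N_mult: "x * y \<in> N" if "x \<in> locA a" "y \<in> N" for x y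
    proof -
      from that obtain j m where y: "y = j + m * c v0" and jm: "j \<in> J" "m \<in> locM a" by (auto simp: N_def)
      have "x * j + (x * m) * c v0 \<in> N" by (rule NI[OF Jmult[OF that(1) jm(1)] M_mult[OF that(1) jm(2)]])
      then show ?thesis unfolding y by (simp only: distrib_left mult.assoc)
    qed
    have cJ: "c v \<in> J" if "v \<noteq> v0" for v
    proof (cases "v \<in> {cx1, cu0, cz}")
      case True
      then have "v = v1 \<or> v = v2" using v12 that by blast
      then show ?thesis using True J12 by (auto simp: c_def)
    qed (use J0 in \<open>simp add: c_def\<close>)
    have cc: "c v * c w \<in> N" for v w
    proof (cases "v = v0")
      case True
      show ?thesis
      proof (cases "w = v0")
        case True then show ?thesis using \<open>v = v0\<close> NI[OF J0 cM] by simp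
      next
        case False then show ?thesis using JN[OF Jmult[OF cA cJ]] by simp
      qed
    next
      case False then show ?thesis using JN[OF Jmult[OF cA cJ], of v w] by (simp add: mult.commute)
    qed
    have "eval_hom kc (\<lambda>v. kc (a v) + c v) (affine_eq \<theta> \<tau> P) - kc (eval_pol (affine_eq \<theta> \<tau> P) a)
        - (\<Sum>v\<in>UNIV. kc (pdiff v (affine_eq \<theta> \<tau> P) a) * c v) \<in> N"
      by (rule eval_taylor[OF emb_Const.coeff_hom_axioms emb_Const_in_locA cA JN[OF J0] N_add N_mult cc])
    moreover have "(\<lambda>v. kc (a v) + c v) = r" by (auto simp: c_def r_def)
    ultimately have "eval_hom kc r (affine_eq \<theta> \<tau> P) - (\<Sum>v\<in>UNIV. kc (pdiff v (affine_eq \<theta> \<tau> P) a) * c v) \<in> N"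
      by (simp add: pt(2) Const_zero)
    then obtain j m where jm: "j \<in> J" "m \<in> locM a"
      "eval_hom kc r (affine_eq \<theta> \<tau> P) - (\<Sum>v\<in>UNIV. kc (pdiff v (affine_eq \<theta> \<tau> P) a) * c v) = j + m * c v0"
      by (auto simp: N_def)
    have sum: "(\<Sum>v\<in>UNIV. kc (pdiff v (affine_eq \<theta> \<tau> P) a) * c v) =
        kc (pdiff v0 (affine_eq \<theta> \<tau> P) a) * c v0 + (\<Sum>v\<in>UNIV - {v0}. kc (pdiff v (affine_eq \<theta> \<tau> P) a) * c v)"
      by (rule sum.remove) auto
    have J_sum: "(\<And>x. x \<in> S \<Longrightarrow> h x \<in> J) \<Longrightarrow> sum h S \<in> J" for h and S :: "coord set"
      by (induction S rule: infinite_finite_induct) (auto simp: J0 Jadd)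
    have "(\<Sum>v\<in>UNIV - {v0}. kc (pdiff v (affine_eq \<theta> \<tau> P) a) * c v) \<in> J"
      by (intro J_sum Jmult emb_Const_in_locA cJ) auto
    then have "eval_hom kc r (affine_eq \<theta> \<tau> P) - j - (\<Sum>v\<in>UNIV - {v0}. kc (pdiff v (affine_eq \<theta> \<tau> P) a) * c v) \<in> J"
      using gI jm(1) by (intro Jdiff)
    moreover have "eval_hom kc r (affine_eq \<theta> \<tau> P) - j - (\<Sum>v\<in>UNIV - {v0}. kc (pdiff v (affine_eq \<theta> \<tau> P) a) * c v)
       = (kc (pdiff v0 (affine_eq \<theta> \<tau> P) a) - (- m)) * c v0"
      using jm(3) unfolding sum by (simp add: algebra_simps)
    ultimately have mem: "(kc (pdiff v0 (affine_eq \<theta> \<tau> P) a) - (- m)) * c v0 \<in> J" by simp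
    have kM: "kc (pdiff v0 (affine_eq \<theta> \<tau> P) a) \<notin> locM a"
      using v0(2) val.Phi_const[of a] by (simp add: locM_def emb_def)
    have "c v0 \<in> J"
      by (rule M_minus_unit[OF emb_Const_in_locA kM M_uminus[OF jm(2)] cA mem Jmult])
    then have cJ': "c v \<in> J" for v using cJ[of v] by (cases "v = v0") auto
    show "locM a \<subseteq> J"
    proof (rule locM_sub[OF J0 Jadd Jmult])
      fix v
      have "eval_hom kc r (toric 1 x1 u0 zz v) - eval_hom kc (\<lambda>v. kc (a v)) (toric 1 x1 u0 zz v) \<in> J"
      proof (rule eval_cong[OF emb_Const.coeff_hom_axioms emb_Const_in_locA rA emb_Const_in_locA J0 Jadd Jmult])
        show "r v - kc (a v) \<in> J" for v using cJ'[of v] J0 by (auto simp: r_def c_def)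
      qed
      moreover have "eval_hom kc r (toric 1 x1 u0 zz v) = t v"
        using fun_cong[OF emb_Const.eval_toric[of r 1 x1 u0 zz], of v]
        by (simp add: t_def r_def emb_Const.eval_hom_one emb_Const.h_one)
      moreover have "eval_hom kc (\<lambda>v. kc (a v)) (toric 1 x1 u0 zz v) = kc (a v)"
      proof -
        have "eval_hom kc (\<lambda>v. kc (a v)) (toric 1 x1 u0 zz v) = toric 1 (kc (a cx1)) (kc (a cu0)) (kc (a cz)) v"
          using fun_cong[OF emb_Const.eval_toric[of "\<lambda>v. kc (a v)" 1 x1 u0 zz], of v] by simp
        also have "\<dots> = kc (toric 1 (a cx1) (a cu0) (a cz) v)"
          using fun_cong[OF toric_hom[of kc 1 "a cx1" "a cu0" "a cz"], of v] by (simp add: emb_Const.h_mult Const_one)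
        finally show ?thesis using pt(1) by metis
      qed
      ultimately have "t v - kc (a v) \<in> J" by simp
      moreover have "af v - t v \<in> J" using tI IJ by auto
      ultimately have "(af v - t v) + (t v - kc (a v)) \<in> J" by (intro Jadd)
      then show "af v - kc (a v) \<in> J" by simp
    qed
  qed
  then show ?thesis by (simp add: local_ring_orbit)
qed

section \<open>The curve where the first coordinate vanishes\<close>

text \<open>
  The equation \<open>l P + a\<^sup>2 Q + b\<^sup>3\<close> for a fixed value \<open>\<alpha>\<close> of \<open>a\<close>, that is, for a fixed value of \<open>w = a\<^sup>5\<close>. The
  variables \<open>l, b, z\<close> are called \<open>x\<^sub>0, u\<^sub>1, z\<close>.
\<close>

definition curve_eq :: "complex \<Rightarrow> complex \<Rightarrow> pol \<Rightarrow> complex \<Rightarrow> pol" where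
  "curve_eq \<theta> \<tau> P \<alpha> = x0 * eval_hom Const (toric x0 (Const \<alpha>) u1 zz) P +
     Const \<alpha> ^ 2 * (Const \<theta> * (Const \<alpha> * u1) * zz + Const \<tau> * Const \<alpha> ^ 15) + u1 ^ 3"

lemma complex_fifth_root: "\<exists>\<alpha>::complex. \<alpha> ^ 5 = \<omega>"
proof (intro exI)
  show "rcis (root 5 (cmod \<omega>)) (Arg \<omega> / 5) ^ 5 = \<omega>"
    by (simp add: DeMoivre2 rcis_cmod_Arg real_root_pow_pos2)
qed

lemma curve_point:
  assumes "surface_point \<theta> \<tau> P a" "a cx0 = 0"
  shows "a cx1 = 0" "a cy = 0" "a cu0 = 0" "a ct = 0"
    "a cw * (\<theta> * a cu1 * a cz + \<tau> * a cw ^ 3) + a cu1 ^ 3 = 0"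
proof -
  interpret surface_point \<theta> \<tau> P a by fact
  have "\<forall>f\<in>relations \<theta> \<tau> P. eval_hom (\<lambda>c. c) a f = 0" using vanish by (simp add: eval_pol_eq)
  note r = this[unfolded id_hom.eval_relations Let_def assms(2)]
  show x: "a cx1 = 0" and "a cu0 = 0" using r by simp_all
  then show "a cy = 0" using r by simp
  then show "a ct = 0" "a cw * (\<theta> * a cu1 * a cz + \<tau> * a cw ^ 3) + a cu1 ^ 3 = 0" using r x \<open>a cu0 = 0\<close> by simp_all
qed

text \<open>
  Where \<open>w \<noteq> 0\<close>, the relations express \<open>x\<^sub>0, x\<^sub>1, u\<^sub>0, t\<close> as multiples of \<open>y\<close>, so the maximal ideal is generated by \<open>y\<close> and
  one coordinate along the curve \<open>y = 0\<close>. In the slice \<open>w = u\<^sub>1\<close> this curve is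
  \<open>\<theta> z + \<tau> w\<^sup>2 + w = 0\<close>: for \<open>\<theta> \<noteq> 0\<close> the coordinate \<open>w\<close> determines \<open>z\<close>; for \<open>\<theta> = 0\<close> the value of \<open>w\<close> is fixed and \<open>z\<close> is free.
  The power series point is constructed in the slice where \<open>a\<close> is constant, with \<open>t\<close> for \<open>l\<close>.
\<close>

theorem regular_on_curve:
  assumes sp: "surface_point \<theta> \<tau> P a" and a0: "a cx0 = 0" and \<omega>: "a cw = a cu1" "a cw \<noteq> 0"
  shows "regular_local_ring (local_ring (relations \<theta> \<tau> P) (orbit a))"
proof -
  define \<omega> where "\<omega> = a cw"
  define \<gamma> where "\<gamma> = a cz"
  note pt = curve_point[OF sp a0]
  have w: "a cw = \<omega>" "a cu1 = \<omega>" "\<omega> \<noteq> 0" using \<omega> by (auto simp: \<omega>_def)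
  have "\<omega> ^ 2 * (\<theta> * \<gamma> + \<tau> * \<omega> ^ 2 + \<omega>) = 0"
    using pt(5) unfolding w \<gamma>_def[symmetric] by (simp add: algebra_simps eval_nat_numeral)
  then have eq: "\<theta> * \<gamma> + \<tau> * \<omega> ^ 2 + \<omega> = 0" using w by simp
  obtain \<alpha> where \<alpha>: "\<alpha> ^ 5 = \<omega>" using complex_fifth_root by blast
  have \<alpha>0: "\<alpha> \<noteq> 0" using \<alpha> w by auto
  define \<beta> where "\<beta> = \<omega> / \<alpha>"
  have \<beta>: "\<alpha> * \<beta> = \<omega>" "\<beta> \<noteq> 0" using \<alpha>0 w by (auto simp: \<beta>_def)
  define q where "q v = (if v = cu1 then \<beta> else if v = cz then \<gamma> else 0)" for v
  have toric_q: "toric 0 \<alpha> \<beta> \<gamma> v = a v" for v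
    by (cases v) (simp_all add: pt a0 w \<alpha> \<beta> \<gamma>_def)
  have q_eq: "eval_pol (curve_eq \<theta> \<tau> P \<alpha>) q = \<alpha> ^ 2 * (\<theta> * \<omega> * \<gamma> + \<tau> * \<alpha> ^ 15) + \<beta> ^ 3"
    by (simp add: curve_eq_def eval_pol_simps q_def \<beta>(1)[symmetric] mult_ac)
  have "\<alpha> ^ 3 * (\<alpha> ^ 2 * (\<theta> * \<omega> * \<gamma> + \<tau> * \<alpha> ^ 15) + \<beta> ^ 3) =
      \<alpha> ^ 5 * (\<theta> * \<omega> * \<gamma> + \<tau> * (\<alpha> ^ 5) ^ 3) + (\<alpha> * \<beta>) ^ 3"
    by (simp add: algebra_simps eval_nat_numeral)
  also have "\<dots> = \<omega> ^ 2 * (\<theta> * \<gamma> + \<tau> * \<omega> ^ 2 + \<omega>)"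
    unfolding \<alpha> \<beta>(1) by (simp add: algebra_simps eval_nat_numeral)
  finally have q0: "eval_pol (curve_eq \<theta> \<tau> P \<alpha>) q = 0" unfolding q_eq eq using \<alpha>0 by simp
  have dz: "pdiff cz (curve_eq \<theta> \<tau> P \<alpha>) q = \<alpha> ^ 2 * \<theta> * \<omega>"
    unfolding curve_eq_def
    by (simp add: pdiff_add pdiff_mult pdiff_power pdiff_Var eval_pol_simps q_def \<beta>(1)[symmetric] mult_ac)
  have db: "pdiff cu1 (curve_eq \<theta> \<tau> P \<alpha>) q = \<alpha> ^ 3 * \<theta> * \<gamma> + 3 * \<beta> ^ 2"
    unfolding curve_eq_def
    by (simp add: pdiff_add pdiff_mult pdiff_power pdiff_Var eval_pol_simps q_def power3_eq_cube power2_eq_square mult_ac)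
  \<comment> \<open>\<open>v0\<close> is solved for, \<open>v1\<close> varies on the formal curve, and \<open>v2\<close> is the second generator\<close>
  define v0 where "v0 = (if \<theta> = 0 then cu1 else cz)"
  define v1 where "v1 = (if \<theta> = 0 then cz else cu1)"
  define v2 where "v2 = (if \<theta> = 0 then cz else cw)"
  define e where "e w = (if w = cx0 then tV else if w = v1 then sV else 0)" for w
  have e0: "cf 0 0 (e w) = 0" for w by (simp add: e_def cf_st_0)
  have d0: "pdiff v0 (curve_eq \<theta> \<tau> P \<alpha>) q \<noteq> 0"
    using dz db \<alpha>0 \<beta>(2) w(3) by (cases "\<theta> = 0") (simp_all add: v0_def)
  obtain Y where Y: "\<And>w. cf 0 0 (Y w) = q w" "\<And>w. w \<noteq> v0 \<Longrightarrow> Y w = fc (q w) + e w"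
    "eval_hom fc Y (curve_eq \<theta> \<tau> P \<alpha>) = 0"
    by (rule formal_implicit[where e = e, OF q0 d0 e0]) blast
  define l where "l = Y cx0"
  define b where "b = Y cu1"
  define z where "z = Y cz"
  have l: "l = tV" using Y(2)[of cx0] fc_hom.h_zero by (simp add: l_def v0_def q_def e_def)
  have Yeq: "l * eval_hom fc (toric l (fc \<alpha>) b z) P + fc \<alpha> ^ 2 * (fc \<theta> * (fc \<alpha> * b) * z + fc \<tau> * fc \<alpha> ^ 15) + b ^ 3 = 0"
    using Y(3) by (simp add: curve_eq_def fc_hom.eval_hom_simps fc_hom.eval_subst fc_hom.eval_toric l_def b_def z_def)
  define X where "X = toric l (fc \<alpha>) b z"
  have Xa: "cf 0 0 (X v) = a v" for v
  proof -
    have "(\<lambda>v. cf 0 0 (X v)) = toric 0 \<alpha> \<beta> \<gamma>"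
      unfolding X_def toric_const using Y(1)[of cu1] Y(1)[of cz] cf_st_0
      by (simp add: l cf_fc b_def z_def q_def)
    then show ?thesis using toric_q by metis
  qed
  interpret formal_surface_point \<theta> \<tau> P a X
    by (rule formal_surface_pointI[OF sp Xa]) (simp only: X_def, rule fc_hom.toric_relations[OF Yeq])
  interpret chart \<theta> \<tau> P a "Var cu1" "Var cw" 3
    by standard (use homogeneous_Var[of cu1] homogeneous_Var[of cw] w in simp_all)
  have u1w: "af cu1 = af cw"
    using num_den_nz unfolding af_eq by (simp add: field_simps eval_nat_numeral)
  have Phi_af: "Phi (af v) * (fc \<alpha> * b) ^ wt v = X v * (fc \<alpha> ^ 5) ^ wt v" for v
    using Phi_Fract[OF homogeneous_num_den, of v] w
    by (simp add: af_def fc_hom.eval_hom_simps eval_pol_simps) (simp add: X_def)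
  have Phi_c: "Phi (af v - kc (a v)) = Phi (af v) - fc (a v)" for v
    using Phi_diff[OF af_locA emb_Const_in_locA] Phi_const[of "a v"] by (simp add: emb_def)
  \<comment> \<open>the restriction of a power series to the curve \<open>t = 0\<close>\<close>
  define n0 where "n0 F = fps_nth F 0" for F :: "complex fps fps"
  have n0: "n0 (F * G) = n0 F * n0 G" "n0 (F + G) = n0 F + n0 G" "n0 (F - G) = n0 F - n0 G" "n0 0 = 0" for F G
    by (simp_all add: n0_def)
  have n0p: "n0 (F ^ k) = n0 F ^ k" for F k
    by (induction k) (simp_all add: n0_def)
  have n0fc: "n0 (fc c) = fps_const c" and n0t: "n0 tV = 0" and n0s: "n0 sV = fps_X" for c
    by (simp_all add: n0_def fc_def tV_def sV_def)
  have b0: "fps_nth (n0 b) 0 = \<beta>" using Y(1)[of cu1] by (simp add: b_def n0_def cf_def q_def)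
  then have b0nz: "n0 b \<noteq> 0" using \<beta> by auto
  have fca: "fc \<alpha> \<noteq> 0" using fc_hom.h_unit[OF \<alpha>0] by auto
  have r1: "Phi (af cy - kc (a cy)) = Phi (af cy)" unfolding pt by (simp add: emb_Const.h_zero)
  have ey: "Phi (af cy) * (fc \<alpha> * b) ^ 2 = fc \<alpha> ^ 3 * tV * (fc \<alpha> ^ 5) ^ 2"
    using Phi_af[of cy] by (simp add: X_def l)
  have f1: "Phi (af cy) \<noteq> 0"
  proof
    assume "Phi (af cy) = 0"
    then have "fc \<alpha> ^ 3 * tV * (fc \<alpha> ^ 5) ^ 2 = 0" using ey by simp
    then show False using fca by (simp add: tV_def)
  qed
  have f2: "n0 (Phi (af cy)) = 0"
    using arg_cong[OF ey, of n0] b0nz \<alpha>0 by (simp add: n0 n0p n0fc n0t)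
  have f3: "n0 (Phi (af v2 - kc (a v2))) \<noteq> 0"
  proof
    assume "n0 (Phi (af v2 - kc (a v2))) = 0"
    then have z: "n0 (Phi (af v2)) = fps_const (a v2)" unfolding Phi_c n0 n0fc by simp
    show False
    proof (cases "\<theta> = 0")
      case False
      have "n0 b = fps_const \<beta> + fps_X"
        using Y(2)[of cu1] False by (simp add: b_def v0_def v1_def e_def q_def n0 n0fc n0s)
      moreover have "Phi (af cw) * (fc \<alpha> * b) ^ 3 = fc \<alpha> ^ 5 * (fc \<alpha> ^ 5) ^ 3"
        using Phi_af[of cw] by (simp add: X_def)
      from arg_cong[OF this, of n0] have "fps_const \<omega> * (fps_const \<alpha> * n0 b) ^ 3 = fps_const \<alpha> ^ 5 * (fps_const \<alpha> ^ 5) ^ 3"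
        using z False w by (simp add: n0 n0p n0fc v2_def)
      ultimately have "fps_const \<omega> * (fps_const \<alpha> * (fps_const \<beta> + fps_X)) ^ 3 = fps_const (\<alpha> ^ 5 * (\<alpha> ^ 5) ^ 3)"
        by (simp add: fps_const_power)
      from arg_cong[OF this, of "\<lambda>F. fps_nth F 1"] have "\<omega> * \<alpha> ^ 3 * (3 * \<beta> ^ 2) = 0"
        by (simp add: power3_eq_cube power2_eq_square algebra_simps)
      then show False using w \<alpha>0 \<beta> by simp
    next
      case True
      have z0: "n0 z = fps_const \<gamma> + fps_X"
        using Y(2)[of cz] True by (simp add: z_def v0_def v1_def e_def q_def n0 n0fc n0s)
      have "Phi (af cz) * (fc \<alpha> * b) ^ 5 = z * (fc \<alpha> ^ 5) ^ 5"
        using Phi_af[of cz] by (simp add: X_def)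
      from arg_cong[OF this, of n0] have A: "fps_const \<gamma> * (fps_const \<alpha> * n0 b) ^ 5 = (fps_const \<gamma> + fps_X) * (fps_const \<alpha> ^ 5) ^ 5"
        using z True by (simp add: n0 n0p n0fc v2_def \<gamma>_def[symmetric] z0)
      have "n0 b ^ 3 = fps_const (- (\<alpha> ^ 2 * (\<tau> * \<alpha> ^ 15)))"
        using arg_cong[OF Yeq, of n0] True
        by (simp add: n0 n0p n0fc n0t l fc_hom.h_zero fps_const_power eq_neg_iff_add_eq_0 add.commute
            flip: fps_const_neg fps_const_mult fps_const_power)
      from arg_cong[OF this, of "\<lambda>F. fps_nth F 1"] have "3 * \<beta> ^ 2 * fps_nth (n0 b) 1 = 0"
        using b0 by (simp add: power3_eq_cube power2_eq_square algebra_simps)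
      then have "fps_nth (n0 b) 1 = 0" using \<beta> by simp
      then have "\<alpha> ^ 25 = 0"
        using arg_cong[OF A, of "\<lambda>F. fps_nth F 1"] by (simp add: eval_nat_numeral)
      then show False using \<alpha>0 by simp
    qed
  qed
  have "regular_local_ring R"
  proof (rule regular_criterion[OF af_minus_locM af_minus_locM])
    show "Phi (af cy - kc (a cy)) \<noteq> 0" "fps_nth (Phi (af cy - kc (a cy))) 0 = 0"
      "fps_nth (Phi (af v2 - kc (a v2))) 0 \<noteq> 0"
      using f1 f2 f3 unfolding r1 n0_def by auto
  next
    fix J assume J12: "af cy - kc (a cy) \<in> J" "af v2 - kc (a v2) \<in> J" and IJ: "locI (relations \<theta> \<tau> P) a \<subseteq> J"
      and Jadd: "\<And>x y. x \<in> J \<Longrightarrow> y \<in> J \<Longrightarrow> x + y \<in> J"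
      and Jmult: "\<And>x y. x \<in> locA a \<Longrightarrow> y \<in> J \<Longrightarrow> x * y \<in> J"
    have J0: "0 \<in> J" using IJ I_0 by auto
    have Jdiff: "x - y \<in> J" if "x \<in> J" "y \<in> J" for x y
      using Jadd[of x "(- 1) * y"] Jmult[of "- 1" y] that A_uminus[OF A_1] by simp
    define W where "W = af cw"
    have WA: "W \<in> locA a" by (simp add: W_def af_locA)
    have "W \<notin> locM a" using value_af[of cw] w by (simp add: locM_def W_def)
    have cancel: "x \<in> J" if "x \<in> locA a" "W * x \<in> J" for x
      by (rule M_minus_unit[OF WA \<open>W \<notin> locM a\<close> M_0 that(1) _ Jmult]) (use that in simp)
    note rel = af_relations[unfolded u1w, folded W_def, THEN subsetD[OF IJ]]
    have k0: "kc 0 = 0" by (rule emb_Const.h_zero)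
    have y: "af cy \<in> J" using J12(1) by (simp add: pt k0)
    have swap: "g \<in> J" if "f - g \<in> J" "f \<in> J" for f g
      using Jdiff[OF that(2,1)] by simp
    have swap': "f \<in> J" if "f - g \<in> J" "g \<in> J" for f g
      using Jadd[OF that] by simp
    have yA: "x * af cy \<in> J" if "x \<in> locA a" for x by (rule Jmult[OF that y])
    have x1': "af cx1 \<in> J"
    proof (rule cancel[OF af_locA])
      have "af cx1 * W \<in> J" by (rule swap'[OF rel(3)]) (simp add: power2_eq_square yA af_locA)
      then show "W * af cx1 \<in> J" by (simp add: mult.commute)
    qed
    have x0': "af cx0 \<in> J"
    proof (rule cancel[OF af_locA])
      have "af cx0 * W \<in> J" by (rule swap'[OF rel(2)]) (simp add: yA af_locA A_power)
      then show "W * af cx0 \<in> J" by (simp add: mult.commute)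
    qed
    have u0': "af cu0 \<in> J"
    proof (rule cancel[OF af_locA])
      show "W * af cu0 \<in> J"
        by (rule swap[OF rel(5)]) (use yA[OF A_mult[OF af_locA[of cx1] WA]] in \<open>simp add: mult_ac\<close>)
    qed
    have t': "af ct \<in> J"
    proof (rule cancel[OF af_locA])
      show "W * af ct \<in> J"
        by (rule swap[OF rel(7)]) (use yA[OF A_power[OF WA]] in \<open>simp add: mult.commute\<close>)
    qed
    have pA: "eval_hom kc af P \<in> locA a"
      by (rule eval_in_A[OF emb_Const.coeff_hom_axioms emb_Const_in_locA af_locA])
    \<comment> \<open>\<open>w\<^sup>2\<close> times this is the relation \<open>y P + w Q + u\<^sub>1\<^sup>3\<close> modulo \<open>y\<close>\<close>
    define E where "E = kc \<theta> * af cz + kc \<tau> * W ^ 2 + W"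
    have EA: "E \<in> locA a" unfolding E_def by (intro A_add A_mult A_power emb_Const_in_locA af_locA WA)
    have "W * (W * E) \<in> J"
    proof -
      have "(af cy * eval_hom kc af P + W * (kc \<theta> * W * af cz + kc \<tau> * W ^ 3) + W ^ 3) - eval_hom kc af P * af cy \<in> J"
        by (rule Jdiff[OF rel(9) yA[OF pA]])
      then show ?thesis by (simp add: E_def algebra_simps eval_nat_numeral)
    qed
    then have EJ: "E \<in> J" using cancel EA WA A_mult by blast
    have kinv: "x \<in> J" if "kc d * x \<in> J" "d \<noteq> 0" for d x
    proof -
      have "kc (inverse d) * (kc d * x) \<in> J" by (rule Jmult[OF emb_Const_in_locA that(1)])
      moreover have "kc (inverse d) * (kc d * x) = (kc d * kc (inverse d)) * x" by (simp only: mult_ac)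
      ultimately show ?thesis using emb_Const.h_unit[OF that(2)] by simp
    qed
    have keq: "kc \<theta> * kc \<gamma> + kc \<tau> * kc \<omega> ^ 2 + kc \<omega> = 0"
    proof -
      have "kc (\<theta> * \<gamma> + \<tau> * \<omega> ^ 2 + \<omega>) = 0" unfolding eq by (rule k0)
      then show ?thesis by (simp only: emb_Const.h_add emb_Const.h_mult emb_Const.h_power)
    qed
    have wz: "W - kc \<omega> \<in> J \<and> af cz - kc \<gamma> \<in> J"
    proof (cases "\<theta> = 0")
      case False
      then have D: "W - kc \<omega> \<in> J" using J12(2) w by (simp add: v2_def W_def)
      have "E - (kc \<tau> * (W + kc \<omega>) + 1) * (W - kc \<omega>) \<in> J"
        by (intro Jdiff EJ Jmult D A_add A_mult emb_Const_in_locA WA A_1)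
      moreover have "E - (kc \<tau> * (W + kc \<omega>) + 1) * (W - kc \<omega>) =
          kc \<theta> * (af cz - kc \<gamma>) + (kc \<theta> * kc \<gamma> + kc \<tau> * kc \<omega> ^ 2 + kc \<omega>)"
        by (simp add: E_def algebra_simps power2_eq_square)
      ultimately have "kc \<theta> * (af cz - kc \<gamma>) \<in> J" unfolding keq by simp
      then show ?thesis using kinv False D by blast
    next
      case True
      have "W * (kc \<tau> * W + 1) \<in> J" using EJ True by (simp add: E_def k0 algebra_simps power2_eq_square)
      then have "kc \<tau> * W + 1 \<in> J" using cancel WA A_1 A_add A_mult emb_Const_in_locA by metis
      moreover have "\<omega> * (\<tau> * \<omega> + 1) = 0" using eq True by (simp add: algebra_simps power2_eq_square)
      then have t1: "\<tau> * \<omega> + 1 = 0" using w by simp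
      then have "kc (\<tau> * \<omega> + 1) = 0" using k0 by simp
      then have "kc \<tau> * kc \<omega> + 1 = 0" by (simp only: emb_Const.h_add emb_Const.h_mult emb_Const.h_one)
      then have "kc \<tau> * W + 1 = kc \<tau> * (W - kc \<omega>)"
        by (simp add: right_diff_distrib eq_neg_iff_add_eq_0[symmetric])
      ultimately have "kc \<tau> * (W - kc \<omega>) \<in> J" by simp
      moreover have "\<tau> \<noteq> 0" using t1 by auto
      ultimately have "W - kc \<omega> \<in> J" by (rule kinv)
      then show ?thesis using J12(2) True by (simp add: v2_def \<gamma>_def)
    qed
    show "locM a \<subseteq> J"
    proof (rule locM_sub[OF J0 Jadd Jmult])
      show "af v - kc (a v) \<in> J" for v
        using x0' x1' y u0' t' wz by (cases v) (simp_all add: a0 pt k0 w u1w \<gamma>_def W_def)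
    qed
  qed
  then show ?thesis by (simp add: local_ring_orbit)
qed

section \<open>Elimination by counting monomials\<close>

text \<open>
  Polynomial functions in the variables \<open>U\<close> whose degree in each variable is at most \<open>N\<close>: the exponent
  vectors form a box, which is easy to count.
\<close>

definition box :: "'i set \<Rightarrow> nat \<Rightarrow> ('i \<Rightarrow> nat) set" where "box U N = (\<Pi>\<^sub>E i\<in>U. {..N})"

definition pmon :: "'i set \<Rightarrow> ('i \<Rightarrow> complex) \<Rightarrow> ('i \<Rightarrow> nat) \<Rightarrow> complex" where
  "pmon U q e = (\<Prod>i\<in>U. q i ^ e i)"

definition boxfun :: "'i set \<Rightarrow> nat \<Rightarrow> (('i \<Rightarrow> complex) \<Rightarrow> complex) \<Rightarrow> bool" where
  "boxfun U N F \<longleftrightarrow> (\<exists>c. \<forall>q. F q = (\<Sum>e\<in>box U N. c e * pmon U q e))"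

lemma finite_box: "finite U \<Longrightarrow> finite (box U N)"
  by (simp add: box_def finite_PiE)

lemma card_box: "finite U \<Longrightarrow> card (box U N) = (N + 1) ^ card U"
  by (simp add: box_def card_PiE)

context
  fixes U :: "'i set"
  assumes U: "finite U"
begin

lemma boxfun_pmon:
  assumes "\<And>i. i \<in> U \<Longrightarrow> e i \<le> N"
  shows "boxfun U N (\<lambda>q. c * pmon U q e)"
  unfolding boxfun_def
proof (intro exI allI)
  fix q
  let ?e = "restrict e U"
  have "(\<Sum>f\<in>box U N. (if f = ?e then c else 0) * pmon U q f) = (\<Sum>f\<in>box U N. if f = ?e then c * pmon U q ?e else 0)"
    by (intro sum.cong) auto
  also have "\<dots> = c * pmon U q ?e"
    using assms finite_box[OF U] by (simp add: box_def)
  also have "pmon U q ?e = pmon U q e" by (simp add: pmon_def)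
  finally show "c * pmon U q e = (\<Sum>f\<in>box U N. (if f = ?e then c else 0) * pmon U q f)" by (rule sym)
qed

lemma boxfun_add: "boxfun U N F \<Longrightarrow> boxfun U N G \<Longrightarrow> boxfun U N (\<lambda>q. F q + G q)"
proof -
  assume "boxfun U N F" "boxfun U N G"
  then obtain c d where "\<forall>q. F q = (\<Sum>e\<in>box U N. c e * pmon U q e)" "\<forall>q. G q = (\<Sum>e\<in>box U N. d e * pmon U q e)"
    by (auto simp: boxfun_def)
  then show ?thesis unfolding boxfun_def
    by (intro exI[of _ "\<lambda>e. c e + d e"]) (simp add: sum.distrib ring_distribs)
qed

lemma boxfun_sum: "finite S \<Longrightarrow> (\<And>x. x \<in> S \<Longrightarrow> boxfun U N (F x)) \<Longrightarrow> boxfun U N (\<lambda>q. \<Sum>x\<in>S. F x q)"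
proof (induction S rule: finite_induct)
  case empty
  show ?case using boxfun_pmon[of "\<lambda>_. 0" N 0] by simp
next
  case (insert x S)
  then show ?case by (simp add: boxfun_add)
qed

lemma boxfun_mult:
  assumes "boxfun U N F" "boxfun U M G"
  shows "boxfun U (N + M) (\<lambda>q. F q * G q)"
proof -
  obtain c d where cd: "\<And>q. F q = (\<Sum>e\<in>box U N. c e * pmon U q e)" "\<And>q. G q = (\<Sum>e\<in>box U M. d e * pmon U q e)"
    using assms by (auto simp: boxfun_def)
  have "boxfun U (N + M) (\<lambda>q. \<Sum>e\<in>box U N. \<Sum>f\<in>box U M. (c e * d f) * pmon U q (\<lambda>i. e i + f i))"
    using finite_box[OF U] by (intro boxfun_sum boxfun_pmon) (auto simp: box_def PiE_iff intro!: add_mono)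
  moreover have "(\<lambda>q. F q * G q) = (\<lambda>q. \<Sum>e\<in>box U N. \<Sum>f\<in>box U M. (c e * d f) * pmon U q (\<lambda>i. e i + f i))"
    unfolding cd sum_product by (simp add: pmon_def power_add prod.distrib mult_ac)
  ultimately show ?thesis by simp
qed

lemma boxfun_mono: "boxfun U N F \<Longrightarrow> N \<le> M \<Longrightarrow> boxfun U M F"
  using boxfun_mult[of N F "M - N" "\<lambda>_. 1"] boxfun_pmon[of "\<lambda>_. 0" "M - N" 1] by (simp add: pmon_def)

lemma boxfun_power: "boxfun U N F \<Longrightarrow> boxfun U (n * N) (\<lambda>q. F q ^ n)"
proof (induction n)
  case 0 show ?case using boxfun_pmon[of "\<lambda>_. 0" 0 1] by (simp add: pmon_def)
next
  case (Suc n) then show ?case using boxfun_mult[of N F "n * N" "\<lambda>q. F q ^ n"] by simp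
qed

lemma boxfun_prod:
  assumes "finite S" "\<And>x. x \<in> S \<Longrightarrow> boxfun U (N x) (F x)"
  shows "boxfun U (\<Sum>x\<in>S. N x) (\<lambda>q. \<Prod>x\<in>S. F x q)"
  using assms
proof (induction S rule: finite_induct)
  case empty show ?case using boxfun_pmon[of "\<lambda>_. 0" 0 1] by (simp add: pmon_def)
next
  case (insert x S)
  then show ?case using boxfun_mult[of "N x" "F x" "sum N S" "\<lambda>q. \<Prod>x\<in>S. F x q"] by simp
qed

end

inductive polyfun :: "'i set \<Rightarrow> (('i \<Rightarrow> complex) \<Rightarrow> complex) \<Rightarrow> bool" for U where
  const: "polyfun U (\<lambda>_. c)"
| var: "i \<in> U \<Longrightarrow> polyfun U (\<lambda>q. q i)"
| add: "polyfun U F \<Longrightarrow> polyfun U G \<Longrightarrow> polyfun U (\<lambda>q. F q + G q)"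
| mult: "polyfun U F \<Longrightarrow> polyfun U G \<Longrightarrow> polyfun U (\<lambda>q. F q * G q)"

lemma polyfun_boxfun:
  assumes U: "finite U" and F: "polyfun U F"
  shows "\<exists>N. boxfun U N F"
  using F
proof induction
  case (const c)
  then show ?case using boxfun_pmon[OF U, of "\<lambda>_. 0" 0 c] by (auto simp: pmon_def)
next
  case (var i)
  have "pmon U q (\<lambda>j. if j = i then 1 else 0) = q i" for q
  proof -
    have "pmon U q (\<lambda>j. if j = i then 1 else 0) = (\<Prod>j\<in>U. if j = i then q i else 1)"
      unfolding pmon_def by (intro prod.cong) auto
    then show ?thesis using var U by simp
  qed
  moreover have "boxfun U 1 (\<lambda>q. 1 * pmon U q (\<lambda>j. if j = i then 1 else 0))"
    by (rule boxfun_pmon[OF U]) simp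
  ultimately show ?case by auto
next
  case (add F G)
  then obtain N M where "boxfun U N F" "boxfun U M G" by blast
  then have "boxfun U (max N M) F" "boxfun U (max N M) G" by (auto intro: boxfun_mono[OF U])
  then show ?case using boxfun_add[OF U] by blast
next
  case (mult F G) then show ?case using boxfun_mult[OF U] by blast
qed

lemma polyfun_sum: "finite S \<Longrightarrow> (\<And>x. x \<in> S \<Longrightarrow> polyfun U (F x)) \<Longrightarrow> polyfun U (\<lambda>q. \<Sum>x\<in>S. F x q)"
  by (induction S rule: finite_induct) (auto intro: polyfun.intros)

lemma polyfun_uminus: "polyfun U F \<Longrightarrow> polyfun U (\<lambda>q. - F q)"
  using polyfun.mult[OF polyfun.const[of U "- 1"], of F] by simp

lemma polyfun_eval: "(\<And>v. polyfun U (\<lambda>q. X q v)) \<Longrightarrow> polyfun U (\<lambda>q. eval_pol f (X q))"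
  by (induction f rule: mpol_induct) (auto simp: eval_pol_simps intro: polyfun.intros)

lemma polyfun_pdiff: "(\<And>v. polyfun U (\<lambda>q. X q v)) \<Longrightarrow> polyfun U (\<lambda>q. pdiff v f (X q))"
proof (induction f rule: mpol_induct)
  case (mult f g)
  then show ?case using polyfun_eval[of U X] by (auto simp: pdiff_mult intro!: polyfun.add polyfun.mult)
qed (auto simp: pdiff_add pdiff_Var intro: polyfun.intros)

lemma pmon_sum_nonzero:
  assumes "finite V" "e0 \<in> box V n" "x e0 \<noteq> 0"
  shows "\<exists>p. (\<Sum>e\<in>box V n. x e * pmon V p e) \<noteq> 0"
  using assms
proof (induction V arbitrary: x e0)
  case empty
  then show ?case by (simp add: box_def pmon_def)
next
  case (insert v V)
  have b: "box (insert v V) n = (\<lambda>(k, e). e(v := k)) ` ({..n} \<times> box V n)"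
    unfolding box_def by (rule PiE_insert_eq)
  have inj: "inj_on (\<lambda>(k, e). e(v := k)) ({..n} \<times> box V n)"
    unfolding box_def by (rule inj_combinator[OF insert.hyps(2)])
  obtain k0 e1 where e1: "k0 \<le> n" "e1 \<in> box V n" "e0 = e1(v := k0)"
    using insert.prems(1) unfolding b by auto
  obtain p where p: "(\<Sum>e\<in>box V n. x (e(v := k0)) * pmon V p e) \<noteq> 0"
    using insert.IH[OF e1(2), of "\<lambda>e. x (e(v := k0))"] insert.prems(2)[unfolded e1(3)] by blast
  define C where "C k = (\<Sum>e\<in>box V n. x (e(v := k)) * pmon V p e)" for k
  define f where "f = (\<Sum>k\<le>n. monom (C k) k)"
  have "coeff f k0 = C k0" using e1 by (simp add: f_def coeff_sum)
  then have "f \<noteq> 0" using p by (auto simp: C_def)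
  then obtain t where t: "poly f t \<noteq> 0" by (metis poly_all_0_iff_0)
  have "(\<Sum>e\<in>box (insert v V) n. x e * pmon (insert v V) (p(v := t)) e) =
     (\<Sum>(k, e)\<in>{..n} \<times> box V n. x (e(v := k)) * pmon (insert v V) (p(v := t)) (e(v := k)))"
    unfolding b by (subst sum.reindex[OF inj]) (simp add: case_prod_unfold)
  also have "\<dots> = (\<Sum>k\<le>n. \<Sum>e\<in>box V n. x (e(v := k)) * pmon (insert v V) (p(v := t)) (e(v := k)))"
    by (simp add: sum.cartesian_product)
  also have "\<dots> = (\<Sum>k\<le>n. C k * t ^ k)"
  proof (rule sum.cong[OF refl])
    fix k
    have "pmon (insert v V) (p(v := t)) (e(v := k)) = t ^ k * pmon V p e" for e
    proof -
      have "pmon V (p(v := t)) (e(v := k)) = pmon V p e"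
        unfolding pmon_def using insert.hyps by (intro prod.cong) auto
      then show ?thesis using insert.hyps by (simp add: pmon_def)
    qed
    then show "(\<Sum>e\<in>box V n. x (e(v := k)) * pmon (insert v V) (p(v := t)) (e(v := k))) = C k * t ^ k"
      by (simp add: C_def sum_distrib_left sum_distrib_right mult_ac)
  qed
  also have "\<dots> = poly f t" by (simp add: f_def poly_sum poly_monom)
  finally show ?case using t by metis
qed

text \<open>
  The monomials with exponents at most \<open>n\<close> in the functions \<open>\<Phi> i\<close> are polynomials of degree at most \<open>n K\<close> in
  each of the variables \<open>U\<close>. There are \<open>(n + 1) ^ card V\<close> such monomials in a space of dimension
  \<open>(n K + 1) ^ card U\<close>, and the former number is larger if \<open>card U < card V\<close> and \<open>n\<close> is large.
\<close>

lemma polynomial_relation: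
  fixes \<Phi> :: "'i \<Rightarrow> ('j \<Rightarrow> complex) \<Rightarrow> complex"
  assumes U: "finite U" and V: "finite V" and card: "card U < card V" and \<Phi>: "\<And>i. i \<in> V \<Longrightarrow> polyfun U (\<Phi> i)"
  shows "\<exists>D :: 'i mpol. (\<forall>q. eval_pol D (\<lambda>i. \<Phi> i q) = 0) \<and> (\<exists>p. eval_pol D p \<noteq> 0) \<and>
    (\<forall>p p'. (\<forall>i\<in>V. p i = p' i) \<longrightarrow> eval_pol D p = eval_pol D p')"
proof -
  obtain N where N: "\<And>i. i \<in> V \<Longrightarrow> boxfun U (N i) (\<Phi> i)" using polyfun_boxfun[OF U \<Phi>] by metis
  define K where "K = (\<Sum>i\<in>V. N i) + 1"
  \<comment> \<open>then \<open>(n K + 1) ^ card U \<le> K ^ card U * (n + 1) ^ card U < (n + 1) ^ Suc (card U)\<close>\<close>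
  define n where "n = K ^ card U"
  have "boxfun U (n * K) (\<lambda>q. \<Prod>i\<in>V. \<Phi> i q ^ e i)" if "e \<in> box V n" for e
  proof (rule boxfun_mono[OF U])
    show "boxfun U (\<Sum>i\<in>V. e i * N i) (\<lambda>q. \<Prod>i\<in>V. \<Phi> i q ^ e i)"
      by (rule boxfun_prod[OF U V boxfun_power[OF U N]])
    have "(\<Sum>i\<in>V. e i * N i) \<le> (\<Sum>i\<in>V. n * N i)"
      using that by (intro sum_mono mult_right_mono) (auto simp: box_def PiE_iff)
    also have "\<dots> \<le> n * K" by (simp add: K_def sum_distrib_left)
    finally show "(\<Sum>i\<in>V. e i * N i) \<le> n * K" .
  qed
  then have "\<forall>e. \<exists>c. e \<in> box V n \<longrightarrow> (\<forall>q. (\<Prod>i\<in>V. \<Phi> i q ^ e i) = (\<Sum>f\<in>box U (n * K). c f * pmon U q f))"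
    unfolding boxfun_def by blast
  then obtain c where c: "\<And>e q. e \<in> box V n \<Longrightarrow> (\<Prod>i\<in>V. \<Phi> i q ^ e i) = (\<Sum>f\<in>box U (n * K). c e f * pmon U q f)"
    by metis
  have "card (box U (n * K)) < card (box V n)"
  proof -
    have "card (box U (n * K)) = (n * K + 1) ^ card U" using U by (simp add: card_box)
    also have "\<dots> \<le> (K * (n + 1)) ^ card U" by (intro power_mono) (simp_all add: K_def)
    also have "\<dots> = n * (n + 1) ^ card U" by (simp only: power_mult_distrib n_def)
    also have "\<dots> < (n + 1) ^ Suc (card U)" by simp
    also have "\<dots> \<le> (n + 1) ^ card V" using card by (intro power_increasing) auto
    finally show ?thesis using V by (simp add: card_box)
  qed
  then obtain x where x: "\<exists>e\<in>box V n. x e \<noteq> 0" "\<And>f. f \<in> box U (n * K) \<Longrightarrow> (\<Sum>e\<in>box V n. x e * c e f) = 0"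
    using homogeneous_linear_system[OF finite_box[OF U] finite_box[OF V], of "n * K" n c] by blast
  define D where "D = (\<Sum>e\<in>box V n. Const (x e) * (\<Prod>i\<in>V. Var i ^ e i))"
  have ev: "eval_pol D p = (\<Sum>e\<in>box V n. x e * pmon V p e)" for p
    by (simp add: D_def eval_pol_eq id_hom.eval_hom_sum id_hom.eval_hom_mult id_hom.eval_hom_prod id_hom.eval_hom_power pmon_def)
  show ?thesis
  proof (intro exI[of _ D] conjI allI)
    fix q
    have "eval_pol D (\<lambda>i. \<Phi> i q) = (\<Sum>e\<in>box V n. x e * (\<Sum>f\<in>box U (n * K). c e f * pmon U q f))"
      unfolding ev pmon_def by (intro sum.cong refl) (simp add: c pmon_def)
    also have "\<dots> = (\<Sum>e\<in>box V n. \<Sum>f\<in>box U (n * K). (x e * c e f) * pmon U q f)"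
      by (simp add: sum_distrib_left mult_ac)
    also have "\<dots> = (\<Sum>f\<in>box U (n * K). \<Sum>e\<in>box V n. (x e * c e f) * pmon U q f)" by (rule sum.swap)
    also have "\<dots> = (\<Sum>f\<in>box U (n * K). (\<Sum>e\<in>box V n. x e * c e f) * pmon U q f)"
      by (simp add: sum_distrib_right)
    also have "\<dots> = 0" using x(2) by (intro sum.neutral) simp
    finally show "eval_pol D (\<lambda>i. \<Phi> i q) = 0" .
  next
    show "\<exists>p. eval_pol D p \<noteq> 0" using x(1) pmon_sum_nonzero[OF V, of _ n x] unfolding ev by blast
  next
    fix p p' :: "'i \<Rightarrow> complex"
    show "(\<forall>i\<in>V. p i = p' i) \<longrightarrow> eval_pol D p = eval_pol D p'" unfolding ev pmon_def by simp
  qed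
qed

section \<open>The affine chart of a general member is smooth\<close>

definition monoms10 :: "(coord \<Rightarrow>\<^sub>0 nat) set" where "monoms10 = {m. monomial_weight m = 10}"

lemma finite_monoms10: "finite monoms10"
proof (rule inj_on_finite)
  show "inj_on lookup monoms10" by (rule inj_onI) (simp add: poly_mapping_eqI)
  show "lookup ` monoms10 \<subseteq> (\<Pi>\<^sub>E v\<in>UNIV. {..10})"
  proof (rule image_subsetI)
    fix m assume "m \<in> monoms10"
    then have "lookup m v \<le> 10" for v
      by (cases v) (auto simp: monoms10_def monomial_weight_eq)
    then show "lookup m \<in> (\<Pi>\<^sub>E v\<in>UNIV. {..10})" by (simp add: PiE_iff)
  qed
  show "finite (\<Pi>\<^sub>E v\<in>(UNIV :: coord set). {..10::nat})" by (rule finite_PiE) auto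
qed

text \<open>
  The monomial with the prescribed coefficient \<open>1\<close>, and the four monomials that restrict to \<open>1, x\<^sub>1, u\<^sub>0, z\<close>
  in the chart (\<open>chart_monoms\<close>).
\<close>

definition mz :: "coord \<Rightarrow>\<^sub>0 nat" where "mz = single cz 2"
definition m0 :: "coord \<Rightarrow>\<^sub>0 nat" where "m0 = single cx0 10"
definition m1 :: "coord \<Rightarrow>\<^sub>0 nat" where "m1 = single cx0 9 + single cx1 1"
definition m2 :: "coord \<Rightarrow>\<^sub>0 nat" where "m2 = single cx0 6 + single cu0 1"
definition m3 :: "coord \<Rightarrow>\<^sub>0 nat" where "m3 = single cx0 5 + single cz 1"

definition chart_monom :: "(coord \<Rightarrow>\<^sub>0 nat) \<Rightarrow> pol" where
  "chart_monom m = monom_eval (toric 1 x1 u0 zz) m"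

lemma chart_monoms: "chart_monom m0 = 1" "chart_monom m1 = x1" "chart_monom m2 = u0" "chart_monom m3 = zz"
  by (simp_all add: chart_monom_def m0_def m1_def m2_def m3_def monom_eval_add monom_eval_single)

lemma special_monoms: "{m0, m1, m2, m3, mz} \<subseteq> monoms10"
  by (simp add: monoms10_def mz_def m0_def m1_def m2_def m3_def monomial_weight_add monomial_weight_single)

lemma special_distinct: "distinct [m0, m1, m2, m3, mz]"
proof -
  have "lookup m0 cx0 = 10" "lookup m1 cx0 = 9" "lookup m2 cx0 = 6"
    "lookup m3 cx0 = 5" "lookup mz cx0 = 0"
    by (simp_all add: mz_def m0_def m1_def m2_def m3_def lookup_add lookup_single)
  then show ?thesis by auto
qed

definition monoms10' :: "(coord \<Rightarrow>\<^sub>0 nat) set" where "monoms10' = monoms10 - {m0, m1, m2, m3}"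

lemma affine_eq_expand:
  assumes "homogeneous 10 P"
  shows "affine_eq \<theta> \<tau> P = (\<Sum>m\<in>monoms10'. Const (lookup P m) * chart_monom m) +
    (Const (lookup P m0) + Const (lookup P m1) * x1 + Const (lookup P m2) * u0
      + Const (lookup P m3) * zz) +
    (x1 ^ 2 * (Const \<theta> * (x1 * u0) * zz) + u0 ^ 3) + Const \<tau> * x1 ^ 17"
proof -
  have "eval_hom Const (toric 1 x1 u0 zz) P = (\<Sum>m\<in>monoms10. Const (lookup P m) * chart_monom m)"
    unfolding chart_monom_def using assms
    by (intro Const_hom.eval_hom_superset finite_monoms10) (auto simp: monoms10_def homogeneous_def)
  also have "monoms10 = insert m0 (insert m1 (insert m2 (insert m3 monoms10')))"
    using special_monoms by (auto simp: monoms10'_def)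
  also have "(\<Sum>m\<in>insert m0 (insert m1 (insert m2 (insert m3 monoms10'))). Const (lookup P m) * chart_monom m)
     = (\<Sum>m\<in>monoms10'. Const (lookup P m) * chart_monom m) +
    (Const (lookup P m0) + Const (lookup P m1) * x1 + Const (lookup P m2) * u0
      + Const (lookup P m3) * zz)"
    using special_distinct finite_monoms10 by (simp add: monoms10'_def chart_monoms add_ac)
  finally show ?thesis
    by (simp add: affine_eq_def algebra_simps flip: power_add)
qed

text \<open>
  A member of the family that is singular in the chart is encoded by an assignment \<open>q\<close>: it contains \<open>\<tau>\<close> and the
  coefficients of the monomials outside \<open>m0, m1, m2, m3\<close>, and, instead of the coefficients of \<open>m1, m2, m3\<close>, the
  coordinates \<open>cpt q\<close> of the singular point. The coefficients of \<open>m1, m2, m3\<close> are recovered from the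
  vanishing of the partial derivatives (\<open>cdiff\<close>), and that of \<open>m0\<close> from the vanishing of the equation
  (\<open>cval\<close>). So a singular member is determined by one number less than it has coefficients.
\<close>

definition rest :: "complex \<Rightarrow> pol" where "rest \<theta> = x1 ^ 2 * (Const \<theta> * (x1 * u0) * zz) + u0 ^ 3"

definition params :: "(coord \<Rightarrow>\<^sub>0 nat) option set" where "params = insert None (Some ` (monoms10 - {mz}))"

definition cpt :: "((coord \<Rightarrow>\<^sub>0 nat) option \<Rightarrow> complex) \<Rightarrow> coord \<Rightarrow> complex" where
  "cpt q v = (if v = cx1 then q (Some m1) else if v = cu0 then q (Some m2) else if v = cz then q (Some m3) else 0)"

definition cdiff :: "complex \<Rightarrow> coord \<Rightarrow> ((coord \<Rightarrow>\<^sub>0 nat) option \<Rightarrow> complex) \<Rightarrow> complex" where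
  "cdiff \<theta> v q = - ((\<Sum>m\<in>monoms10'. (if m = mz then 1 else q (Some m)) * pdiff v (chart_monom m) (cpt q))
      + pdiff v (rest \<theta>) (cpt q) + q None * pdiff v (x1 ^ 17) (cpt q))"

definition cval :: "complex \<Rightarrow> ((coord \<Rightarrow>\<^sub>0 nat) option \<Rightarrow> complex) \<Rightarrow> complex" where
  "cval \<theta> q = - ((\<Sum>m\<in>monoms10'. (if m = mz then 1 else q (Some m)) * eval_pol (chart_monom m) (cpt q))
      + (cdiff \<theta> cx1 q * q (Some m1) + cdiff \<theta> cu0 q * q (Some m2) + cdiff \<theta> cz q * q (Some m3))
      + eval_pol (rest \<theta>) (cpt q) + q None * eval_pol (x1 ^ 17) (cpt q))"

definition singular_coeffs :: "complex \<Rightarrow> (coord \<Rightarrow>\<^sub>0 nat) option \<Rightarrow> ((coord \<Rightarrow>\<^sub>0 nat) option \<Rightarrow> complex) \<Rightarrow> complex" where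
  "singular_coeffs \<theta> i q = (if i = Some m0 then cval \<theta> q else if i = Some m1 then cdiff \<theta> cx1 q
     else if i = Some m2 then cdiff \<theta> cu0 q else if i = Some m3 then cdiff \<theta> cz q else q i)"

lemma polyfun_singular_coeffs:
  assumes "i \<in> params"
  shows "polyfun (params - {Some m0}) (singular_coeffs \<theta> i)"
proof -
  let ?U = "params - {Some m0}"
  have sp: "Some m1 \<in> ?U" "Some m2 \<in> ?U" "Some m3 \<in> ?U" "None \<in> ?U"
    using special_monoms special_distinct by (auto simp: params_def)
  have pt: "polyfun ?U (\<lambda>q. cpt q v)" for v
    unfolding cpt_def using polyfun.const[of ?U 0] sp(1-3)[THEN polyfun.var]
    by (cases "v = cx1"; cases "v = cu0"; cases "v = cz") simp_all
  have co: "polyfun ?U (\<lambda>q. if m = mz then 1 else q (Some m))" if "m \<in> monoms10'" for m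
  proof (cases "m = mz")
    case True show ?thesis unfolding if_P[OF True] by (rule polyfun.const)
  next
    case False
    show ?thesis unfolding if_not_P[OF False]
      by (rule polyfun.var) (use that False in \<open>auto simp: monoms10'_def params_def\<close>)
  qed
  have fin: "finite monoms10'" using finite_monoms10 by (simp add: monoms10'_def)
  have d: "polyfun ?U (cdiff \<theta> v)" for v
    unfolding cdiff_def[abs_def]
    by (intro polyfun_uminus polyfun.add polyfun.mult polyfun_sum polyfun_pdiff fin co pt polyfun.var sp)
  have "polyfun ?U (cval \<theta>)"
    unfolding cval_def[abs_def]
    by (intro polyfun_uminus polyfun.add polyfun.mult polyfun_sum polyfun_eval fin co pt polyfun.var sp d)
  then show ?thesis using d assms polyfun.var[of i ?U] unfolding singular_coeffs_def[abs_def]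
    by (cases "i = Some m0"; cases "i = Some m1"; cases "i = Some m2"; cases "i = Some m3") simp_all
qed

lemma singular_coeffs_eq:
  assumes P: "P \<in> P10_forms" and g: "eval_pol (affine_eq \<theta> \<tau> P) a = 0"
    and d: "\<And>v. v \<in> {cx1, cu0, cz} \<Longrightarrow> pdiff v (affine_eq \<theta> \<tau> P) a = 0" and i: "i \<in> params"
  defines "q \<equiv> (case_option \<tau> (lookup P))(Some m1 := a cx1, Some m2 := a cu0, Some m3 := a cz)"
  shows "singular_coeffs \<theta> i q = case_option \<tau> (lookup P) i"
proof -
  have hom: "homogeneous 10 P" and Pz: "lookup P mz = 1" using P by (auto simp: P10_forms_def mz_def)
  have dist: "m1 \<noteq> m2" "m1 \<noteq> m3" "m2 \<noteq> m3" using special_distinct by auto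
  have qs: "q (Some m1) = a cx1" "q (Some m2) = a cu0" "q (Some m3) = a cz" "q None = \<tau>"
    using dist by (auto simp: q_def)
  have qm: "(if m = mz then 1 else q (Some m)) = lookup P m" if "m \<in> monoms10'" for m
    using that Pz by (auto simp: q_def monoms10'_def)
  \<comment> \<open>the chart equation involves three coordinates only\<close>
  have three_ev: "eval_pol f (cpt q) = eval_pol f a \<and> (\<forall>v. pdiff v f (cpt q) = pdiff v f a)"
    if "f \<in> range chart_monom \<union> {rest \<theta>, x1 ^ 17}" for f
  proof -
    let ?C = "{f. eval_pol f (cpt q) = eval_pol f a \<and> (\<forall>v. pdiff v f (cpt q) = pdiff v f a)}"
    have C: "f + g \<in> ?C" "f * g \<in> ?C" if "f \<in> ?C" "g \<in> ?C" for f g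
      using that by (simp_all add: eval_pol_simps pdiff_add pdiff_mult)
    have one: "1 \<in> ?C" by (simp add: pdiff_one)
    have k: "Const c \<in> ?C" for c by simp
    have v: "x1 \<in> ?C" "u0 \<in> ?C" "zz \<in> ?C" by (simp_all add: cpt_def qs pdiff_Var)
    have pw: "f ^ n \<in> ?C" if "f \<in> ?C" for f n
      by (induction n) (use one C(2) that in auto)
    have tor: "toric 1 x1 u0 zz v \<in> ?C" for v
      using pw[OF one] pw[OF v(1)] pw[OF v(2)] C(2)[OF v(1,2)] v one
      by (cases v) (simp_all only: toric_simps power_one mult_1_right)
    have pr: "prod h S \<in> ?C" if "\<And>x. x \<in> S \<Longrightarrow> h x \<in> ?C" for h and S :: "coord set"
      using that by (induction S rule: infinite_finite_induct) (use one C(2) in auto)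
    have "chart_monom m \<in> ?C" for m
      unfolding chart_monom_def monom_eval_def by (rule pr[OF pw[OF tor]])
    moreover have "rest \<theta> \<in> ?C" unfolding rest_def by (intro C pw k v)
    moreover have "x1 ^ 17 \<in> ?C" by (intro pw v)
    ultimately show ?thesis using that by auto
  qed
  have ex: "affine_eq \<theta> \<tau> P = (\<Sum>m\<in>monoms10'. Const (lookup P m) * chart_monom m) +
    (Const (lookup P m0) + Const (lookup P m1) * x1 + Const (lookup P m2) * u0
      + Const (lookup P m3) * zz) + rest \<theta> + Const \<tau> * x1 ^ 17"
    unfolding rest_def by (rule affine_eq_expand[OF hom])
  have cd: "cdiff \<theta> v q = lookup P m1 * pdiff v x1 a + lookup P m2 * pdiff v u0 a + lookup P m3 * pdiff v zz a"
    if "v \<in> {cx1, cu0, cz}" for v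
  proof -
    have "(\<Sum>m\<in>monoms10'. (if m = mz then 1 else q (Some m)) * pdiff v (chart_monom m) (cpt q)) =
       (\<Sum>m\<in>monoms10'. lookup P m * pdiff v (chart_monom m) a)"
      by (rule sum.cong[OF refl]) (simp only: qm, use three_ev in simp)
    then have A: "- cdiff \<theta> v q = (\<Sum>m\<in>monoms10'. lookup P m * pdiff v (chart_monom m) a)
       + pdiff v (rest \<theta>) a + \<tau> * pdiff v (x1 ^ 17) a"
      using three_ev[of "rest \<theta>"] three_ev[of "x1 ^ 17"] by (simp add: cdiff_def qs)
    have B: "pdiff v (affine_eq \<theta> \<tau> P) a = (\<Sum>m\<in>monoms10'. lookup P m * pdiff v (chart_monom m) a)
        + (lookup P m1 * pdiff v x1 a + lookup P m2 * pdiff v u0 a + lookup P m3 * pdiff v zz a)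
       + pdiff v (rest \<theta>) a + \<tau> * pdiff v (x1 ^ 17) a"
      unfolding ex by (simp add: pdiff_add pdiff_sum pdiff_mult)
    have "(lookup P m1 * pdiff v x1 a + lookup P m2 * pdiff v u0 a + lookup P m3 * pdiff v zz a)
        + (- cdiff \<theta> v q) = pdiff v (affine_eq \<theta> \<tau> P) a"
      unfolding A B by (simp only: add_ac)
    then show ?thesis unfolding d[OF that] eq_neg_iff_add_eq_0[symmetric] minus_minus by (rule sym)
  qed
  have c1: "cdiff \<theta> cx1 q = lookup P m1" and c2: "cdiff \<theta> cu0 q = lookup P m2"
    and c3: "cdiff \<theta> cz q = lookup P m3"
    using cd[of cx1] cd[of cu0] cd[of cz] by (simp_all add: pdiff_Var)
  have c0: "cval \<theta> q = lookup P m0"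
  proof -
    have "(\<Sum>m\<in>monoms10'. (if m = mz then 1 else q (Some m)) * eval_pol (chart_monom m) (cpt q)) =
       (\<Sum>m\<in>monoms10'. lookup P m * eval_pol (chart_monom m) a)"
      by (rule sum.cong[OF refl]) (simp only: qm, use three_ev in simp)
    then have A: "- cval \<theta> q = (\<Sum>m\<in>monoms10'. lookup P m * eval_pol (chart_monom m) a)
       + (lookup P m1 * a cx1 + lookup P m2 * a cu0 + lookup P m3 * a cz)
       + eval_pol (rest \<theta>) a + \<tau> * eval_pol (x1 ^ 17) a"
      using three_ev[of "rest \<theta>"] three_ev[of "x1 ^ 17"] by (simp add: cval_def qs c1 c2 c3)
    have B: "eval_pol (affine_eq \<theta> \<tau> P) a = (\<Sum>m\<in>monoms10'. lookup P m * eval_pol (chart_monom m) a)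
        + (lookup P m0 + lookup P m1 * a cx1 + lookup P m2 * a cu0 + lookup P m3 * a cz)
       + eval_pol (rest \<theta>) a + \<tau> * eval_pol (x1 ^ 17) a"
      unfolding ex by (simp add: eval_pol_eq id_hom.eval_hom_simps id_hom.eval_hom_sum)
    have "lookup P m0 + (- cval \<theta> q) = eval_pol (affine_eq \<theta> \<tau> P) a"
      unfolding A B by (simp only: add_ac)
    then show ?thesis unfolding g eq_neg_iff_add_eq_0[symmetric] minus_minus by (rule sym)
  qed
  show ?thesis
    unfolding singular_coeffs_def c0 c1 c2 c3 by (auto simp: q_def split: option.split)
qed

text \<open>
  The coefficients of singular members are values of \<open>singular_coeffs\<close>, so they satisfy a polynomial
  equation by \<open>polynomial_relation\<close>. The factor \<open>\<tau>\<close> of \<open>D\<close> excludes \<open>\<tau> = 0\<close>.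
\<close>

lemma general_smooth:
  obtains D :: "(coord \<Rightarrow>\<^sub>0 nat) option mpol" where
    "\<exists>\<tau>. \<exists>P\<in>P10_forms. eval_pol D (case_option \<tau> (lookup P)) \<noteq> 0"
    "\<And>\<tau> P. P \<in> P10_forms \<Longrightarrow> eval_pol D (case_option \<tau> (lookup P)) \<noteq> 0 \<Longrightarrow> \<tau> \<noteq> 0"
    "\<And>\<tau> P a. P \<in> P10_forms \<Longrightarrow> eval_pol D (case_option \<tau> (lookup P)) \<noteq> 0 \<Longrightarrow>
       eval_pol (affine_eq \<theta> \<tau> P) a = 0 \<Longrightarrow> \<exists>v\<in>{cx1, cu0, cz}. pdiff v (affine_eq \<theta> \<tau> P) a \<noteq> 0"
proof -
  have fin: "finite params" using finite_monoms10 by (simp add: params_def)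
  have m0: "Some m0 \<in> params" using special_monoms special_distinct by (auto simp: params_def)
  have card: "card (params - {Some m0}) < card params" using fin m0 by (rule card_Diff1_less)
  have "\<exists>D. (\<forall>q. eval_pol D (\<lambda>i. singular_coeffs \<theta> i q) = 0) \<and> (\<exists>p. eval_pol D p \<noteq> 0) \<and>
      (\<forall>p p'. (\<forall>i\<in>params. p i = p' i) \<longrightarrow> eval_pol D p = eval_pol D p')"
    by (rule polynomial_relation[OF finite_Diff[OF fin] fin card]) (rule polyfun_singular_coeffs)
  then obtain D0 where D0: "\<forall>q. eval_pol D0 (\<lambda>i. singular_coeffs \<theta> i q) = 0" "\<exists>p. eval_pol D0 p \<noteq> 0"
    and D0_cong: "\<forall>p p'. (\<forall>i\<in>params. p i = p' i) \<longrightarrow> eval_pol D0 p = eval_pol D0 p'"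
    by blast
  define D where "D = Var None * D0"
  have D: "eval_pol D p = p None * eval_pol D0 p" for p by (simp add: D_def eval_pol_simps)
  show ?thesis
  proof (rule that[of D])
    obtain p where p: "eval_pol D0 p \<noteq> 0" using D0(2) by blast
    \<comment> \<open>as a polynomial in \<open>\<tau>\<close> alone, \<open>D0\<close> is nonzero, so some \<open>\<tau> \<noteq> 0\<close> is not a root\<close>
    define L where "L = eval_hom (\<lambda>c. [:c:]) (\<lambda>w. if w = None then [:0, 1:] else [:p w:]) D0"
    have L: "poly L t = eval_pol D0 (p(None := t))" for t
    proof -
      have e: "(\<lambda>w. if w = None then [:0, 1:] else [:p w:]) = (\<lambda>w. if w = None then [:0, 1:] else [:(p(None := t)) w:])" by auto
      show ?thesis unfolding L_def e using poly_line[of None "p(None := t)" D0] by simp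
    qed
    have "L \<noteq> 0" using L[of "p None"] p by auto
    then have "finite ({t. poly L t = 0} \<union> {0})" using poly_roots_finite by simp
    then obtain t where t: "t \<notin> {t. poly L t = 0} \<union> {0}" using ex_new_if_finite[OF infinite_UNIV_char_0] by blast
    define P where "P = (\<Sum>m\<in>monoms10. single m (if m = mz then 1 else p (Some m)))"
    have lk: "lookup P m = (if m = mz then 1 else p (Some m))" if "m \<in> monoms10" for m
    proof -
      have "lookup P m = (\<Sum>n\<in>monoms10. if n = m then (if m = mz then 1 else p (Some m)) else 0)"
        unfolding P_def lookup_sum by (intro sum.cong) (auto simp: lookup_single when_def)
      then show ?thesis using that finite_monoms10 by simp
    qed
    have "homogeneous 10 P"
      unfolding P_def by (intro homogeneous_sum homogeneous_single) (simp add: monoms10_def)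
    moreover have "lookup P mz = 1" using lk[of mz] special_monoms by simp
    ultimately have "P \<in> P10_forms" by (simp add: P10_forms_def mz_def)
    moreover have "eval_pol D0 (case_option t (lookup P)) = eval_pol D0 (p(None := t))"
      by (rule D0_cong[rule_format]) (auto simp: params_def lk split: if_splits)
    ultimately show "\<exists>\<tau>. \<exists>P\<in>P10_forms. eval_pol D (case_option \<tau> (lookup P)) \<noteq> 0"
      using t L by (intro exI[of _ t] bexI[of _ P]) (auto simp: D)
  next
    fix \<tau> P assume "eval_pol D (case_option \<tau> (lookup P)) \<noteq> 0"
    then show "\<tau> \<noteq> 0" by (auto simp: D)
  next
    fix \<tau> P a assume P: "P \<in> P10_forms" and nz: "eval_pol D (case_option \<tau> (lookup P)) \<noteq> 0"
      and g: "eval_pol (affine_eq \<theta> \<tau> P) a = 0"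
    show "\<exists>v\<in>{cx1, cu0, cz}. pdiff v (affine_eq \<theta> \<tau> P) a \<noteq> 0"
    proof (rule ccontr)
      assume "\<not> ?thesis"
      then have d: "\<And>v. v \<in> {cx1, cu0, cz} \<Longrightarrow> pdiff v (affine_eq \<theta> \<tau> P) a = 0" by blast
      let ?q = "(case_option \<tau> (lookup P))(Some m1 := a cx1, Some m2 := a cu0, Some m3 := a cz)"
      have "eval_pol D0 (case_option \<tau> (lookup P)) = eval_pol D0 (\<lambda>i. singular_coeffs \<theta> i ?q)"
        by (rule D0_cong[rule_format]) (simp only: singular_coeffs_eq[OF P g d])
      then show False using nz D0(1) by (simp add: D)
    qed
  qed
qed

section \<open>The singular locus\<close>

lemma self_in_orbit: "a \<in> orbit a"
  unfolding orbit_def by (auto simp: scale_def intro!: exI[of _ 1])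

lemma orbit_scale: "l \<noteq> 0 \<Longrightarrow> orbit (scale l a) = orbit a"
proof -
  assume l: "l \<noteq> 0"
  have c: "scale k (scale l a) = scale (k * l) a" for k l :: complex
    by (auto simp: scale_def power_mult_distrib mult_ac)
  show ?thesis
  proof (rule equalityI; rule subsetI)
    fix b assume "b \<in> orbit (scale l a)"
    then obtain k where "k \<noteq> 0" "b = scale (k * l) a" by (auto simp: orbit_def c)
    then show "b \<in> orbit a" using l by (auto simp: orbit_def intro!: exI[of _ "k * l"])
  next
    fix b assume "b \<in> orbit a"
    then obtain k where "k \<noteq> 0" "b = scale k a" by (auto simp: orbit_def)
    then have "b = scale (k / l) (scale l a)" "k / l \<noteq> 0" using l by (auto simp: c)
    then show "b \<in> orbit (scale l a)" unfolding orbit_def by blast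
  qed
qed

lemma zero_locusE:
  assumes "p \<in> zero_locus (relations \<theta> \<tau> P)" "homogeneous 10 P"
  obtains a where "p = orbit a" "a \<noteq> (\<lambda>_. 0)" "\<And>l. l \<noteq> 0 \<Longrightarrow> surface_point \<theta> \<tau> P (scale l a)" "surface_point \<theta> \<tau> P a"
proof -
  obtain a where a: "p = orbit a" "a \<noteq> (\<lambda>_. 0)" using assms by (auto simp: zero_locus_def wproj_def orbit_def)
  have sp: "surface_point \<theta> \<tau> P b" if "b \<in> p" for b
    using that assms by (intro surface_point.intro scheme_point.intro surface_point_axioms.intro) (auto simp: zero_locus_def)
  show ?thesis
  proof (rule that[OF a])
    show "surface_point \<theta> \<tau> P (scale l a)" if "l \<noteq> 0" for l
      using that by (intro sp) (auto simp: a orbit_def)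
    show "surface_point \<theta> \<tau> P a" by (intro sp) (simp add: a self_in_orbit)
  qed
qed

lemma pz_on_surface: "orbit pz \<in> zero_locus (relations \<theta> \<tau> P)"
proof -
  have "eval_pol f b = 0" if "b \<in> orbit pz" "f \<in> relations \<theta> \<tau> P" for b f
  proof -
    from that(1) obtain l where l: "b = scale l pz" by (auto simp: orbit_def)
    have "b cx0 = 0" "b cx1 = 0" "b cy = 0" "b cw = 0" "b cu0 = 0" "b cu1 = 0" "b ct = 0"
      by (simp_all add: l scale_def pz_def)
    then have "\<forall>f\<in>relations \<theta> \<tau> P. eval_hom (\<lambda>c. c) b f = 0"
      unfolding id_hom.eval_relations Let_def by simp
    then show ?thesis using that(2) by (simp add: eval_pol_eq)
  qed
  moreover have "orbit pz \<in> wproj"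
    unfolding wproj_def orbit_def by (auto simp: pz_def fun_eq_iff intro!: exI[of _ pz])
  ultimately show ?thesis by (simp add: zero_locus_def)
qed

lemma singular_point:
  assumes "P \<in> P10_forms"
  shows "\<not> regular_local_ring (local_ring (relations \<theta> \<tau> P) (orbit pz))"
    and "of_type (relations \<theta> \<tau> P) (orbit pz) 25 1 14"
proof -
  have hom: "homogeneous 10 P" using assms by (simp add: P10_forms_def)
  obtain l where l: "cf 0 0 l = 0"
    "l * eval_hom fc (toric l sV tV 1) P + sV ^ 2 * (fc \<theta> * (sV * tV) * 1 + fc \<tau> * sV ^ 15) + tV ^ 3 = 0"
    by (rule exists_toric_lift_pz[OF assms])
  have sp: "surface_point \<theta> \<tau> P pz"
    using pz_on_surface[of \<theta> \<tau> P] self_in_orbit[of pz] hom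
    by (intro surface_point.intro scheme_point.intro surface_point_axioms.intro) (auto simp: zero_locus_def)
  interpret formal_surface_point \<theta> \<tau> P pz "toric l sV tV 1"
  proof (rule formal_surface_pointI[OF sp])
    show "cf 0 0 (toric l sV tV 1 v) = pz v" for v
      using fun_cong[OF toric_const[of l sV tV 1], of v] by (simp add: l cf_st_0 cf_one toric_pz)
    show "eval_hom fc (toric l sV tV 1) f = 0" if "f \<in> relations \<theta> \<tau> P" for f
      by (rule fc_hom.toric_relations[OF l(2) that])
  qed
  interpret point_z \<theta> \<tau> P l by standard (use assms l in simp_all)
  have R: "local_ring (relations \<theta> \<tau> P) (orbit pz) = R" by (rule local_ring_orbit)
  show "\<not> regular_local_ring (local_ring (relations \<theta> \<tau> P) (orbit pz))"
    unfolding R by (rule not_regular)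
  obtain h where h: "h \<in> ring_iso (completion R (proj ` locM pz)) (quotient_plane_ring 25 1 14)"
     "\<forall>c\<in>carrier R. h (to_completion R (proj ` locM pz) c) = phi c"
    using completed_local_ring by blast
  have lc: "local_const (relations \<theta> \<tau> P) (orbit pz) c = proj (emb (Const c))" for c
    unfolding local_const_def ambient_local_ring_orbit local_ideal_orbit emb_def proj_def ..
  have "h (to_completion R (proj ` locM pz) (proj (emb (Const c)))) = fps_const (fps_const c)" for c
  proof -
    have "phi (proj (emb (Const c))) = fc c"
      using Phi_const[of c] by (simp add: phi_proj[OF emb_Const_in_locA]) (simp add: emb_def)
    then show ?thesis using h(2) proj_in[OF emb_Const_in_locA] by (simp add: fc_def)
  qed
  then show "of_type (relations \<theta> \<tau> P) (orbit pz) 25 1 14"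
    unfolding of_type_def Let_def R nonunits_R lc using pz_on_surface h(1) by blast
qed

text \<open>
  A point with \<open>x\<^sub>0 \<noteq> 0\<close> is scaled to \<open>x\<^sub>0 = 1\<close>. On the curve \<open>x\<^sub>0 = 0\<close>, \<open>w \<noteq> 0\<close> implies \<open>u\<^sub>1 \<noteq> 0\<close> as \<open>\<tau> \<noteq> 0\<close>, and scaling by \<open>w / u\<^sub>1\<close>
  makes these coordinates equal. The only point left has all coordinates but \<open>z\<close> equal to \<open>0\<close>.
\<close>

theorem general_singular_locus:
  assumes P: "P \<in> P10_forms" and \<tau>: "\<tau> \<noteq> 0"
    and smooth: "\<And>a. eval_pol (affine_eq \<theta> \<tau> P) a = 0 \<Longrightarrow> \<exists>v\<in>{cx1, cu0, cz}. pdiff v (affine_eq \<theta> \<tau> P) a \<noteq> 0"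
  shows "singular_locus (relations \<theta> \<tau> P) = {orbit pz}"
proof -
  have hom: "homogeneous 10 P" using P by (simp add: P10_forms_def)
  have "p = orbit pz" if p: "p \<in> zero_locus (relations \<theta> \<tau> P)" "\<not> regular_local_ring (local_ring (relations \<theta> \<tau> P) p)" for p
  proof -
    obtain a where a: "p = orbit a" "a \<noteq> (\<lambda>_. 0)" "\<And>l. l \<noteq> 0 \<Longrightarrow> surface_point \<theta> \<tau> P (scale l a)" "surface_point \<theta> \<tau> P a"
      by (rule zero_locusE[OF p(1) hom]) blast
    have a0: "a cx0 = 0"
    proof (rule ccontr)
      assume "a cx0 \<noteq> 0"
      then have l: "inverse (a cx0) \<noteq> 0" and one: "scale (inverse (a cx0)) a cx0 = 1" by (simp_all add: scale_def)
      note sp = a(3)[OF l]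
      obtain v where "v \<in> {cx1, cu0, cz}" "pdiff v (affine_eq \<theta> \<tau> P) (scale (inverse (a cx0)) a) \<noteq> 0"
        using smooth[OF affine_point(2)[OF sp one]] by blast
      then have "regular_local_ring (local_ring (relations \<theta> \<tau> P) (orbit (scale (inverse (a cx0)) a)))"
        by (rule regular_affine_chart[OF sp one])
      then show False using p(2) a(1) orbit_scale[OF l] by simp
    qed
    note pt = curve_point[OF a(4) a0]
    have w: "a cw = 0"
    proof (rule ccontr)
      assume w: "a cw \<noteq> 0"
      have u: "a cu1 \<noteq> 0" using pt(5) w \<tau> by auto
      \<comment> \<open>\<open>w\<close> and \<open>u\<^sub>1\<close> have weights \<open>3\<close> and \<open>4\<close>\<close>
      define l where "l = a cw / a cu1"
      have l: "l \<noteq> 0" using w u by (simp add: l_def)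
      have "scale l a cw = scale l a cu1" "scale l a cw \<noteq> 0" "scale l a cx0 = 0"
        using w u a0 by (simp_all add: scale_def l_def field_simps eval_nat_numeral)
      then have "regular_local_ring (local_ring (relations \<theta> \<tau> P) (orbit (scale l a)))"
        by (intro regular_on_curve[OF a(3)[OF l]])
      then show False using p(2) a(1) orbit_scale[OF l] by simp
    qed
    then have u: "a cu1 = 0" using pt(5) by simp
    obtain l where l: "l ^ 5 = a cz" using complex_fifth_root by blast
    have "a = scale l pz"
    proof
      show "a v = scale l pz v" for v
        by (cases v) (simp_all add: scale_def pz_def a0 pt w u l)
    qed
    moreover have "l \<noteq> 0"
    proof
      assume "l = 0"
      then have "a = (\<lambda>_. 0)" using \<open>a = scale l pz\<close> by (auto simp: scale_def fun_eq_iff pz_def)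
      then show False using a(2) by simp
    qed
    ultimately show ?thesis using a(1) orbit_scale by metis
  qed
  then show ?thesis
    unfolding singular_locus_def using pz_on_surface singular_point(1)[OF P] by blast
qed

theorem corollary3p11:
  fixes \<theta> :: complex
  shows "(\<forall>\<tau> P. homogeneous 10 P \<longrightarrow>
            (let M = M_mat \<theta> \<tau> P; N = Pf4 M \<union> set\<^sub>v (M *\<^sub>v V_vec) in
             (\<forall>f\<in>relations \<theta> \<tau> P. f \<in> N \<or> - f \<in> N) \<and>
             pol_ideal N = pol_ideal (relations \<theta> \<tau> P))) \<and>
         for_general (\<lambda>\<tau> P. \<exists>p. singular_locus (relations \<theta> \<tau> P) = {p} \<and>
            of_type (relations \<theta> \<tau> P) p 25 1 14)"
proof
  show "\<forall>\<tau> P. homogeneous 10 P \<longrightarrow>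
            (let M = M_mat \<theta> \<tau> P; N = Pf4 M \<union> set\<^sub>v (M *\<^sub>v V_vec) in
             (\<forall>f\<in>relations \<theta> \<tau> P. f \<in> N \<or> - f \<in> N) \<and>
             pol_ideal N = pol_ideal (relations \<theta> \<tau> P))"
    unfolding Let_def using pfaffian_presentation by blast
  obtain D where D: "\<exists>\<tau>. \<exists>P\<in>P10_forms. eval_pol D (case_option \<tau> (lookup P)) \<noteq> 0"
    "\<And>\<tau> P. P \<in> P10_forms \<Longrightarrow> eval_pol D (case_option \<tau> (lookup P)) \<noteq> 0 \<Longrightarrow> \<tau> \<noteq> 0"
    "\<And>\<tau> P a. P \<in> P10_forms \<Longrightarrow> eval_pol D (case_option \<tau> (lookup P)) \<noteq> 0 \<Longrightarrow>
       eval_pol (affine_eq \<theta> \<tau> P) a = 0 \<Longrightarrow> \<exists>v\<in>{cx1, cu0, cz}. pdiff v (affine_eq \<theta> \<tau> P) a \<noteq> 0"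
    by (rule general_smooth[of \<theta>]) blast
  show "for_general (\<lambda>\<tau> P. \<exists>p. singular_locus (relations \<theta> \<tau> P) = {p} \<and>
            of_type (relations \<theta> \<tau> P) p 25 1 14)"
    unfolding for_general_def Let_def
  proof (intro exI[of _ D] conjI allI ballI impI D(1))
    fix \<tau> P assume P: "P \<in> P10_forms" and nz: "eval_pol D (case_option \<tau> (lookup P)) \<noteq> 0"
    show "\<exists>p. singular_locus (relations \<theta> \<tau> P) = {p} \<and> of_type (relations \<theta> \<tau> P) p 25 1 14"
      using general_singular_locus[OF P D(2)[OF P nz] D(3)[OF P nz]] singular_point(2)[OF P] by blast
  qed
qed

end
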